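(* Let $W$ be a restricted $\mathcal{L}^*$-module of level $\ell_{1234}$. Then there exists a $\phi$-coordinated $V_{\widehat{\mathfrak{L}^*}}(\ell_{1234},0)$-module structure $Y_W(\cdot,x)$ on $W$, uniquely determined by $$Y_W((T^m)_{-1}\mathbf{1},x)=T_m(x),\qquad Y_W((E^m)_{-1}\mathbf{1},x)=E_m(x)\qquad(m\in\mathbb{Z}).$$
   Context: The rank two twisted Heisenberg–Virasoro algebra $\mathcal{L}^*$ has basis $\{t_1^mt_2^n, E_{m,n}: (m,n)\in\mathbb{Z}^2\setminus\{(0,0)\}\}\cup\{K_1,K_2,K_3,K_4\}$, $K_i$ central, with $[t_1^mt_2^n,t_1^rt_2^s]=0$, $[t_1^mt_2^n,E_{r,s}]=(nr-ms)t_1^{m+r}t_2^{n+s}+\delta_{m+r,0}\delta_{n+s,0}(mK_1+nK_2)$, $[E_{m,n},E_{r,s}]=(nr-ms)E_{m+r,n+s}+\delta_{m+r,0}\delta_{n+s,0}(mK_3+nK_4)$ (terms with index $(0,0)$ are interpreted as $0$). Set $T_m(x)=\sum_{n\in\mathbb{Z}}t_1^mt_2^nx^{-n}$ and $E_m(x)=\sum_nE_{m,n}x^{-n}$ (omitting $(0,0)$ terms). An $\mathcal{L}^*$-module $W$ is restricted if $T_m(x),E_m(x)\in\mathrm{Hom}(W,W((x)))$ for all $m$, i.e. for each $w$, $t_1^mt_2^nw=0$ and $E_{m,n}w=0$ for $n$ sufficiently large; it has level $\ell_{1234}$ if $K_i$ acts as $\ell_i\in\mathbb{C}$. $\widehat{\mathfrak{L}^*}$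 is the Lie algebra with basis $\{T^m\otimes t^n, E^r\otimes t^s:(m,n),(r,s)\in\mathbb{Z}^2\}\cup\{K_1,\dots,K_4\}$, $K_i$ central, $[T^m\otimes t^n,T^r\otimes t^s]=0$, $[T^m\otimes t^n,E^r\otimes t^s]=(nr-ms)T^{m+r}\otimes t^{n+s-1}+m\delta_{m+r,0}\delta_{n+s+1,0}K_1+n\delta_{m+r,0}\delta_{n+s,0}K_2$, $[E^m\otimes t^n,E^r\otimes t^s]=(nr-ms)E^{m+r}\otimes t^{n+s-1}+m\delta_{m+r,0}\delta_{n+s+1,0}K_3+n\delta_{m+r,0}\delta_{n+s,0}K_4$. Write $(T^m)_n=T^m\otimes t^n$, $(E^r)_s=E^r\otimes t^s$. $V_{\widehat{\mathfrak{L}^*}}(\ell_{1234},0)=U(\widehat{\mathfrak{L}^*})\otimes_{U(\widehat{\mathfrak{L}^*}_{\ge0})}\mathbb{C}$, where $\widehat{\mathfrak{L}^*}_{\ge0}$ is spanned by $T^m\otimes t^n,E^r\otimes t^n$ ($n\ge0$) acting as $0$ and $K_i$ acting as $\ell_i$; $\mathbf{1}=1\otimes1$. It is a vertex algebra with vacuum $\mathbf{1}$, $Y((T^m)_{-1}\mathbf{1},x)=\sum_n(T^m)_nx^{-n-1}$, $Y((E^r)_{-1}\mathbf{1},x)=\sum_s(E^r)_sx^{-s-1}$, generated by $\{(T^m)_{-1}\mathbf{1},(E^r)_{-1}\mathbf{1}\}$. A $\phi$-coordinated module ($\phi(x,z)=xe^z$) for a vertex algebra $V$ is a space $W$ with a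 linear map $Y_W(\cdot,x):V\to\mathrm{Hom}(W,W((x)))$ such that $Y_W(\mathbf{1},x)=\mathbf{1}_W$ and for $u,v\in V$ there is $k\in\mathbb{N}$ with $(x_1-x_2)^kY_W(u,x_1)Y_W(v,x_2)\in\mathrm{Hom}(W,W((x_1,x_2)))$ and $(x_2e^z-x_2)^kY_W(Y(u,z)v,x_2)=((x_1-x_2)^kY_W(u,x_1)Y_W(v,x_2))|_{x_1=x_2e^z}$. *)

theory Defs
  imports Complex_Main "HOL-Library.Function_Algebras"
begin

text \<open>The operator of t1^m t2^n (resp. E_{m,n}) on W is given by a function
  act m n; index (0,0) is not a basis element and is interpreted as 0.\<close>

definition zact :: "(int \<Rightarrow> int \<Rightarrow> 'w \<Rightarrow> 'w) \<Rightarrow> int \<Rightarrow> int \<Rightarrow> 'w \<Rightarrow> ('w::zero)" where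
  "zact act m n w = (if m = 0 \<and> n = 0 then 0 else act m n w)"

definition restricted_Lstar_module ::
  "(complex \<Rightarrow> 'w::ab_group_add \<Rightarrow> 'w) \<Rightarrow> complex \<Rightarrow> complex \<Rightarrow> complex \<Rightarrow> complex \<Rightarrow>
   (int \<Rightarrow> int \<Rightarrow> 'w \<Rightarrow> 'w) \<Rightarrow> (int \<Rightarrow> int \<Rightarrow> 'w \<Rightarrow> 'w) \<Rightarrow> bool" where
  "restricted_Lstar_module sc l1 l2 l3 l4 tact eact \<longleftrightarrow>
     \<comment> \<open>each basis element acts linearly\<close>
     (\<forall>m n w w'. zact tact m n (w + w') = zact tact m n w + zact tact m n w') \<and>
     (\<forall>m n c w. zact tact m n (sc c w) = sc c (zact tact m n w)) \<and>
     (\<forall>m n w w'. zact eact m n (w + w') = zact eact m n w + zact eact m n w') \<and>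
     (\<forall>m n c w. zact eact m n (sc c w) = sc c (zact eact m n w)) \<and>
     \<comment> \<open>bracket relations, K_i acting as l_i\<close>
     (\<forall>m n r s w. (m, n) \<noteq> (0, 0) \<longrightarrow> (r, s) \<noteq> (0, 0) \<longrightarrow>
        zact tact m n (zact tact r s w) = zact tact r s (zact tact m n w)) \<and>
     (\<forall>m n r s w. (m, n) \<noteq> (0, 0) \<longrightarrow> (r, s) \<noteq> (0, 0) \<longrightarrow>
        zact tact m n (zact eact r s w) - zact eact r s (zact tact m n w) =
        sc (of_int (n * r - m * s)) (zact tact (m + r) (n + s) w) +
        (if m + r = 0 \<and> n + s = 0 then sc (of_int m * l1 + of_int n * l2) w else 0)) \<and>
     (\<forall>m n r s w. (m, n) \<noteq> (0, 0) \<longrightarrow> (r, s) \<noteq> (0, 0) \<longrightarrow>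
        zact eact m n (zact eact r s w) - zact eact r s (zact eact m n w) =
        sc (of_int (n * r - m * s)) (zact eact (m + r) (n + s) w) +
        (if m + r = 0 \<and> n + s = 0 then sc (of_int m * l3 + of_int n * l4) w else 0)) \<and>
     \<comment> \<open>restrictedness\<close>
     (\<forall>m w. \<exists>N. \<forall>n\<ge>N. zact tact m n w = 0 \<and> zact eact m n w = 0)"

text \<open>Basis of hat L*: HT m n = T^m \<otimes> t^n, HE m n = E^m \<otimes> t^n, HK1..HK4 = K_1..K_4.\<close>

datatype hb = HT int int | HE int int | HK1 | HK2 | HK3 | HK4

fun br :: "hb \<Rightarrow> hb \<Rightarrow> (complex \<times> hb) list" where
  "br (HT m n) (HE r s) =
     [(of_int (n * r - m * s), HT (m + r) (n + s - 1)),
      (if m + r = 0 \<and> n + s + 1 = 0 then of_int m else 0, HK1),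
      (if m + r = 0 \<and> n + s = 0 then of_int n else 0, HK2)]"
| "br (HE r s) (HT m n) =
     [(- of_int (n * r - m * s), HT (m + r) (n + s - 1)),
      (if m + r = 0 \<and> n + s + 1 = 0 then - of_int m else 0, HK1),
      (if m + r = 0 \<and> n + s = 0 then - of_int n else 0, HK2)]"
| "br (HE m n) (HE r s) =
     [(of_int (n * r - m * s), HE (m + r) (n + s - 1)),
      (if m + r = 0 \<and> n + s + 1 = 0 then of_int m else 0, HK3),
      (if m + r = 0 \<and> n + s = 0 then of_int n else 0, HK4)]"
| "br _ _ = []"

text \<open>Elements of the tensor algebra T(hat L*) as finitely supported coefficient functions on
  words; the word [x1,...,xk] stands for the product x1 x2 ... xk.\<close>

type_synonym tv = "hb list \<Rightarrow> complex"

definition Fin :: "tv \<Rightarrow> bool" where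
  "Fin f \<longleftrightarrow> finite {w. f w \<noteq> 0}"

definition mono :: "hb list \<Rightarrow> tv" where
  "mono p = (\<lambda>w. if w = p then 1 else 0)"

definition smul :: "complex \<Rightarrow> tv \<Rightarrow> tv" where
  "smul c f = (\<lambda>w. c * f w)"

definition lmul :: "hb \<Rightarrow> tv \<Rightarrow> tv" where
  "lmul x f = (\<lambda>w. case w of [] \<Rightarrow> 0 | y # w' \<Rightarrow> if y = x then f w' else 0)"

fun nonneg_mode :: "hb \<Rightarrow> bool" where
  "nonneg_mode (HT m n) = (n \<ge> 0)"
| "nonneg_mode (HE m n) = (n \<ge> 0)"
| "nonneg_mode _ = False"

text \<open>Jset: preimage in T(hat L*) of the left ideal U(hat L*)\<cdot>{x - chi(x) : x \<in> hat L*_{\<ge>0}},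
  i.e. the two-sided ideal defining U(hat L*) plus the left ideal generated by the
  nonnegative modes and K_i - l_i.  V(l1234,0) = T / Jset, vacuum = class of [].\<close>

inductive_set Jset :: "complex \<Rightarrow> complex \<Rightarrow> complex \<Rightarrow> complex \<Rightarrow> tv set"
  for l1 l2 l3 l4 :: complex where
  J0: "0 \<in> Jset l1 l2 l3 l4"
| Jadd: "a \<in> Jset l1 l2 l3 l4 \<Longrightarrow> b \<in> Jset l1 l2 l3 l4 \<Longrightarrow> a + b \<in> Jset l1 l2 l3 l4"
| Jsmul: "a \<in> Jset l1 l2 l3 l4 \<Longrightarrow> smul c a \<in> Jset l1 l2 l3 l4"
| Jcomm: "mono (p @ [x, y] @ q) - mono (p @ [y, x] @ q)
            - (\<Sum>(c, z)\<leftarrow>br x y. smul c (mono (p @ [z] @ q))) \<in> Jset l1 l2 l3 l4"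
| Jpos: "nonneg_mode x \<Longrightarrow> mono (p @ [x]) \<in> Jset l1 l2 l3 l4"
| JK1: "mono (p @ [HK1]) - smul l1 (mono p) \<in> Jset l1 l2 l3 l4"
| JK2: "mono (p @ [HK2]) - smul l2 (mono p) \<in> Jset l1 l2 l3 l4"
| JK3: "mono (p @ [HK3]) - smul l3 (mono p) \<in> Jset l1 l2 l3 l4"
| JK4: "mono (p @ [HK4]) - smul l4 (mono p) \<in> Jset l1 l2 l3 l4"

definition veq :: "complex \<Rightarrow> complex \<Rightarrow> complex \<Rightarrow> complex \<Rightarrow> tv \<Rightarrow> tv \<Rightarrow> bool" where
  "veq l1 l2 l3 l4 u v \<longleftrightarrow> u - v \<in> Jset l1 l2 l3 l4"

definition vac :: tv where "vac = mono []"

text \<open>The vertex algebra structure of V(l1234,0): Yv u n v is (a representative of) u_n v,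
  where Y(u,x) = sum_n u_n x^(-n-1).  The conditions are the vertex algebra axioms
  (truncation, vacuum, creation, Jacobi identity in Borcherds' component form) on T/Jset,
  plus Y((T^m)_{-1} 1, x) = sum_n (T^m)_n x^(-n-1) and likewise for E.\<close>

definition is_V_structure :: "complex \<Rightarrow> complex \<Rightarrow> complex \<Rightarrow> complex \<Rightarrow> (tv \<Rightarrow> int \<Rightarrow> tv \<Rightarrow> tv) \<Rightarrow> bool" where
  "is_V_structure l1 l2 l3 l4 Yv \<longleftrightarrow>
     (let eq = veq l1 l2 l3 l4 in
     (\<forall>u v n. Fin u \<longrightarrow> Fin v \<longrightarrow> Fin (Yv u n v)) \<and>
     (\<forall>u u' v v' n. Fin u \<longrightarrow> Fin u' \<longrightarrow> Fin v \<longrightarrow> Fin v' \<longrightarrow> eq u u' \<longrightarrow> eq v v' \<longrightarrow>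
        eq (Yv u n v) (Yv u' n v')) \<and>
     (\<forall>u u' v n. Fin u \<longrightarrow> Fin u' \<longrightarrow> Fin v \<longrightarrow> eq (Yv (u + u') n v) (Yv u n v + Yv u' n v)) \<and>
     (\<forall>u v v' n. Fin u \<longrightarrow> Fin v \<longrightarrow> Fin v' \<longrightarrow> eq (Yv u n (v + v')) (Yv u n v + Yv u n v')) \<and>
     (\<forall>c u v n. Fin u \<longrightarrow> Fin v \<longrightarrow> eq (Yv (smul c u) n v) (smul c (Yv u n v))) \<and>
     (\<forall>c u v n. Fin u \<longrightarrow> Fin v \<longrightarrow> eq (Yv u n (smul c v)) (smul c (Yv u n v))) \<and>
     (\<forall>u v. Fin u \<longrightarrow> Fin v \<longrightarrow> (\<exists>N. \<forall>n\<ge>N. eq (Yv u n v) 0)) \<and>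
     (\<forall>v n. Fin v \<longrightarrow> eq (Yv vac n v) (if n = -1 then v else 0)) \<and>
     (\<forall>u n. Fin u \<longrightarrow> n \<ge> 0 \<longrightarrow> eq (Yv u n vac) 0) \<and>
     (\<forall>u. Fin u \<longrightarrow> eq (Yv u (-1) vac) u) \<and>
     (\<forall>u v w p q r. Fin u \<longrightarrow> Fin v \<longrightarrow> Fin w \<longrightarrow>
        (\<exists>M. \<forall>M'\<ge>M.
          eq (\<Sum>i<M'. smul (of_int p gchoose i) (Yv (Yv u (r + int i) v) (p + q - int i) w))
             (\<Sum>i<M'. smul ((-1) ^ i * (of_int r gchoose i))
                 (Yv u (p + r - int i) (Yv v (q + int i) w)
                  - smul ((-1) powi r) (Yv v (q + r - int i) (Yv u (p + int i) w)))))) \<and>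
     (\<forall>m n v. Fin v \<longrightarrow> eq (Yv (mono [HT m (-1)]) n v) (lmul (HT m n) v)) \<and>
     (\<forall>m n v. Fin v \<longrightarrow> eq (Yv (mono [HE m (-1)]) n v) (lmul (HE m n) v)))"

section \<open>phi-coordinated modules, phi(x,z) = x e^z\<close>

text \<open>YW u k w is the coefficient of x^k in Y_W(u,x) w.\<close>

text \<open>Coefficient of x1^a x2^b in (x1 - x2)^K Y_W(u,x1) Y_W(v,x2) w.\<close>
definition Pc :: "(complex \<Rightarrow> 'w::ab_group_add \<Rightarrow> 'w) \<Rightarrow> (tv \<Rightarrow> int \<Rightarrow> 'w \<Rightarrow> 'w) \<Rightarrow> nat \<Rightarrow>
                  tv \<Rightarrow> tv \<Rightarrow> 'w \<Rightarrow> int \<Rightarrow> int \<Rightarrow> 'w" where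
  "Pc sc YW K u v w a b =
     (\<Sum>i\<le>K. sc (of_int ((-1) ^ (K - i) * int (K choose i)))
                (YW u (a - int i) (YW v (b - int (K - i)) w)))"

text \<open>Coefficient of z^d in (e^z - 1)^K.\<close>
definition ek :: "nat \<Rightarrow> nat \<Rightarrow> complex" where
  "ek K d = (\<Sum>i\<le>K. of_nat (K choose i) * (-1) ^ (K - i) * of_nat i ^ d) / fact d"

text \<open>Coefficient of z^c x2^p in (x2 e^z - x2)^K Y_W(Y(u,z)v, x2) w, where u_j v = 0 in V
  for j \<ge> N'.\<close>
definition phiL :: "(complex \<Rightarrow> 'w::ab_group_add \<Rightarrow> 'w) \<Rightarrow> (tv \<Rightarrow> int \<Rightarrow> tv \<Rightarrow> tv) \<Rightarrow>
                    (tv \<Rightarrow> int \<Rightarrow> 'w \<Rightarrow> 'w) \<Rightarrow> nat \<Rightarrow> tv \<Rightarrow> tv \<Rightarrow> 'w \<Rightarrow> int \<Rightarrow> int \<Rightarrow> int \<Rightarrow> 'w" where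
  "phiL sc Yv YW K u v w N' c p =
     (\<Sum>j\<in>{-c-1..<N'}. sc (ek K (nat (c + j + 1))) (YW (Yv u j v) (p - int K) w))"

text \<open>Coefficient of z^c x2^p in ((x1 - x2)^K Y_W(u,x1) Y_W(v,x2) w)|_{x1 = x2 e^z}, where the
  coefficients Pc vanish when either exponent is < N.\<close>
definition phiR :: "(complex \<Rightarrow> 'w::ab_group_add \<Rightarrow> 'w) \<Rightarrow> (tv \<Rightarrow> int \<Rightarrow> 'w \<Rightarrow> 'w) \<Rightarrow> nat \<Rightarrow>
                    tv \<Rightarrow> tv \<Rightarrow> 'w \<Rightarrow> int \<Rightarrow> int \<Rightarrow> int \<Rightarrow> 'w" where
  "phiR sc YW K u v w N c p =
     (if c < 0 then 0 else
      (\<Sum>a\<in>{N..p-N}. sc (of_int a ^ nat c / fact (nat c)) (Pc sc YW K u v w a (p - a))))"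

definition phi_coord_module ::
  "(complex \<Rightarrow> 'w::ab_group_add \<Rightarrow> 'w) \<Rightarrow> complex \<Rightarrow> complex \<Rightarrow> complex \<Rightarrow> complex \<Rightarrow>
   (tv \<Rightarrow> int \<Rightarrow> tv \<Rightarrow> tv) \<Rightarrow> (tv \<Rightarrow> int \<Rightarrow> 'w \<Rightarrow> 'w) \<Rightarrow> bool" where
  "phi_coord_module sc l1 l2 l3 l4 Yv YW \<longleftrightarrow>
     (let eq = veq l1 l2 l3 l4 in
     \<comment> \<open>Y_W is a well-defined linear map V \<rightarrow> Hom(W, W((x)))\<close>
     (\<forall>u u'. Fin u \<longrightarrow> Fin u' \<longrightarrow> eq u u' \<longrightarrow> YW u = YW u') \<and>
     (\<forall>u u' k w. Fin u \<longrightarrow> Fin u' \<longrightarrow> YW (u + u') k w = YW u k w + YW u' k w) \<and>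
     (\<forall>c u k w. Fin u \<longrightarrow> YW (smul c u) k w = sc c (YW u k w)) \<and>
     (\<forall>u k w w'. Fin u \<longrightarrow> YW u k (w + w') = YW u k w + YW u k w') \<and>
     (\<forall>u k c w. Fin u \<longrightarrow> YW u k (sc c w) = sc c (YW u k w)) \<and>
     (\<forall>u w. Fin u \<longrightarrow> (\<exists>N. \<forall>k<N. YW u k w = 0)) \<and>
     \<comment> \<open>Y_W(1,x) = 1_W\<close>
     (\<forall>k w. YW vac k w = (if k = 0 then w else 0)) \<and>
     \<comment> \<open>phi-locality and phi-associativity\<close>
     (\<forall>u v. Fin u \<longrightarrow> Fin v \<longrightarrow> (\<exists>K::nat. \<forall>w.
        (\<exists>N. \<forall>a b. (a < N \<or> b < N) \<longrightarrow> Pc sc YW K u v w a b = 0) \<and>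
        (\<forall>N N'. (\<forall>a b. (a < N \<or> b < N) \<longrightarrow> Pc sc YW K u v w a b = 0) \<longrightarrow>
                (\<forall>j\<ge>N'. eq (Yv u j v) 0) \<longrightarrow>
                (\<forall>c p. phiL sc Yv YW K u v w N' c p = phiR sc YW K u v w N c p)))))"

text \<open>Y_W((T^m)_{-1} 1, x) = T_m(x) = sum_n t1^m t2^n x^(-n), likewise for E.\<close>
definition gen_fields :: "(int \<Rightarrow> int \<Rightarrow> 'w \<Rightarrow> 'w::zero) \<Rightarrow> (int \<Rightarrow> int \<Rightarrow> 'w \<Rightarrow> 'w) \<Rightarrow>
                          (tv \<Rightarrow> int \<Rightarrow> 'w \<Rightarrow> 'w) \<Rightarrow> bool" where
  "gen_fields tact eact YW \<longleftrightarrow>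
     (\<forall>m k w. YW (mono [HT m (-1)]) k w = zact tact m (- k) w \<and>
              YW (mono [HE m (-1)]) k w = zact eact m (- k) w)"

end

theory Submission
  imports Defs "HOL-Library.Groups_Big_Fun" "HOL-Computational_Algebra.Formal_Laurent_Series"
begin

text \<open>
  Put \<open>y = x1/x2\<close>.  For mutually local fields \<open>a\<close>, \<open>b\<close> the coefficients of \<open>a(x1) b(x2)\<close> and
  \<open>b(x2) a(x1)\<close>, as series in \<open>y\<close>, are the expansions at infinity and at 0 of one rational function
  whose only finite pole is at \<open>y = 1\<close>.  Multiplication by \<open>z = y - 1\<close> is invertible on series that
  are bounded on one side, so the residue at \<open>y = 1\<close> against any Laurent series in \<open>z\<close> is the
  difference of two one-sided coefficients.  Taking residues against \<open>t^n\<close>, \<open>t = log y\<close>, gives the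
  products \<open>a_n b\<close>.  They preserve locality and satisfy the commutator formula of a vertex algebra.
  The products of the fields \<open>T_m\<close> and \<open>E_m\<close> with one another are read off from the brackets of
  \<open>L*\<close>, so sending the modes of \<open>hat L*\<close> to the operators \<open>c \<mapsto> (T_m)_n c\<close> and \<open>c \<mapsto> (E_m)_n c\<close> and
  the vacuum to the identity field maps the vacuum module to fields on \<open>W\<close>, compatibly with all
  products.  Associativity is then the expansion \<open>z^K = (exp t - 1)^K\<close>.  Conversely associativity
  determines \<open>Y_W(u_n v, x)\<close> from \<open>Y_W(u, x)\<close> and \<open>Y_W(v, x)\<close>, whence uniqueness.
\<close>

unbundle fps_syntax

section \<open>Inverting \<open>y - 1\<close> on one-sided series\<close>

text \<open>A function \<open>L\<close> on the integers stands for the series with coefficient \<open>L k\<close> at \<open>y^k\<close>.\<close>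

definition times_z :: "(int \<Rightarrow> 'v::ab_group_add) \<Rightarrow> int \<Rightarrow> 'v" where
  "times_z L k = L (k - 1) - L k"

datatype side = Upper | Lower

primrec beyond :: "side \<Rightarrow> int \<Rightarrow> int set" where
  "beyond Upper c = {c<..}"
| "beyond Lower c = {..<c}"

definition vanishes_beyond :: "side \<Rightarrow> int \<Rightarrow> (int \<Rightarrow> 'v::zero) \<Rightarrow> bool" where
  "vanishes_beyond s c L \<longleftrightarrow> (\<forall>k\<in>beyond s c. L k = 0)"

definition vanishes :: "side \<Rightarrow> (int \<Rightarrow> 'v::zero) \<Rightarrow> bool" where
  "vanishes s L \<longleftrightarrow> (\<exists>c. vanishes_beyond s c L)"

lemma vanishesI: "vanishes_beyond s c L \<Longrightarrow> vanishes s L"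
  by (auto simp: vanishes_def)

lemma beyond_mono: "\<exists>c. beyond s c \<subseteq> beyond s a \<inter> beyond s b"
proof (cases s)
  case Upper
  then show ?thesis by (intro exI[of _ "max a b"]) auto
next
  case Lower
  then show ?thesis by (intro exI[of _ "min a b"]) auto
qed

lemma vanishes_combine:
  assumes "vanishes s L" "vanishes s M" "\<And>k. L k = 0 \<Longrightarrow> M k = 0 \<Longrightarrow> N k = 0"
  shows "vanishes s N"
proof -
  from assms(1,2) obtain a b where "vanishes_beyond s a L" "vanishes_beyond s b M"
    by (auto simp: vanishes_def)
  moreover obtain c where "beyond s c \<subseteq> beyond s a \<inter> beyond s b" using beyond_mono by blast
  ultimately have "vanishes_beyond s c N" using assms(3) unfolding vanishes_beyond_def by blast
  then show ?thesis by (rule vanishesI)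
qed

lemma vanishes_mono: "vanishes s L \<Longrightarrow> (\<And>k. L k = 0 \<Longrightarrow> M k = 0) \<Longrightarrow> vanishes s M"
  by (rule vanishes_combine[of s L L])

lemma vanishes_0: "vanishes s 0"
  by (auto simp: vanishes_def vanishes_beyond_def)

lemma vanishes_add: "vanishes s L \<Longrightarrow> vanishes s M \<Longrightarrow> vanishes s (L + M)"
  for L M :: "int \<Rightarrow> 'v::monoid_add"
  by (rule vanishes_combine[of s L M]) auto

lemma vanishes_diff: "vanishes s L \<Longrightarrow> vanishes s M \<Longrightarrow> vanishes s (L - M)"
  for L M :: "int \<Rightarrow> 'v::group_add"
  by (rule vanishes_combine[of s L M]) auto

lemma vanishes_beyond_shift: "vanishes_beyond s c (\<lambda>k. L (k + d)) \<longleftrightarrow> vanishes_beyond s (c + d) L"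
proof -
  have "k + d \<in> beyond s (c + d) \<longleftrightarrow> k \<in> beyond s c" for k
    by (cases s) auto
  then show ?thesis unfolding vanishes_beyond_def by (metis diff_add_cancel)
qed

lemma vanishes_shift: "vanishes s L \<Longrightarrow> vanishes s (\<lambda>k. L (k + d))"
  by (auto simp: vanishes_def vanishes_beyond_shift intro: exI[of _ "_ - d"])

lemma vanishes_finite_family:
  assumes "finite I" "\<And>i. i \<in> I \<Longrightarrow> vanishes s (L i)"
  shows "\<exists>c. \<forall>i\<in>I. vanishes_beyond s c (L i)"
  using assms
proof (induction I rule: finite_induct)
  case (insert i I)
  then obtain a b where "\<forall>i\<in>I. vanishes_beyond s a (L i)" "vanishes_beyond s b (L i)"
    by (metis insertCI vanishes_def)
  moreover obtain c where "beyond s c \<subseteq> beyond s a \<inter> beyond s b" using beyond_mono by blast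
  ultimately show ?case by (intro exI[of _ c]) (auto simp: vanishes_beyond_def)
qed simp

lemma times_z_add: "times_z (L + M) = times_z L + times_z M"
  by (auto simp: times_z_def fun_eq_iff)

lemma times_z_diff: "times_z (L - M) = times_z L - times_z M"
  by (auto simp: times_z_def fun_eq_iff)

lemma times_z_shift: "times_z (\<lambda>k. L (k + c)) = (\<lambda>k. times_z L (k + c))"
  by (auto simp: times_z_def fun_eq_iff algebra_simps)

text \<open>A power of \<open>y - 1\<close> moves bounds from above by its exponent, and leaves bounds from below in
  place.\<close>

primrec moved :: "side \<Rightarrow> int \<Rightarrow> int" where
  "moved Upper j = j"
| "moved Lower j = 0"

lemma moved_add: "moved s (i + j) = moved s i + moved s j"
  by (cases s) auto

lemma times_z_eq_0_imp_eq:
  assumes "a \<le> b" "\<And>k. a < k \<Longrightarrow> k \<le> b \<Longrightarrow> times_z L k = 0"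
  shows "L a = L b"
  using assms
proof (induction b rule: int_ge_induct)
  case (step b)
  then have "times_z L (b + 1) = 0" "L a = L b" by simp_all
  then show ?case by (simp add: times_z_def)
qed simp

lemma vanishes_beyond_times_z_iff:
  assumes "vanishes s L"
  shows "vanishes_beyond s (c + moved s 1) (times_z L) \<longleftrightarrow> vanishes_beyond s c L"
proof
  assume "vanishes_beyond s c L"
  then show "vanishes_beyond s (c + moved s 1) (times_z L)"
    by (cases s) (auto simp: vanishes_beyond_def times_z_def)
next
  assume z: "vanishes_beyond s (c + moved s 1) (times_z L)"
  obtain d where d: "vanishes_beyond s d L" using assms by (auto simp: vanishes_def)
  have "L k = 0" if "k \<in> beyond s c" for k
  proof (cases s)
    case Upper
    then have "L k = L (max k d + 1)"
      using z that by (intro times_z_eq_0_imp_eq) (auto simp: vanishes_beyond_def)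
    then show ?thesis using d Upper by (simp add: vanishes_beyond_def)
  next
    case Lower
    then have "L (min k d - 1) = L k"
      using z that by (intro times_z_eq_0_imp_eq) (auto simp: vanishes_beyond_def)
    then show ?thesis using d Lower by (simp add: vanishes_beyond_def)
  qed
  then show "vanishes_beyond s c L" by (simp add: vanishes_beyond_def)
qed

lemma vanishes_times_z: "vanishes s L \<Longrightarrow> vanishes s (times_z L)"
  using vanishes_beyond_times_z_iff vanishesI by (metis vanishes_def)

lemma times_z_inject:
  assumes "vanishes s L" "vanishes s M" "times_z L = times_z M"
  shows "L = M"
proof
  fix k
  have "vanishes s (L - M)" using assms by (intro vanishes_diff)
  moreover have "times_z (L - M) = 0" using assms(3) by (simp add: times_z_diff)
  ultimately have "vanishes_beyond s c (L - M)" for c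
    using vanishes_beyond_times_z_iff[of s "L - M" c] by (simp add: vanishes_beyond_def)
  from this[of "case s of Upper \<Rightarrow> k - 1 | Lower \<Rightarrow> k + 1"] show "L k = M k"
    by (cases s) (auto simp: vanishes_beyond_def)
qed

lemma ex_times_z_eq:
  assumes "vanishes s L"
  shows "\<exists>M. vanishes s M \<and> times_z M = L"
proof (cases s)
  case Upper
  obtain c where c: "\<And>k. k > c \<Longrightarrow> L k = 0"
    using assms Upper by (auto simp: vanishes_def vanishes_beyond_def)
  define M where "M k = sum L {k<..c}" for k
  have "vanishes_beyond Upper c M" by (auto simp: vanishes_beyond_def M_def)
  moreover have "times_z M k = L k" for k
  proof (cases "k \<le> c")
    case True
    then have "{k - 1<..c} = insert k {k<..c}" by auto
    then show ?thesis by (simp add: times_z_def M_def)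
  qed (simp add: times_z_def M_def c)
  ultimately show ?thesis using Upper by (auto simp: vanishes_def)
next
  case Lower
  obtain c where c: "\<And>k. k < c \<Longrightarrow> L k = 0"
    using assms Lower by (auto simp: vanishes_def vanishes_beyond_def)
  define M where "M k = - sum L {c..k}" for k
  have "vanishes_beyond Lower c M" by (auto simp: vanishes_beyond_def M_def)
  moreover have "times_z M k = L k" for k
  proof (cases "c \<le> k")
    case True
    then have "{c..k} = insert k {c..k - 1}" by auto
    then show ?thesis by (simp add: times_z_def M_def)
  qed (simp add: times_z_def M_def c)
  ultimately show ?thesis using Lower by (auto simp: vanishes_def)
qed

definition div_z :: "side \<Rightarrow> (int \<Rightarrow> 'v::ab_group_add) \<Rightarrow> int \<Rightarrow> 'v" where
  "div_z s L = (SOME M. vanishes s M \<and> times_z M = L)"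

lemma
  assumes "vanishes s L"
  shows vanishes_div_z: "vanishes s (div_z s L)"
    and times_z_div_z: "times_z (div_z s L) = L"
  using someI_ex[OF ex_times_z_eq[OF assms]] by (auto simp: div_z_def)

definition z_power :: "side \<Rightarrow> int \<Rightarrow> (int \<Rightarrow> 'v::ab_group_add) \<Rightarrow> int \<Rightarrow> 'v" where
  "z_power s j = (if j \<ge> 0 then times_z ^^ nat j else div_z s ^^ nat (- j))"

lemma z_power_nat: "z_power s (int n) = times_z ^^ n"
  by (simp add: z_power_def)

lemma z_power_0: "z_power s 0 L = L"
  by (simp add: z_power_def)

lemma vanishes_z_power: "vanishes s L \<Longrightarrow> vanishes s (z_power s j L)"
proof -
  assume L: "vanishes s L"
  have "vanishes s ((times_z ^^ n) L)" "vanishes s ((div_z s ^^ n) L)" for n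
    by (induction n) (auto intro: L vanishes_times_z vanishes_div_z)
  then show ?thesis by (simp add: z_power_def)
qed

lemma times_z_z_power:
  assumes "vanishes s L"
  shows "times_z (z_power s j L) = z_power s (j + 1) L"
proof (cases "j \<ge> 0")
  case True
  then have "nat (j + 1) = Suc (nat j)" by simp
  then show ?thesis using True by (simp add: z_power_def)
next
  case False
  then obtain n where j: "j = - 1 - int n" using that[of "nat (- 1 - j)"] by simp
  have "z_power s (j + 1) L = (div_z s ^^ n) L"
    by (cases n) (auto simp: j z_power_def nat_add_distrib)
  moreover have "z_power s j L = div_z s ((div_z s ^^ n) L)"
    by (simp add: j z_power_def nat_add_distrib)
  ultimately show ?thesis
    using times_z_div_z[OF vanishes_z_power[OF assms, of "j + 1"]] by simp
qed

lemma z_power_eqI: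
  assumes "\<And>i. vanishes s (f i)" "\<And>i. times_z (f i) = f (i + 1)"
  shows "z_power s j (f 0) = f j"
proof (induction j rule: int_induct[where k = 0])
  case base
  show ?case by (rule z_power_0)
next
  case (step1 i)
  then show ?case using times_z_z_power[OF assms(1), of i 0] assms(2) by simp
next
  case (step2 i)
  show ?case
    by (rule times_z_inject[of s])
       (use step2 times_z_z_power[OF assms(1), of "i - 1" 0] assms(2)[of "i - 1"] in
         \<open>simp_all add: vanishes_z_power assms(1)\<close>)
qed

lemma z_power_z_power:
  assumes "vanishes s L"
  shows "z_power s i (z_power s j L) = z_power s (i + j) L"
proof -
  let ?f = "\<lambda>i. z_power s (i + j) L"
  have "z_power s i (?f 0) = ?f i"
    by (rule z_power_eqI[of s ?f])
        (simp_all add: assms vanishes_z_power times_z_z_power add.commute add.left_commute)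
  then show ?thesis by simp
qed

lemma z_power_times_z: "vanishes s L \<Longrightarrow> z_power s j (times_z L) = z_power s (j + 1) L"
  using z_power_z_power[of s L j 1] by (simp add: z_power_def)

lemma z_power_add:
  assumes "vanishes s L" "vanishes s M"
  shows "z_power s j (L + M) = z_power s j L + z_power s j M"
proof -
  let ?f = "\<lambda>i. z_power s i L + z_power s i M"
  have "z_power s j (?f 0) = ?f j"
    by (rule z_power_eqI[of s ?f])
        (simp_all add: assms vanishes_z_power vanishes_add times_z_add times_z_z_power)
  then show ?thesis by (simp add: z_power_0)
qed

lemma z_power_diff:
  assumes "vanishes s L" "vanishes s M"
  shows "z_power s j (L - M) = z_power s j L - z_power s j M"
  using z_power_add[of s "L - M" M j] assms by (simp add: vanishes_diff)

lemma z_power_zero: "z_power s j 0 = 0"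
  using z_power_diff[OF vanishes_0 vanishes_0, of s j] by simp

lemma z_power_eq_zero_imp:
  assumes "vanishes s L" "z_power s j L = 0"
  shows "L = 0"
  using z_power_z_power[OF assms(1), of "- j" j] assms(2) by (simp add: z_power_zero z_power_0)

lemma z_power_shift:
  assumes "vanishes s L"
  shows "z_power s j (\<lambda>k. L (k + c)) = (\<lambda>k. z_power s j L (k + c))"
proof -
  let ?f = "\<lambda>i k. z_power s i L (k + c)"
  have "z_power s j (?f 0) = ?f j"
    by (rule z_power_eqI[of s ?f])
       (simp_all add: assms vanishes_z_power vanishes_shift times_z_z_power times_z_shift)
  then show ?thesis by (simp add: z_power_0)
qed

lemma z_power_map:
  assumes h: "\<And>v w. h (v - w) = h v - h w" and L: "vanishes s L"
  shows "z_power s j (\<lambda>k. h (L k)) = (\<lambda>k. h (z_power s j L k))"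
proof -
  have h0: "h 0 = 0" using h[of 0 0] by simp
  let ?f = "\<lambda>i k. h (z_power s i L k)"
  have "z_power s j (?f 0) = ?f j"
  proof (rule z_power_eqI[of s ?f])
    fix i
    show "vanishes s (?f i)" by (rule vanishes_mono[OF vanishes_z_power[OF L, of i]]) (simp add: h0)
    show "times_z (?f i) = ?f (i + 1)"
      unfolding times_z_z_power[OF L, of i, symmetric] by (simp add: times_z_def fun_eq_iff h)
  qed
  then show ?thesis by (simp add: z_power_0)
qed

lemma vanishes_beyond_z_power:
  assumes "vanishes_beyond s c L"
  shows "vanishes_beyond s (c + moved s j) (z_power s j L)"
proof (induction j rule: int_induct[where k = 0])
  case base
  have "moved s 0 = 0" by (cases s) auto
  then show ?case using assms by (simp add: z_power_0)
next
  case (step1 i)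
  with assms show ?case
    by (simp add: moved_add vanishesI vanishes_z_power
        vanishes_beyond_times_z_iff[of s "z_power s i L" "c + moved s i", symmetric]
        times_z_z_power add.assoc[symmetric])
next
  case (step2 i)
  have v: "vanishes s (z_power s (i - 1) L)" using assms by (intro vanishes_z_power vanishesI)
  have "c + moved s i = c + moved s (i - 1) + moved s 1" by (simp flip: moved_add)
  with step2 assms show ?case
    by (simp add: vanishes_beyond_times_z_iff[OF v, symmetric] times_z_z_power[of s L] vanishesI)
qed

section \<open>Series in two variables\<close>

definition vanishes2 :: "side \<Rightarrow> side \<Rightarrow> (int \<Rightarrow> int \<Rightarrow> 'v::zero) \<Rightarrow> bool" where
  "vanishes2 s t X \<longleftrightarrow>
    (\<forall>d. \<exists>c. \<forall>k\<in>beyond s c. \<forall>l\<in>beyond t d. X k l = 0) \<and>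
    (\<forall>c. \<exists>d. \<forall>k\<in>beyond s c. \<forall>l\<in>beyond t d. X k l = 0)"

lemma vanishes2_transpose: "vanishes2 s t X \<Longrightarrow> vanishes2 t s (\<lambda>l k. X k l)"
  unfolding vanishes2_def by meson

lemma ex_beyond: "\<exists>c. k \<in> beyond s c"
  by (cases s) (auto intro: exI[of _ "k - 1"] exI[of _ "k + 1"])

lemma vanishes2_left: "vanishes2 s t X \<Longrightarrow> vanishes s (\<lambda>k. X k l)"
  using ex_beyond[of l t] unfolding vanishes2_def vanishes_def vanishes_beyond_def by meson

lemma vanishes2_right: "vanishes2 s t X \<Longrightarrow> vanishes t (X k)"
  using ex_beyond[of k s] unfolding vanishes2_def vanishes_def vanishes_beyond_def by meson

lemma vanishes2_z_power_left:
  assumes "vanishes2 s t X"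
  shows "vanishes2 s t (\<lambda>k l. z_power s j (\<lambda>k. X k l) k)"
proof -
  have bound: "\<forall>k\<in>beyond s (c + moved s j). \<forall>l\<in>beyond t d. z_power s j (\<lambda>k. X k l) k = 0"
    if "\<forall>k\<in>beyond s c. \<forall>l\<in>beyond t d. X k l = 0" for c d
    using that vanishes_beyond_z_power[of s c "\<lambda>k. X k _" j] by (simp add: vanishes_beyond_def)
  have "\<exists>c. \<forall>k\<in>beyond s c. \<forall>l\<in>beyond t d. z_power s j (\<lambda>k. X k l) k = 0" for d
    using assms bound unfolding vanishes2_def by meson
  moreover have "\<exists>d. \<forall>k\<in>beyond s c. \<forall>l\<in>beyond t d. z_power s j (\<lambda>k. X k l) k = 0" for c
    using assms bound[of "c - moved s j"] unfolding vanishes2_def by (metis diff_add_cancel)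
  ultimately show ?thesis by (simp add: vanishes2_def)
qed

lemma vanishes2_z_power_right: "vanishes2 s t X \<Longrightarrow> vanishes2 s t (\<lambda>k l. z_power t j (X k) l)"
  by (rule vanishes2_transpose[OF vanishes2_z_power_left[OF vanishes2_transpose]])

lemma z_power_commute:
  assumes "vanishes2 s t X"
  shows "z_power s i (\<lambda>k. z_power t j (X k) l) k = z_power t j (\<lambda>l. z_power s i (\<lambda>k. X k l) k) l"
proof -
  define Y where "Y i k l = z_power s i (\<lambda>k. X k l) k" for i k l
  let ?f = "\<lambda>i k. z_power t j (Y i k) l"
  have Y: "vanishes2 s t (Y i)" for i
    using vanishes2_z_power_left[OF assms, of i] by (simp add: Y_def[abs_def])
  have "z_power s i (?f 0) = ?f i"
  proof (rule z_power_eqI[of s ?f])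
    fix i
    show "vanishes s (?f i)" by (rule vanishes2_left[OF vanishes2_z_power_right[OF Y]])
    have "Y (i + 1) k = Y i (k - 1) - Y i k" for k
      by (simp add: fun_eq_iff Y_def times_z_z_power[OF vanishes2_left[OF assms], symmetric]
          times_z_def)
    then show "times_z (?f i) = ?f (i + 1)"
      by (intro ext) (simp add: times_z_def z_power_diff vanishes2_right[OF Y])
  qed
  moreover have "Y 0 = X" by (simp add: Y_def z_power_0 fun_eq_iff)
  ultimately have "z_power s i (\<lambda>k. z_power t j (X k) l) k = z_power t j (Y i k) l" by simp
  then show ?thesis by (simp add: Y_def[abs_def])
qed

definition z_power2 :: "side \<Rightarrow> side \<Rightarrow> int \<Rightarrow> int \<Rightarrow> (int \<Rightarrow> int \<Rightarrow> 'v::ab_group_add) \<Rightarrow> 'v" where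
  "z_power2 s t i j X = z_power s i (\<lambda>k. z_power t j (X k) 0) 0"

lemma z_power2_swap: "vanishes2 s t X \<Longrightarrow> z_power2 s t i j X = z_power2 t s j i (\<lambda>l k. X k l)"
  unfolding z_power2_def by (rule z_power_commute)

lemma vanishes_z_power_slice: "vanishes2 s t X \<Longrightarrow> vanishes s (\<lambda>k. z_power t j (X k) l)"
  by (rule vanishes2_left[OF vanishes2_z_power_right])

lemma z_power2_add:
  assumes "vanishes2 s t X" "vanishes2 s t Y"
  shows "z_power2 s t i j (\<lambda>k l. X k l + Y k l) = z_power2 s t i j X + z_power2 s t i j Y"
proof -
  have "(\<lambda>k. z_power t j (\<lambda>l. X k l + Y k l) 0) =
      (\<lambda>k. z_power t j (X k) 0) + (\<lambda>k. z_power t j (Y k) 0)"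
    using assms[THEN vanishes2_right] z_power_add[of t "X _" "Y _" j] by (simp add: plus_fun_def)
  then show ?thesis using assms by (simp add: z_power2_def z_power_add vanishes_z_power_slice)
qed

lemma vanishes2_diagonal:
  assumes "vanishes s H" "\<And>k l. H (k + l) = 0 \<Longrightarrow> X k l = 0"
  shows "vanishes2 s s X"
proof -
  obtain c where c: "vanishes_beyond s c H" using assms(1) by (auto simp: vanishes_def)
  have "k + l \<in> beyond s c" if "k \<in> beyond s (c - d)" "l \<in> beyond s d" for k l d
    using that by (cases s) auto
  then have "\<forall>k\<in>beyond s (c - d). \<forall>l\<in>beyond s d. X k l = 0" for d
    using c assms(2) by (auto simp: vanishes_beyond_def)
  from this this[of "c - _"] show ?thesis unfolding vanishes2_def by fastforce
qed

lemma vanishes2_strip: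
  assumes "\<And>l. l < c \<Longrightarrow> X l = 0" "\<And>l. vanishes t (X l)"
  shows "vanishes2 Lower t X"
proof -
  have "\<exists>d. \<forall>k\<in>beyond Lower e. \<forall>l\<in>beyond t d. X k l = 0" for e
  proof -
    obtain d where d: "\<forall>k\<in>{c..<e}. vanishes_beyond t d (X k)"
      using vanishes_finite_family[of "{c..<e}" t X] assms(2) by auto
    have "X k l = 0" if "k < e" "l \<in> beyond t d" for k l
      using that d assms(1)[of k] by (cases "k < c") (auto simp: vanishes_beyond_def)
    then show ?thesis by auto
  qed
  moreover have "\<exists>e. \<forall>k\<in>beyond Lower e. \<forall>l\<in>beyond t d. X k l = 0" for d
    using assms(1) by (intro exI[of _ c]) simp
  ultimately show ?thesis by (simp add: vanishes2_def)
qed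

section \<open>Laurent series in \<open>y - 1\<close>\<close>

text \<open>Laurent series are series in \<open>z = y - 1\<close>; \<open>euler\<close> is the derivation \<open>y d/dy\<close>.\<close>

lemma fls_times_nth_below:
  fixes f g :: "'a::field fls"
  assumes "\<And>j. j < a \<Longrightarrow> f $$ j = 0" "\<And>j. j < b \<Longrightarrow> g $$ j = 0" "j < a + b"
  shows "(f * g) $$ j = 0"
proof (cases "f = 0 \<or> g = 0")
  case False
  then have "a \<le> fls_subdegree f" "b \<le> fls_subdegree g"
    using assms by (auto intro: fls_subdegree_geI)
  then show ?thesis using assms(3) by (intro fls_times_nth_eq0) auto
qed auto

lemma fls_eventual_induct [case_names add monomial high]:
  fixes g :: "'a::field fls"
  assumes add: "\<And>f g. P f \<Longrightarrow> P g \<Longrightarrow> P (f + g)"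
    and monomial: "\<And>c j. P (fls_const c * fls_X_intpow j)"
    and high: "\<And>g. (\<And>j. j < M \<Longrightarrow> g $$ j = 0) \<Longrightarrow> P g"
  shows "P g"
proof -
  let ?m = "fls_subdegree g"
  define p where "p = (\<Sum>j\<in>{?m..<M}. fls_const (g $$ j) * fls_X_intpow j)"
  have "P (\<Sum>j\<in>I. fls_const (g $$ j) * fls_X_intpow j)" if "finite I" for I
    using that
  proof (induction I rule: finite_induct)
    case empty
    show ?case using high[of 0] by simp
  next
    case (insert j I)
    then show ?case using add[OF monomial] by simp
  qed
  then have "P p" by (simp add: p_def)
  have "p $$ i = (\<Sum>j\<in>{?m..<M}. if j = i then g $$ j else 0)" for i
    unfolding p_def fls_nth_sum by (rule sum.cong) auto
  then have "p $$ i = g $$ i" if "i < M" for i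
    using that by (cases "i < ?m") auto
  then have "P (g - p)" by (intro high) simp
  from add[OF this \<open>P p\<close>] show ?thesis by simp
qed

definition euler :: "'a::comm_ring_1 fls \<Rightarrow> 'a fls" where
  "euler g = (1 + fls_X) * fls_deriv g"

lemma euler_nth: "euler g $$ j = of_int j * g $$ j + of_int (j + 1) * g $$ (j + 1)"
  by (simp add: euler_def distrib_right fls_X_times_conv_shift)

lemma euler_add: "euler (f + g) = euler f + euler g"
  by (simp add: euler_def distrib_left)

lemma euler_mult: "euler (f * g) = f * euler g + euler f * g"
  by (simp add: euler_def algebra_simps)

lemma euler_const_mult: "euler (fls_const c * g) = fls_const c * euler g"
  by (simp add: euler_def algebra_simps)

lemma euler_X_intpow: "euler (fls_X_intpow j) = of_int j * (fls_X_intpow j + fls_X_intpow (j - 1))"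
  by (simp add: euler_def fls_deriv_X_intpow algebra_simps fls_X_times_conv_shift)

lemma euler_pow_add: "(euler ^^ n) (f + g) = (euler ^^ n) f + (euler ^^ n) g"
  by (induction n) (auto simp: euler_add)

lemma euler_pow_const_mult: "(euler ^^ n) (fls_const c * g) = fls_const c * (euler ^^ n) g"
  by (induction n) (auto simp: euler_const_mult)

lemma euler_pow_nth_below:
  "(\<And>j. j < M \<Longrightarrow> g $$ j = 0) \<Longrightarrow> j < M - int n \<Longrightarrow> (euler ^^ n) g $$ j = 0"
  by (induction n arbitrary: j) (auto simp: euler_nth)

lemma euler_power_int:
  fixes g :: "'a::field_char_0 fls"
  assumes "g \<noteq> 0"
  shows "euler (g powi n) = of_int n * g powi (n - 1) * euler g"
proof -
  have pos: "euler (g ^ m) = of_nat m * g powi (int m - 1) * euler g" for m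
    by (cases m) (simp_all add: euler_def fls_deriv_power mult_ac del: power_Suc of_nat_Suc, simp)
  show ?thesis
  proof (cases "n \<ge> 0")
    case True
    then show ?thesis using pos[of "nat n"] by (simp add: power_int_def)
  next
    case False
    then obtain m where n: "n = - int m" using that[of "nat (- n)"] by simp
    have "0 = euler (g ^ m * g powi n)" using assms by (simp add: n power_int_minus euler_def)
    also have "\<dots> = g ^ m * (euler (g powi n) - of_int n * g powi (n - 1) * euler g)"
      unfolding euler_mult pos
      by (simp add: n right_diff_distrib power_int_add power_int_diff power_int_minus assms
          field_simps)
    finally show ?thesis using assms by simp
  qed
qed

definition log_y :: "'a::field_char_0 fls" where "log_y = fps_to_fls (fps_ln 1)"

lemma log_y_nth_1: "log_y $$ 1 = 1"
  by (simp add: log_y_def fps_ln_nth)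

lemma log_y_subdegree [simp]: "fls_subdegree log_y = 1"
  by (rule fls_subdegree_eqI) (auto simp: log_y_nth_1, auto simp: log_y_def fps_ln_nth)

lemma log_y_nonzero [simp]: "(log_y :: 'a::field_char_0 fls) \<noteq> 0"
  using log_y_nth_1[where 'a = 'a] by fastforce

lemma log_y_powi_nth_below: "j < n \<Longrightarrow> (log_y powi n) $$ j = 0"
  by simp

lemma log_y_powi_minus_1_nth: "(log_y powi (-1) :: 'a::field_char_0 fls) $$ -1 = 1"
  using fls_times_base[of "log_y :: 'a fls" "inverse log_y"]
  by (simp add: power_int_minus log_y_nth_1)

lemma euler_log_y: "euler log_y = (1 :: 'a::field_char_0 fls)"
proof -
  have "(1 + fps_X :: 'a fps) * inverse (1 + fps_X) = 1" by (rule inverse_mult_eq_1') simp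
  then have "fps_to_fls ((1 + fps_X :: 'a fps) * inverse (1 + fps_X)) = 1" by simp
  then show ?thesis
    by (simp add: euler_def log_y_def fls_deriv_fps_to_fls fps_ln_deriv fls_times_fps_to_fls)
qed

lemma euler_log_y_powi: "euler (log_y powi n) = of_int n * log_y powi (n - 1)"
  by (simp add: euler_power_int euler_log_y)

lemma euler_pow_log_y_powi:
  "(euler ^^ i) (log_y powi n) = fls_const (fact i * (of_int n gchoose i)) * log_y powi (n - int i)"
proof (induction i)
  case (Suc i)
  have "of_nat (Suc i) * (of_int n gchoose Suc i) = of_int (n - int i) * (of_int n gchoose i :: 'a)"
    using gbinomial_absorb_comp[of "of_int n :: 'a" i] gbinomial_absorption[of i "of_int n :: 'a"]
    by simp
  then have "fact (Suc i) * (of_int n gchoose Suc i) =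
      fact i * (of_int n gchoose i) * (of_int (n - int i) :: 'a)"
    by (simp only: fact_Suc mult_ac)
  moreover have "n - int i - 1 = n - int (Suc i)" by simp
  ultimately show ?case
    by (simp only: funpow.simps comp_apply Suc euler_const_mult euler_log_y_powi fls_of_int
        mult.assoc[symmetric] fls_const_mult_const)
qed simp

lemma fps_compose_ln_expansion:
  fixes f :: "'a::field_char_0 fps"
  assumes "n < M"
  shows "(fps_to_fls (f oo fps_ln 1) - (\<Sum>d<nat M. fls_const (f $ d) * log_y powi int d)) $$ n = 0"
proof (cases "n < 0")
  case True
  then show ?thesis by (simp add: fls_nth_sum fls_subdegree_pow)
next
  case False
  then obtain m where m: "n = int m" by (metis nonneg_int_cases not_less)
  let ?T = "fps_ln 1 :: 'a fps"
  have "(f oo ?T) $ m = (\<Sum>i=0..m. f $ i * (?T ^ i) $ m)" by (rule fps_compose_nth)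
  also have "\<dots> = (\<Sum>i<nat M. f $ i * (?T ^ i) $ m)"
  proof (rule sum.mono_neutral_left)
    show "\<forall>i\<in>{..<nat M} - {0..m}. f $ i * (?T ^ i) $ m = 0"
      by (auto simp: startsby_zero_power_prefix)
  qed (use assms m in auto)
  finally show ?thesis
    by (simp add: m fls_nth_sum log_y_def flip: fps_to_fls_power)
qed

lemma fps_exp_compose_ln: "fps_exp 1 oo fps_ln 1 = (1 + fps_X :: 'a::field_char_0 fps)"
proof -
  have "fps_exp 1 - 1 oo fps_ln 1 = (fps_X :: 'a fps)"
    by (simp add: fps_ln_fps_exp_inv fps_inv_fps_exp_compose)
  then show ?thesis by (simp add: fps_compose_sub_distrib algebra_simps)
qed

lemma exp_minus_1_power_compose_ln:
  "(fps_exp 1 - 1) ^ K oo fps_ln 1 = (fps_X ^ K :: 'a::field_char_0 fps)"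
  by (simp add: fps_compose_power[symmetric] fps_compose_sub_distrib fps_exp_compose_ln)

lemma exp_int_compose_ln:
  "fps_to_fls (fps_exp (of_int n) oo fps_ln 1) = ((1 + fls_X) powi n :: 'a::field_char_0 fls)"
proof -
  let ?E = "\<lambda>n. fps_to_fls (fps_exp (of_int n) oo fps_ln 1) :: 'a fls"
  have nat: "?E (int m) = (1 + fls_X) ^ m" for m
  proof -
    have "fps_exp (of_int (int m)) = (fps_exp 1 ^ m :: 'a fps)" by (simp add: fps_exp_power_mult)
    then show ?thesis
      by (simp only: fps_compose_power[symmetric] fps_ln_0 fps_exp_compose_ln fps_to_fls_power) simp
  qed
  show ?thesis
  proof (cases "n \<ge> 0")
    case True
    then show ?thesis using nat[of "nat n"] by (simp add: power_int_def)
  next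
    case False
    then obtain m where n: "n = - int m" using that[of "nat (- n)"] by simp
    have "?E n * ?E (int m) =
        fps_to_fls ((fps_exp (of_int n) * fps_exp (of_int (int m))) oo fps_ln 1)"
      by (simp add: fps_compose_mult_distrib fls_times_fps_to_fls)
    also have "\<dots> = 1" by (simp add: n flip: fps_exp_add_mult)
    finally show ?thesis using nat[of m]
      by (simp add: n power_int_minus inverse_eq_divide nonzero_eq_divide_eq)
       (metis mult_zero_right one_neq_zero nonzero_eq_divide_eq)
  qed
qed

section \<open>The residue pairing\<close>

locale char_0_space = vector_space sc for sc :: "'a::field_char_0 \<Rightarrow> 'w::ab_group_add \<Rightarrow> 'w"
begin

abbreviation endo :: "('w \<Rightarrow> 'w) \<Rightarrow> bool" where "endo \<equiv> module_hom sc sc"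

lemma endoI: "(\<And>v w. h (v + w) = h v + h w) \<Longrightarrow> (\<And>c w. h (sc c w) = sc c (h w)) \<Longrightarrow> endo h"
  by (simp add: module_hom_iff module_axioms)

lemma endo_scale: "endo (sc c)"
  by (rule endoI) (simp_all add: scale_right_distrib mult.commute)

text \<open>\<open>L\<close> and \<open>R\<close> are the expansions at infinity and at 0 of a Laurent polynomial over \<open>(y - 1)^K\<close>.\<close>

definition local_pair :: "nat \<Rightarrow> (int \<Rightarrow> 'w) \<Rightarrow> (int \<Rightarrow> 'w) \<Rightarrow> bool" where
  "local_pair K L R \<longleftrightarrow> vanishes Upper L \<and> vanishes Lower R \<and> (times_z ^^ K) L = (times_z ^^ K) R"

lemma local_pair_vanishes:
  "local_pair K L R \<Longrightarrow> vanishes Upper L"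
  "local_pair K L R \<Longrightarrow> vanishes Lower R"
  by (auto simp: local_pair_def)

lemma local_pair_iff_z_power:
  "local_pair K L R \<longleftrightarrow>
    vanishes Upper L \<and> vanishes Lower R \<and> z_power Upper (int K) L = z_power Lower (int K) R"
  by (simp add: local_pair_def z_power_nat)

lemma local_pair_z_power_eq:
  assumes "local_pair K L R" "int K \<le> j"
  shows "z_power Upper j L = z_power Lower j R"
proof -
  obtain n where j: "j = int n + int K" using that[of "nat (j - int K)"] assms(2) by simp
  have "z_power s j M = (times_z ^^ n) ((times_z ^^ K) M)" if "vanishes s M" for s M
    using z_power_z_power[OF that, of "int n" "int K"] by (simp add: j z_power_nat)
  then show ?thesis using assms(1) unfolding local_pair_def by metis
qed

lemma local_pair_mono: "local_pair K L R \<Longrightarrow> K \<le> K' \<Longrightarrow> local_pair K' L R"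
  using local_pair_z_power_eq[of K L R "int K'"] by (simp add: local_pair_iff_z_power)

lemma local_pair_zero: "local_pair K 0 0"
  by (simp add: local_pair_def vanishes_0)

lemma local_pair_add: "local_pair K L R \<Longrightarrow> local_pair K L' R' \<Longrightarrow> local_pair K (L + L') (R + R')"
  by (simp add: local_pair_iff_z_power vanishes_add z_power_add)

lemma local_pair_diff: "local_pair K L R \<Longrightarrow> local_pair K L' R' \<Longrightarrow> local_pair K (L - L') (R - R')"
  by (simp add: local_pair_iff_z_power vanishes_diff z_power_diff)

lemma local_pair_map:
  assumes "local_pair K L R" "endo h"
  shows "local_pair K (\<lambda>k. h (L k)) (\<lambda>k. h (R k))"
  using assms
  by (auto simp: local_pair_iff_z_power z_power_map[of h] module_hom.diff module_hom.zero
      intro: vanishes_mono[of Upper L] vanishes_mono[of Lower R])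

lemma local_pair_shift: "local_pair K L R \<Longrightarrow> local_pair K (\<lambda>k. L (k + c)) (\<lambda>k. R (k + c))"
  by (simp add: local_pair_iff_z_power z_power_shift vanishes_shift)

lemma local_pair_z_power:
  assumes "local_pair K L R" "int K \<le> int K' + j"
  shows "local_pair K' (z_power Upper j L) (z_power Lower j R)"
  using assms local_pair_z_power_eq[OF assms]
  by (simp add: local_pair_iff_z_power vanishes_z_power z_power_z_power)

definition neg_index :: "(int \<Rightarrow> 'w) \<Rightarrow> int \<Rightarrow> 'w" where
  "neg_index L k = sc (- of_int k) (L k)"

lemma neg_index_pow: "(neg_index ^^ n) L = (\<lambda>k. sc ((- of_int k) ^ n) (L k))"
  by (induction n) (auto simp: neg_index_def)

lemma vanishes_neg_index: "vanishes s L \<Longrightarrow> vanishes s (neg_index L)"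
  by (erule vanishes_mono) (simp add: neg_index_def)

lemma z_power_neg_index:
  assumes "vanishes s L"
  shows "z_power s j (neg_index L) =
    (\<lambda>k. neg_index (z_power s j L) k + sc (of_int j) (z_power s j L k + z_power s (j - 1) L k))"
proof -
  let ?f = "\<lambda>j k. neg_index (z_power s j L) k +
      sc (of_int j) (z_power s j L k + z_power s (j - 1) L k)"
  have "z_power s j (?f 0) = ?f j"
  proof (rule z_power_eqI[of s ?f])
    fix i
    show "vanishes s (?f i)"
      by (rule vanishes_combine[OF vanishes_z_power vanishes_z_power, OF assms assms, of i "i - 1"])
         (simp add: neg_index_def)
    have "z_power s j L (k - 1) = z_power s (j + 1) L k + z_power s j L k" for j k
      using fun_cong[OF times_z_z_power[OF assms, of j], of k]
      by (simp add: times_z_def algebra_simps)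
    from this[of i] this[of "i - 1"] show "times_z (?f i) = ?f (i + 1)"
      by (simp add: fun_eq_iff times_z_def neg_index_def algebra_simps)
  qed
  then show ?thesis by (simp add: z_power_0)
qed

lemma local_pair_neg_index:
  assumes "local_pair K L R"
  shows "local_pair (Suc K) (neg_index L) (neg_index R)"
  using assms local_pair_z_power_eq[OF assms, of "int (Suc K)"]
      local_pair_z_power_eq[OF assms, of "int K"]
  by (simp add: local_pair_iff_z_power z_power_neg_index vanishes_neg_index)

text \<open>The residue at \<open>y = 1\<close> of \<open>(y - 1)^j f dy/y\<close>, where \<open>f\<close> expands to \<open>L\<close> at infinity
  and to \<open>R\<close> at 0.\<close>

definition residue :: "int \<Rightarrow> (int \<Rightarrow> 'w) \<Rightarrow> (int \<Rightarrow> 'w) \<Rightarrow> 'w" where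
  "residue j L R = z_power Upper j L 0 - z_power Lower j R 0"

lemma residue_eq_0: "local_pair K L R \<Longrightarrow> int K \<le> j \<Longrightarrow> residue j L R = 0"
  by (simp add: residue_def local_pair_z_power_eq)

lemma residue_add:
  assumes "local_pair K L R" "local_pair K L' R'"
  shows "residue j (L + L') (R + R') = residue j L R + residue j L' R'"
  using assms by (simp add: residue_def local_pair_vanishes z_power_add)

lemma residue_map:
  assumes "local_pair K L R" "endo h"
  shows "residue j (\<lambda>k. h (L k)) (\<lambda>k. h (R k)) = h (residue j L R)"
  using assms by (simp add: residue_def local_pair_vanishes z_power_map[of h] module_hom.diff)

lemma residue_z_power:
  assumes "local_pair K L R"
  shows "residue j (z_power Upper i L) (z_power Lower i R) = residue (j + i) L R"
  using assms by (simp add: residue_def local_pair_vanishes z_power_z_power)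

lemma residue_neg_index:
  assumes "local_pair K L R"
  shows "residue j (neg_index L) (neg_index R) =
      sc (of_int j) (residue j L R + residue (j - 1) L R)"
  using assms by (simp add: residue_def local_pair_vanishes z_power_neg_index neg_index_def
      algebra_simps)

definition pairing :: "'a fls \<Rightarrow> (int \<Rightarrow> 'w) \<Rightarrow> (int \<Rightarrow> 'w) \<Rightarrow> 'w" where
  "pairing g L R = (\<Sum>j. sc (g $$ j) (residue j L R))"

lemma pairing_support:
  assumes "local_pair K L R"
  shows "{j. sc (g $$ j) (residue j L R) \<noteq> 0} \<subseteq> {fls_subdegree g..<int K}"
proof
  fix j assume "j \<in> {j. sc (g $$ j) (residue j L R) \<noteq> 0}"
  then have "g $$ j \<noteq> 0" "residue j L R \<noteq> 0" by auto
  then show "j \<in> {fls_subdegree g..<int K}"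
    using residue_eq_0[OF assms, of j] fls_eq0_below_subdegree[of j g]
    by (cases "j < fls_subdegree g"; cases "int K \<le> j") auto
qed

lemma finite_pairing_support: "local_pair K L R \<Longrightarrow> finite {j. sc (g $$ j) (residue j L R) \<noteq> 0}"
  by (rule finite_subset[OF pairing_support]) auto

lemma pairing_eq_0:
  assumes "local_pair K L R" "\<And>j. j < int K \<Longrightarrow> g $$ j = 0"
  shows "pairing g L R = 0"
proof -
  have "sc (g $$ j) (residue j L R) = 0" for j
    using assms(2)[of j] residue_eq_0[OF assms(1), of j] by (cases "j < int K") auto
  then show ?thesis by (simp only: pairing_def Sum_any.neutral)
qed

lemma pairing_X_intpow: "pairing (fls_X_intpow j) L R = residue j L R"
proof -
  have "pairing (fls_X_intpow j) L R = (\<Sum>i. if i = j then residue j L R else 0)"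
    unfolding pairing_def by (rule Sum_any.cong) auto
  then show ?thesis by simp
qed

lemma pairing_add_left:
  assumes "local_pair K L R"
  shows "pairing (f + g) L R = pairing f L R + pairing g L R"
  unfolding pairing_def fls_plus_nth scale_left_distrib
  by (rule Sum_any.distrib) (intro finite_pairing_support[OF assms])+

lemma pairing_map:
  assumes "local_pair K L R" "endo h"
  shows "pairing g (\<lambda>k. h (L k)) (\<lambda>k. h (R k)) = h (pairing g L R)"
proof -
  let ?I = "{fls_subdegree g..<int K}"
  have "pairing g M N = (\<Sum>j\<in>?I. sc (g $$ j) (residue j M N))" if "local_pair K M N" for M N
    unfolding pairing_def by (rule Sum_any.expand_superset[OF _ pairing_support[OF that]]) simp
  then show ?thesis
    using assms local_pair_map[OF assms]
    by (simp add: residue_map module_hom.sum module_hom.scale)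
qed

lemma pairing_scale:
  "local_pair K L R \<Longrightarrow> pairing g (\<lambda>k. sc c (L k)) (\<lambda>k. sc c (R k)) = sc c (pairing g L R)"
  by (rule pairing_map[OF _ endo_scale])

lemma pairing_const_mult:
  assumes "local_pair K L R"
  shows "pairing (fls_const c * g) L R = sc c (pairing g L R)"
proof -
  have "pairing (fls_const c * g) L R =
      (\<Sum>j. sc (g $$ j) (residue j (\<lambda>k. sc c (L k)) (\<lambda>k. sc c (R k))))"
    unfolding pairing_def using residue_map[OF assms endo_scale[of c]]
    by (simp add: mult.commute)
  then show ?thesis using pairing_scale[OF assms] by (simp add: pairing_def)
qed

lemma pairing_diff_left:
  assumes "local_pair K L R"
  shows "pairing (f - g) L R = pairing f L R - pairing g L R"
  using pairing_add_left[OF assms, of "f - g" g] by simp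

lemma pairing_sum_left:
  assumes "local_pair K L R"
  shows "pairing (\<Sum>i\<in>I. g i) L R = (\<Sum>i\<in>I. pairing (g i) L R)"
proof (induction I rule: infinite_finite_induct)
  case (insert i I)
  then show ?case by (simp add: pairing_add_left[OF assms])
qed (simp_all add: pairing_def)

lemma pairing_eqI_high:
  assumes "local_pair K L R" "\<And>j. j < int K \<Longrightarrow> (f - g) $$ j = 0"
  shows "pairing f L R = pairing g L R"
  using pairing_diff_left[OF assms(1), of f g] pairing_eq_0[OF assms] by simp

lemma pairing_add:
  assumes "local_pair K L R" "local_pair K L' R'"
  shows "pairing g (L + L') (R + R') = pairing g L R + pairing g L' R'"
  unfolding pairing_def residue_add[OF assms] scale_right_distrib
  by (rule Sum_any.distrib)
      (rule finite_pairing_support[OF assms(1)], rule finite_pairing_support[OF assms(2)])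

lemma pairing_diff:
  assumes "local_pair K L R" "local_pair K L' R'"
  shows "pairing g (L - L') (R - R') = pairing g L R - pairing g L' R'"
  using pairing_add[OF local_pair_diff[OF assms] assms(2), of g] by simp

lemma pairing_zero: "pairing g 0 0 = 0"
  using pairing_diff[OF local_pair_zero local_pair_zero, of g] by simp

lemma pairing_X_intpow_mult:
  assumes "local_pair K L R"
  shows "pairing (fls_X_intpow n * g) L R = pairing g (z_power Upper n L) (z_power Lower n R)"
proof -
  obtain K' where K': "int K \<le> int K' + n" using that[of "nat (int K - n)"] by auto
  note local = assms local_pair_z_power[OF assms K']
  show ?thesis
  proof (induction g rule: fls_eventual_induct[where M = "max (int K - n) (int K')"])
    case (add f g)
    then show ?case by (simp add: distrib_left pairing_add_left[OF local(1)]
        pairing_add_left[OF local(2)])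
  next
    case (monomial c j)
    have "fls_X_intpow n * (fls_const c * fls_X_intpow j) = fls_const c * fls_X_intpow (j + n)"
      using fls_X_intpow_times_fls_X_intpow[of j n] by (metis mult.assoc mult.commute)
    then show ?case
      using residue_z_power[OF assms]
      by (simp only: pairing_const_mult[OF local(1)] pairing_const_mult[OF local(2)]
          pairing_X_intpow)
  next
    case (high g)
    have "pairing (fls_X_intpow n * g) L R = 0"
      by (rule pairing_eq_0[OF local(1)]) (simp add: high fls_X_intpow_times_conv_shift)
    moreover have "pairing g (z_power Upper n L) (z_power Lower n R) = 0"
      by (rule pairing_eq_0[OF local(2)]) (simp add: high)
    ultimately show ?case by simp
  qed
qed

lemma pairing_X_power_mult:
  "local_pair K L R \<Longrightarrow> pairing (fls_X ^ n * g) L R = pairing g ((times_z ^^ n) L) ((times_z ^^ n) R)"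
  using pairing_X_intpow_mult[of K L R "int n" g]
  by (simp add: fls_X_power_conv_shift_1 z_power_nat)

lemma pairing_euler:
  assumes "local_pair K L R"
  shows "pairing (euler g) L R = pairing g (neg_index L) (neg_index R)"
proof -
  note local = assms local_pair_neg_index[OF assms]
  show ?thesis
  proof (induction g rule: fls_eventual_induct[where M = "int (Suc K)"])
    case (add f g)
    then show ?case by (simp add: euler_add pairing_add_left[OF local(1)]
        pairing_add_left[OF local(2)])
  next
    case (monomial c j)
    show ?case
      by (simp only: euler_const_mult euler_X_intpow fls_of_int pairing_const_mult[OF local(1)]
          pairing_const_mult[OF local(2)] pairing_add_left[OF assms] pairing_X_intpow
              residue_neg_index[OF assms])
  next
    case (high g)
    then show ?case
      using pairing_eq_0[OF local(1), of "euler g"] pairing_eq_0[OF local(2), of g]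
      by (simp add: euler_nth)
  qed
qed

lemma local_pair_neg_index_pow:
  "local_pair K L R \<Longrightarrow> local_pair (n + K) ((neg_index ^^ n) L) ((neg_index ^^ n) R)"
  by (induction n) (auto intro: local_pair_neg_index)

lemma pairing_euler_pow:
  assumes "local_pair K L R"
  shows "pairing ((euler ^^ n) g) L R = pairing g ((neg_index ^^ n) L) ((neg_index ^^ n) R)"
proof (induction n arbitrary: g)
  case (Suc n)
  then show ?case
    using pairing_euler[OF local_pair_neg_index_pow[OF assms], of g n] by (simp add: funpow_swap1)
qed simp

lemma pairing_one_plus_X_mult:
  assumes "local_pair K L R"
  shows "pairing ((1 + fls_X) * g) L R = pairing g (\<lambda>k. L (k - 1)) (\<lambda>k. R (k - 1))"
proof -
  have shift: "M + times_z M = (\<lambda>k. M (k - 1))" for M :: "int \<Rightarrow> 'w"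
    by (auto simp: times_z_def)
  have "local_pair K (times_z L) (times_z R)"
    using local_pair_z_power[OF assms, of K 1] by (simp add: z_power_def)
  then show ?thesis
    using pairing_X_power_mult[OF assms, of 1 g] pairing_add[OF assms, of "times_z L" "times_z R" g]
    by (simp add: distrib_right pairing_add_left[OF assms] shift)
qed

lemma pairing_one_plus_X_powi_mult:
  assumes "local_pair K L R"
  shows "pairing ((1 + fls_X) powi n * g) L R = pairing g (\<lambda>k. L (k - n)) (\<lambda>k. R (k - n))"
proof -
  define Y :: "'a fls" where "Y = 1 + fls_X"
  have "Y $$ 0 = 1" by (simp add: Y_def)
  then have nz: "Y \<noteq> 0" by fastforce
  then have Suc: "Y powi (i + 1) * g = Y powi i * (Y * g)" for i g
    by (simp add: power_int_add)
  have step: "pairing (Y * g) (\<lambda>k. L (k - i)) (\<lambda>k. R (k - i)) =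
      pairing g (\<lambda>k. L (k - (i + 1))) (\<lambda>k. R (k - (i + 1)))" for g i
    using pairing_one_plus_X_mult[OF local_pair_shift[OF assms, of "- i"], of g]
    by (simp add: Y_def algebra_simps)
  have "pairing (Y powi n * g) L R = pairing g (\<lambda>k. L (k - n)) (\<lambda>k. R (k - n))"
  proof (induction n arbitrary: g rule: int_induct[where k = 0])
    case (step1 i)
    then show ?case by (simp only: Suc step)
  next
    case (step2 i)
    have "Y powi (i - 1) * g = Y powi i * (inverse Y * g)" and "Y * (inverse Y * g) = g"
      using nz by (simp_all add: power_int_diff divide_inverse flip: mult.assoc)
    then show ?case using step2 step[of "inverse Y * g" "i - 1"] by (simp only:) simp
  qed simp
  then show ?thesis by (simp add: Y_def)
qed

text \<open>The expansion of \<open>y^(-k) = exp (- k log y)\<close> in powers of \<open>log y\<close>.\<close>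

lemma diff_eq_sum_pairing:
  assumes "local_pair K L R"
  shows "L k - R k = (\<Sum>i<K. sc ((- of_int k) ^ i / fact i) (pairing (log_y powi int i) L R))"
proof -
  have "L k - R k = residue 0 (\<lambda>i. L (i + k)) (\<lambda>i. R (i + k))"
    by (simp add: residue_def z_power_0)
  also have "\<dots> = pairing ((1 + fls_X) powi (- k)) L R"
    using pairing_one_plus_X_powi_mult[OF assms, of "- k" 1] pairing_X_intpow[of 0] by simp
  also have "\<dots> = pairing (\<Sum>i<K. fls_const (fps_exp (of_int (- k)) $ i) * log_y powi int i) L R"
  proof (rule pairing_eqI_high[OF assms])
    fix j assume "j < int K"
    from fps_compose_ln_expansion[OF this, of "fps_exp (of_int (- k))"]
    show "((1 + fls_X) powi (- k) -
        (\<Sum>i<K. fls_const (fps_exp (of_int (- k)) $ i) * log_y powi int i)) $$ j = (0::'a)"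
      by (simp only: exp_int_compose_ln nat_int)
  qed
  also have "\<dots> = (\<Sum>i<K. sc ((- of_int k) ^ i / fact i) (pairing (log_y powi int i) L R))"
    by (simp only: pairing_sum_left[OF assms] pairing_const_mult[OF assms] fps_exp_nth of_int_minus
        of_nat_fact)
  finally show ?thesis .
qed

end

section \<open>Products of local fields\<close>

type_synonym 'w formal_field = "int \<Rightarrow> 'w \<Rightarrow> 'w"

lemma times_z_pow_uminus: "(times_z ^^ n) (\<lambda>k. - L k) = (\<lambda>k. - (times_z ^^ n) L k)"
  by (induction n) (auto simp: times_z_def fun_eq_iff)

lemma times_z_pow_reflect:
  assumes "(times_z ^^ n) L = (times_z ^^ n) M"
  shows "(times_z ^^ n) (\<lambda>k. L (p - k)) = (times_z ^^ n) (\<lambda>k. M (p - k))"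
  using assms
proof (induction n arbitrary: L M p)
  case 0
  then show ?case by simp
next
  case (Suc n)
  have reflect: "times_z (\<lambda>k. N (p - k)) = (\<lambda>k. - times_z N (p + 1 - k))" for N :: "int \<Rightarrow> 'a"
    by (auto simp: times_z_def fun_eq_iff algebra_simps)
  have "(times_z ^^ n) (\<lambda>k. times_z L (p + 1 - k)) = (times_z ^^ n) (\<lambda>k. times_z M (p + 1 - k))"
    using Suc.prems by (intro Suc.IH) (simp add: funpow_swap1)
  then show ?case by (simp only: funpow_Suc_right comp_apply reflect times_z_pow_uminus)
qed

text \<open>Multiplication by \<open>x1 - x2\<close> on series in \<open>x1\<close> and \<open>x2\<close>.\<close>

definition times_diff :: "(int \<Rightarrow> int \<Rightarrow> 'v::ab_group_add) \<Rightarrow> int \<Rightarrow> int \<Rightarrow> 'v" where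
  "times_diff G q r = G (q - 1) r - G q (r - 1)"

lemma times_diff_pow_eq: "(times_diff ^^ n) G k q = (times_z ^^ n) (\<lambda>i. G i (k + q - int n - i)) k"
proof -
  have "(times_diff ^^ n) G k (p - k) = (times_z ^^ n) (\<lambda>i. G i (p - int n - i)) k" for p
  proof (induction n arbitrary: p k)
    case (Suc n)
    have "(times_diff ^^ Suc n) G k (p - k) =
        (times_diff ^^ n) G (k - 1) ((p - 1) - (k - 1)) - (times_diff ^^ n) G k ((p - 1) - k)"
      by (simp add: times_diff_def algebra_simps)
    also have "\<dots> = (times_z ^^ Suc n) (\<lambda>i. G i (p - 1 - int n - i)) k"
      unfolding Suc by (simp add: times_z_def)
    finally show ?case by (simp add: algebra_simps)
  qed simp
  from this[of "k + q"] show ?thesis by simp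
qed

lemma times_diff_pow_diff: "(times_diff ^^ n) (F - G) = (times_diff ^^ n) F - (times_diff ^^ n) G"
  by (induction n) (auto simp: times_diff_def fun_eq_iff)

lemma times_diff_pow_add: "(times_diff ^^ n) (F + G) = (times_diff ^^ n) F + (times_diff ^^ n) G"
  by (induction n) (auto simp: times_diff_def fun_eq_iff)

lemma times_diff_pow_zero: "(times_diff ^^ n) 0 = 0"
  by (induction n) (auto simp: times_diff_def fun_eq_iff)

lemma times_diff_pow_shift:
  "(times_diff ^^ n) (\<lambda>q r. G (q + c) r) = (\<lambda>q r. (times_diff ^^ n) G (q + c) r)"
  by (induction n) (auto simp: times_diff_def fun_eq_iff algebra_simps)

lemma times_diff_pow_map:
  assumes "\<And>v w. h (v - w) = h v - h w"
  shows "(times_diff ^^ n) (\<lambda>q r. h (G q r)) = (\<lambda>q r. h ((times_diff ^^ n) G q r))"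
  by (induction n) (auto simp: times_diff_def fun_eq_iff assms)

text \<open>Multiplication by \<open>x1 - x3\<close> on series in \<open>y\<close>, \<open>x2\<close> and \<open>x3\<close>, where \<open>x1 = x2 y\<close>.\<close>

definition times_diff13 :: "(int \<Rightarrow> int \<Rightarrow> int \<Rightarrow> 'v::ab_group_add) \<Rightarrow> int \<Rightarrow> int \<Rightarrow> int \<Rightarrow> 'v" where
  "times_diff13 F k q r = F (k - 1) (q - 1) r - F k q (r - 1)"

lemma times_diff13_pow_eq:
  "(times_diff13 ^^ n) F k q r = (times_diff ^^ n) (\<lambda>i r. F i (i + (q - k)) r) k r"
proof (induction n arbitrary: k q r)
  case (Suc n)
  have "k - 1 + (q - k) = q - 1" by simp
  then show ?case
    using Suc[of "k - 1" "q - 1" r] Suc[of k q "r - 1"]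
    by (simp add: times_diff13_def times_diff_def)
qed simp

lemma times_diff13_pow_commute:
  "(times_diff13 ^^ m) (\<lambda>k. (times_diff ^^ n) (F k)) =
      (\<lambda>k. (times_diff ^^ n) ((times_diff13 ^^ m) F k))"
proof -
  have "times_diff13 (\<lambda>k. times_diff (G k)) = (\<lambda>k. times_diff (times_diff13 G k))"
    for G :: "int \<Rightarrow> int \<Rightarrow> int \<Rightarrow> 'a"
    by (auto simp: times_diff13_def times_diff_def fun_eq_iff)
  then have "times_diff13 (\<lambda>k. (times_diff ^^ n) (G k)) =
      (\<lambda>k. (times_diff ^^ n) (times_diff13 G k))"
    for G :: "int \<Rightarrow> int \<Rightarrow> int \<Rightarrow> 'a"
    by (induction n) simp_all
  then show ?thesis by (induction m) simp_all
qed

context char_0_space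
begin

definition is_field :: "'w formal_field \<Rightarrow> bool" where
  "is_field a \<longleftrightarrow> (\<forall>k. endo (a k)) \<and> (\<forall>w. vanishes Lower (\<lambda>k. a k w))"

definition fscale :: "'a \<Rightarrow> 'w formal_field \<Rightarrow> 'w formal_field" where
  "fscale c a k w = sc c (a k w)"

definition id_field :: "'w formal_field" where
  "id_field k w = (if k = 0 then w else 0)"

lemma is_field_endo: "is_field a \<Longrightarrow> endo (a k)"
  by (simp add: is_field_def)

lemma is_field_vanishes: "is_field a \<Longrightarrow> vanishes Lower (\<lambda>k. a k w)"
  by (simp add: is_field_def)

lemma is_field_boundE:
  assumes "is_field a" obtains N where "\<And>k. k < N \<Longrightarrow> a k w = 0"
  using is_field_vanishes[OF assms, of w] by (auto simp: vanishes_def vanishes_beyond_def)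

lemmas field_zero = is_field_endo[THEN module_hom.zero]
lemmas field_add = is_field_endo[THEN module_hom.add]
lemmas field_diff = is_field_endo[THEN module_hom.diff]
lemmas field_scale = is_field_endo[THEN module_hom.scale]
lemmas field_sum = is_field_endo[THEN module_hom.sum]

lemma is_field_add: "is_field a \<Longrightarrow> is_field b \<Longrightarrow> is_field (a + b)"
  unfolding is_field_def[of "a + b"]
proof (intro conjI allI)
  assume ab: "is_field a" "is_field b"
  show "endo ((a + b) k)" for k
    using ab by (intro endoI) (simp_all add: field_add field_scale scale_right_distrib)
  show "vanishes Lower (\<lambda>k. (a + b) k w)" for w
    by (rule vanishes_combine[OF ab[THEN is_field_vanishes, of w]]) simp
qed

lemma is_field_fscale: "is_field a \<Longrightarrow> is_field (fscale c a)"
  unfolding is_field_def[of "fscale c a"] fscale_def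
  by (auto simp: field_add field_scale scale_right_distrib mult.commute intro!: endoI
      intro: vanishes_mono[OF is_field_vanishes])

lemma is_field_id: "is_field id_field"
  by (auto simp: is_field_def id_field_def vanishes_def vanishes_beyond_def intro!: endoI
      exI[of _ 0])

text \<open>The coefficients of \<open>x^p\<close> in \<open>a(x y) b(x) w\<close> and in \<open>b(x) a(x y) w\<close>, as series in \<open>y\<close>.\<close>

definition left_series :: "'w formal_field \<Rightarrow> 'w formal_field \<Rightarrow> int \<Rightarrow> 'w \<Rightarrow> int \<Rightarrow> 'w" where
  "left_series a b p w k = a k (b (p - k) w)"

definition right_series :: "'w formal_field \<Rightarrow> 'w formal_field \<Rightarrow> int \<Rightarrow> 'w \<Rightarrow> int \<Rightarrow> 'w" where
  "right_series a b p w k = b (p - k) (a k w)"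

definition local_order :: "nat \<Rightarrow> 'w formal_field \<Rightarrow> 'w formal_field \<Rightarrow> bool" where
  "local_order K a b \<longleftrightarrow>
    (\<forall>p w. (times_z ^^ K) (left_series a b p w) = (times_z ^^ K) (right_series a b p w))"

lemma vanishes_left_series:
  assumes "is_field a" "is_field b"
  shows "vanishes Upper (left_series a b p w)"
proof -
  obtain N where "\<And>k. k < N \<Longrightarrow> b k w = 0" using is_field_boundE[OF assms(2)] by blast
  then have "vanishes_beyond Upper (p - N) (left_series a b p w)"
    by (simp add: vanishes_beyond_def left_series_def field_zero[OF assms(1)])
  then show ?thesis by (rule vanishesI)
qed

lemma vanishes_right_series:
  assumes "is_field a" "is_field b"
  shows "vanishes Lower (right_series a b p w)"
  by (rule vanishes_mono[OF is_field_vanishes[OF assms(1), of w]])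
      (simp add: right_series_def field_zero[OF assms(2)])

lemma local_order_iff_local_pair:
  assumes "is_field a" "is_field b"
  shows "local_order K a b \<longleftrightarrow> (\<forall>p w. local_pair K (left_series a b p w) (right_series a b p w))"
  using assms by (simp add: local_order_def local_pair_def vanishes_left_series
      vanishes_right_series)

lemma local_order_mono:
  assumes "is_field a" "is_field b" "local_order K a b" "K \<le> K'"
  shows "local_order K' a b"
  using assms local_pair_mono by (metis local_order_iff_local_pair)

lemma local_order_sym: "local_order K a b \<Longrightarrow> local_order K b a"
proof -
  have "left_series b a p w = (\<lambda>k. right_series a b p w (p - k))"
    and "right_series b a p w = (\<lambda>k. left_series a b p w (p - k))" for p w
    by (auto simp: left_series_def right_series_def)
  then show "local_order K a b \<Longrightarrow> local_order K b a"
    unfolding local_order_def by (metis times_z_pow_reflect)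
qed

lemma local_order_iff_times_diff:
  "local_order K a b \<longleftrightarrow>
    (\<forall>w. (times_diff ^^ K) (\<lambda>k q. a k (b q w)) = (times_diff ^^ K) (\<lambda>k q. b q (a k w)))"
proof
  assume "local_order K a b"
  then show "\<forall>w. (times_diff ^^ K) (\<lambda>k q. a k (b q w)) = (times_diff ^^ K) (\<lambda>k q. b q (a k w))"
    by (simp add: fun_eq_iff times_diff_pow_eq local_order_def left_series_def[abs_def]
        right_series_def[abs_def])
next
  assume diff: "\<forall>w. (times_diff ^^ K) (\<lambda>k q. a k (b q w)) = (times_diff ^^ K) (\<lambda>k q. b q (a k w))"
  show "local_order K a b"
    unfolding local_order_def
  proof (intro allI ext)
    fix p w k
    have "(times_diff ^^ K) (\<lambda>k q. a k (b q w)) k (p - k + int K) =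
        (times_diff ^^ K) (\<lambda>k q. b q (a k w)) k (p - k + int K)" using diff by simp
    then show "(times_z ^^ K) (left_series a b p w) k = (times_z ^^ K) (right_series a b p w) k"
      by (simp add: times_diff_pow_eq left_series_def[abs_def] right_series_def[abs_def])
  qed
qed

lemma left_series_add_left: "left_series (a + b) c p w = left_series a c p w + left_series b c p w"
  and right_series_add_left:
    "is_field c \<Longrightarrow> right_series (a + b) c p w = right_series a c p w + right_series b c p w"
  by (auto simp: left_series_def right_series_def field_add)

lemma left_series_fscale_left: "left_series (fscale x a) c p w = (\<lambda>k. sc x (left_series a c p w k))"
  and right_series_fscale_left:
    "is_field c \<Longrightarrow> right_series (fscale x a) c p w = (\<lambda>k. sc x (right_series a c p w k))"
  by (auto simp: left_series_def right_series_def fscale_def field_scale)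

lemma local_order_add_left:
  assumes "is_field a" "is_field b" "is_field c" "local_order K a c" "local_order K b c"
  shows "local_order K (a + b) c"
  using assms
  by (simp add: local_order_iff_local_pair is_field_add left_series_add_left right_series_add_left
      local_pair_add)

lemma local_order_fscale_left:
  assumes "is_field a" "is_field c" "local_order K a c"
  shows "local_order K (fscale x a) c"
  using assms local_pair_map[OF _ endo_scale[of x]]
  by (simp add: local_order_iff_local_pair is_field_fscale left_series_fscale_left
      right_series_fscale_left)

lemma local_order_0_iff: "local_order 0 a b \<longleftrightarrow> (\<forall>k l w. a k (b l w) = b l (a k w))"
proof
  assume loc: "local_order 0 a b"
  have "a k (b l w) = b l (a k w)" for k l w
    using loc[unfolded local_order_def, rule_format, THEN fun_cong, of "k + l" w k]
    by (simp add: left_series_def right_series_def)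
  then show "\<forall>k l w. a k (b l w) = b l (a k w)" by blast
qed (simp add: local_order_def left_series_def right_series_def fun_eq_iff)

lemma local_order_id_left: "is_field b \<Longrightarrow> local_order 0 id_field b"
  by (simp add: local_order_0_iff id_field_def field_zero)

definition field_product :: "'a fls \<Rightarrow> 'w formal_field \<Rightarrow> 'w formal_field \<Rightarrow> 'w formal_field" where
  "field_product g a b p w = pairing g (left_series a b p w) (right_series a b p w)"

lemma field_product_eq_0:
  assumes "is_field a" "is_field b" "local_order K a b" "\<And>j. j < int K \<Longrightarrow> g $$ j = 0"
  shows "field_product g a b = 0"
  using assms by (auto simp: field_product_def fun_eq_iff local_order_iff_local_pair
      intro: pairing_eq_0)

lemma left_series_support:
  assumes "is_field a" "is_field b" "local_order K a b"
  shows "\<exists>N. \<forall>p k. k < N \<or> p + int K - k < N \<longrightarrow> (times_z ^^ K) (left_series a b p w) k = 0"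
proof -
  obtain M where M: "\<And>k. k < M \<Longrightarrow> a k w = 0" using is_field_boundE[OF assms(1)] by blast
  obtain N where N: "\<And>k. k < N \<Longrightarrow> b k w = 0" using is_field_boundE[OF assms(2)] by blast
  have "(times_z ^^ K) (left_series a b p w) k = 0" if "k < M \<or> p + int K - k < N" for p k
  proof -
    have "vanishes_beyond Upper (p - N) (left_series a b p w)"
      by (simp add: vanishes_beyond_def left_series_def N field_zero[OF assms(1)])
    then have "vanishes_beyond Upper (p - N + int K) ((times_z ^^ K) (left_series a b p w))"
      using vanishes_beyond_z_power[of Upper "p - N" _ "int K"] by (simp add: z_power_nat)
    moreover have "vanishes_beyond Lower M (right_series a b p w)"
      by (simp add: vanishes_beyond_def right_series_def M field_zero[OF assms(2)])
    then have "vanishes_beyond Lower M ((times_z ^^ K) (left_series a b p w))"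
      using vanishes_beyond_z_power[of Lower M _ "int K"] assms(3)
      by (simp add: z_power_nat local_order_def)
    ultimately show ?thesis using that by (auto simp: vanishes_beyond_def)
  qed
  then show ?thesis by (intro exI[of _ "min M N"]) auto
qed

lemma field_product_vanishes:
  assumes "is_field a" "is_field b" "local_order K a b"
  shows "vanishes Lower (\<lambda>p. field_product g a b p w)"
proof -
  obtain N where N: "\<And>p k. k < N \<or> p + int K - k < N \<Longrightarrow> (times_z ^^ K) (left_series a b p w) k = 0"
    using left_series_support[OF assms] by metis
  have "field_product g a b p w = 0" if p: "p < N + N - int K" for p
  proof -
    have pair: "local_pair K (left_series a b p w) (right_series a b p w)"
      using assms by (simp add: local_order_iff_local_pair)
    have "z_power Upper (int K) (left_series a b p w) = 0"
    proof
      fix k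
      have "k < N \<or> p + int K - k < N" using p by linarith
      then show "z_power Upper (int K) (left_series a b p w) k = 0 k" by (simp add: z_power_nat N)
    qed
    moreover from this have "z_power Lower (int K) (right_series a b p w) = 0"
      using local_pair_z_power_eq[OF pair order_refl] by simp
    ultimately have "left_series a b p w = 0" "right_series a b p w = 0"
      using local_pair_vanishes[OF pair] by (blast intro: z_power_eq_zero_imp)+
    then show ?thesis by (simp add: field_product_def pairing_zero)
  qed
  then have "vanishes_beyond Lower (N + N - int K) (\<lambda>p. field_product g a b p w)"
    by (simp add: vanishes_beyond_def)
  then show ?thesis by (rule vanishesI)
qed

lemma is_field_product:
  assumes "is_field a" "is_field b" "local_order K a b"
  shows "is_field (field_product g a b)"
proof -
  have pair: "local_pair K (left_series a b p w) (right_series a b p w)" for p w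
    using assms by (simp add: local_order_iff_local_pair)
  have "left_series a b p (v + w) = left_series a b p v + left_series a b p w"
    and "right_series a b p (v + w) = right_series a b p v + right_series a b p w"
    and "left_series a b p (sc c w) = (\<lambda>k. sc c (left_series a b p w k))"
    and "right_series a b p (sc c w) = (\<lambda>k. sc c (right_series a b p w k))" for p v w c
    using assms by (auto simp: left_series_def right_series_def field_add field_scale)
  then have "endo (field_product g a b p)" for p
    by (intro endoI) (simp_all add: field_product_def pairing_add[OF pair pair]
        pairing_scale[OF pair])
  then show ?thesis using field_product_vanishes[OF assms] by (simp add: is_field_def)
qed

definition mutually_local :: "'w formal_field \<Rightarrow> 'w formal_field \<Rightarrow> bool" where
  "mutually_local a b \<longleftrightarrow> (\<exists>K. local_order K a b)"

lemma mutually_localI: "local_order K a b \<Longrightarrow> mutually_local a b"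
  by (auto simp: mutually_local_def)

lemma mutually_local_sym: "mutually_local a b \<Longrightarrow> mutually_local b a"
  using local_order_sym by (auto simp: mutually_local_def)

lemma common_local_order:
  assumes "is_field a" "is_field b" "is_field c" "is_field d" "mutually_local a b"
      "mutually_local c d"
  obtains K where "local_order K a b" "local_order K c d"
proof -
  from assms(5,6) obtain K K' where "local_order K a b" "local_order K' c d"
    by (auto simp: mutually_local_def)
  with assms that[of "max K K'"] show thesis
    by (meson local_order_mono max.cobounded1 max.cobounded2)
qed

lemma mutually_local_add_left:
  assumes "is_field a" "is_field b" "is_field c" "mutually_local a c" "mutually_local b c"
  shows "mutually_local (a + b) c"
proof -
  obtain K where "local_order K a c" "local_order K b c"
    using common_local_order[OF assms(1,3,2,3,4,5)] by blast
  then show ?thesis using assms local_order_add_left by (blast intro: mutually_localI)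
qed

lemma mutually_local_fscale_left:
  "is_field a \<Longrightarrow> is_field c \<Longrightarrow> mutually_local a c \<Longrightarrow> mutually_local (fscale x a) c"
  unfolding mutually_local_def using local_order_fscale_left by blast

lemma mutually_local_id_left: "is_field b \<Longrightarrow> mutually_local id_field b"
  using local_order_id_left by (rule mutually_localI)

lemma mutually_local_id_right: "is_field b \<Longrightarrow> mutually_local b id_field"
  by (rule mutually_local_sym[OF mutually_local_id_left])

lemma mutually_local_local_pair:
  "is_field a \<Longrightarrow> is_field b \<Longrightarrow> mutually_local a b \<Longrightarrow>
    \<exists>K. \<forall>p w. local_pair K (left_series a b p w) (right_series a b p w)"
  by (auto simp: mutually_local_def local_order_iff_local_pair)

lemma field_product_add_left:
  assumes "is_field a" "is_field b" "is_field c" "mutually_local a c" "mutually_local b c"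
  shows "field_product g (a + b) c = field_product g a c + field_product g b c"
proof -
  obtain K where "local_order K a c" "local_order K b c"
    using common_local_order[OF assms(1,3,2,3,4,5)] by blast
  then show ?thesis
    using assms(1-3)
    by (auto simp: field_product_def fun_eq_iff left_series_add_left right_series_add_left
        local_order_iff_local_pair pairing_add[of K])
qed

lemma field_product_fscale_left:
  assumes "is_field a" "is_field b" "mutually_local a b"
  shows "field_product g (fscale c a) b = fscale c (field_product g a b)"
proof -
  obtain K where pair: "\<And>p w. local_pair K (left_series a b p w) (right_series a b p w)"
    using mutually_local_local_pair[OF assms] by auto
  show ?thesis
    using assms(2) pairing_scale[OF pair]
    by (simp add: field_product_def fun_eq_iff left_series_fscale_left right_series_fscale_left
        fscale_def)
qed

lemma field_product_add_right:
  assumes "is_field a" "is_field b" "is_field c" "mutually_local a b" "mutually_local a c"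
  shows "field_product g a (b + c) = field_product g a b + field_product g a c"
proof -
  obtain K where "local_order K a b" "local_order K a c"
    using common_local_order[OF assms(1,2,1,3,4,5)] by blast
  moreover have "left_series a (b + c) p w = left_series a b p w + left_series a c p w"
    and "right_series a (b + c) p w = right_series a b p w + right_series a c p w" for p w
    using assms(1) by (auto simp: left_series_def right_series_def field_add)
  ultimately show ?thesis
    using assms(1-3)
    by (intro ext) (simp add: field_product_def local_order_iff_local_pair pairing_add[of K])
qed

lemma field_product_fscale_right:
  assumes "is_field a" "is_field b" "mutually_local a b"
  shows "field_product g a (fscale c b) = fscale c (field_product g a b)"
proof -
  obtain K where pair: "\<And>p w. local_pair K (left_series a b p w) (right_series a b p w)"
    using mutually_local_local_pair[OF assms] by auto
  have "left_series a (fscale c b) p w = (\<lambda>k. sc c (left_series a b p w k))"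
    and "right_series a (fscale c b) p w = (\<lambda>k. sc c (right_series a b p w k))" for p w
    using assms(1) by (auto simp: left_series_def right_series_def fscale_def field_scale)
  then show ?thesis
    using pairing_scale[OF pair] by (intro ext) (simp add: field_product_def fscale_def)
qed

lemma field_product_add:
  assumes "is_field a" "is_field b" "mutually_local a b"
  shows "field_product (f + g) a b = field_product f a b + field_product g a b"
proof -
  obtain K where pair: "\<And>p w. local_pair K (left_series a b p w) (right_series a b p w)"
    using mutually_local_local_pair[OF assms] by auto
  show ?thesis by (simp add: field_product_def fun_eq_iff pairing_add_left[OF pair])
qed

lemma field_product_const_mult:
  assumes "is_field a" "is_field b" "mutually_local a b"
  shows "field_product (fls_const c * g) a b = fscale c (field_product g a b)"
proof -
  obtain K where pair: "\<And>p w. local_pair K (left_series a b p w) (right_series a b p w)"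
    using mutually_local_local_pair[OF assms] by auto
  show ?thesis by (simp add: field_product_def fun_eq_iff fscale_def pairing_const_mult[OF pair])
qed

lemma field_product_zero_right:
  assumes "is_field a"
  shows "field_product g a 0 = 0"
proof -
  have "left_series a 0 p w = 0" "right_series a 0 p w = 0" for p w
    using assms by (auto simp: left_series_def right_series_def field_zero)
  then show ?thesis by (intro ext) (simp add: field_product_def pairing_zero)
qed

definition local_family ::
  "nat \<Rightarrow> (int \<Rightarrow> int \<Rightarrow> int \<Rightarrow> 'w) \<Rightarrow> (int \<Rightarrow> int \<Rightarrow> int \<Rightarrow> 'w) \<Rightarrow> bool" where
  "local_family K P Q \<longleftrightarrow> (\<forall>q r. local_pair K (\<lambda>k. P k q r) (\<lambda>k. Q k q r))"

definition family_pairing ::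
  "'a fls \<Rightarrow> (int \<Rightarrow> int \<Rightarrow> int \<Rightarrow> 'w) \<Rightarrow> (int \<Rightarrow> int \<Rightarrow> int \<Rightarrow> 'w) \<Rightarrow> int \<Rightarrow> int \<Rightarrow> 'w" where
  "family_pairing g P Q q r = pairing g (\<lambda>k. P k q r) (\<lambda>k. Q k q r)"

lemma local_familyD: "local_family K P Q \<Longrightarrow> local_pair K (\<lambda>k. P k q r) (\<lambda>k. Q k q r)"
  by (simp add: local_family_def)

lemma local_family_times_diff:
  assumes "local_family K P Q"
  shows "local_family K (\<lambda>k. times_diff (P k)) (\<lambda>k. times_diff (Q k))"
  unfolding local_family_def
proof (intro allI)
  fix q r
  show "local_pair K (\<lambda>k. times_diff (P k) q r) (\<lambda>k. times_diff (Q k) q r)"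
    using local_pair_diff[OF local_familyD[OF assms, of "q - 1" r]
        local_familyD[OF assms, of q "r - 1"]]
    by (simp add: times_diff_def fun_diff_def)
qed

lemma local_family_times_diff13:
  assumes "local_family K P Q"
  shows "local_family K (times_diff13 P) (times_diff13 Q)"
  unfolding local_family_def
proof (intro allI)
  fix q r
  have "local_pair K (\<lambda>k. P (k + -1) (q - 1) r) (\<lambda>k. Q (k + -1) (q - 1) r)"
    by (rule local_pair_shift[OF local_familyD[OF assms]])
  then show "local_pair K (\<lambda>k. times_diff13 P k q r) (\<lambda>k. times_diff13 Q k q r)"
    using local_pair_diff[OF _ local_familyD[OF assms, of q "r - 1"]]
    by (simp add: times_diff13_def fun_diff_def)
qed

lemma times_diff_family_pairing:
  assumes "local_family K P Q"
  shows "times_diff (family_pairing g P Q) =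
      family_pairing g (\<lambda>k. times_diff (P k)) (\<lambda>k. times_diff (Q k))"
proof (intro ext)
  fix q r
  show "times_diff (family_pairing g P Q) q r =
      family_pairing g (\<lambda>k. times_diff (P k)) (\<lambda>k. times_diff (Q k)) q r"
    using pairing_diff[OF local_familyD[OF assms, of "q - 1" r]
        local_familyD[OF assms, of q "r - 1"]]
    by (simp add: times_diff_def family_pairing_def fun_diff_def)
qed

lemma times_diff_pow_family_pairing:
  assumes "local_family K P Q"
  shows "local_family K (\<lambda>k. (times_diff ^^ n) (P k)) (\<lambda>k. (times_diff ^^ n) (Q k)) \<and>
    (times_diff ^^ n) (family_pairing g P Q) =
      family_pairing g (\<lambda>k. (times_diff ^^ n) (P k)) (\<lambda>k. (times_diff ^^ n) (Q k))"
proof (induction n)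
  case (Suc n)
  then show ?case
    using local_family_times_diff[OF Suc[THEN conjunct1]]
        times_diff_family_pairing[OF Suc[THEN conjunct1]]
    by simp
qed (simp add: assms)

text \<open>\<open>x2 - x3 = (x1 - x3) - x2 (y - 1)\<close>.\<close>

lemma times_diff_family_pairing_split:
  assumes "local_family K P Q"
  shows "times_diff (family_pairing g P Q) =
    family_pairing g (times_diff13 P) (times_diff13 Q) -
        (\<lambda>q r. family_pairing (fls_X * g) P Q (q + -1) r)"
proof (intro ext)
  fix q r
  note pair = local_familyD[OF assms] local_familyD[OF local_family_times_diff13[OF assms]]
  have "pairing (fls_X * g) (\<lambda>k. P k (q - 1) r) (\<lambda>k. Q k (q - 1) r) =
      pairing g (times_z (\<lambda>k. P k (q - 1) r)) (times_z (\<lambda>k. Q k (q - 1) r))"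
    using pairing_X_power_mult[OF pair(1), of 1 g "q - 1" r] by simp
  moreover have "local_pair K (times_z (\<lambda>k. P k (q - 1) r)) (times_z (\<lambda>k. Q k (q - 1) r))"
    using local_pair_z_power[OF pair(1), of K 1 "q - 1" r] by (simp add: z_power_def)
  from pairing_diff[OF pair(2) this, of g q r]
  have "pairing g (\<lambda>k. times_diff13 P k q r) (\<lambda>k. times_diff13 Q k q r) -
      pairing g (times_z (\<lambda>k. P k (q - 1) r)) (times_z (\<lambda>k. Q k (q - 1) r)) =
      pairing g (\<lambda>k. times_diff (P k) q r) (\<lambda>k. times_diff (Q k) q r)"
    by (simp add: fun_diff_def times_diff13_def times_diff_def times_z_def)
  ultimately show "times_diff (family_pairing g P Q) q r =
      (family_pairing g (times_diff13 P) (times_diff13 Q)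
          - (\<lambda>q r. family_pairing (fls_X * g) P Q (q + -1) r)) q r"
    by (simp add: times_diff_family_pairing[OF assms] family_pairing_def)
qed

lemma times_diff_pow_family_pairing_eq_0:
  assumes "local_family K P Q" "(times_diff13 ^^ m) P = 0" "(times_diff13 ^^ m) Q = 0"
    and "\<And>j. j < int K - int n \<Longrightarrow> g $$ j = 0"
  shows "(times_diff ^^ (m + n)) (family_pairing g P Q) = 0"
  using assms
proof (induction "m + n" arbitrary: m n g P Q)
  case 0
  then show ?case by (auto simp: family_pairing_def pairing_zero fun_eq_iff simp flip: zero_fun_def)
next
  case (Suc N)
  consider (zero) "m = 0" | (high) "n = 0" | (split) m' n' where "m = Suc m'" "n = Suc n'"
    by (meson not0_implies_Suc)
  then show ?case
  proof cases
    case zero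
    then have "family_pairing g P Q = 0"
      using Suc.prems by (simp add: family_pairing_def fun_eq_iff pairing_zero flip: zero_fun_def)
    then show ?thesis by (simp add: times_diff_pow_zero)
  next
    case high
    then have "family_pairing g P Q = 0"
      using Suc.prems(4) pairing_eq_0[OF local_familyD[OF Suc.prems(1)]]
      by (simp add: family_pairing_def fun_eq_iff)
    then show ?thesis by (simp add: times_diff_pow_zero)
  next
    case split
    have "(times_diff ^^ (m' + n)) (family_pairing g (times_diff13 P) (times_diff13 Q)) = 0"
      using Suc.hyps(2) Suc.prems split
      by (intro Suc.hyps(1) local_family_times_diff13) (simp_all add: funpow_swap1)
    moreover have "(times_diff ^^ (m + n')) (family_pairing (fls_X * g) P Q) = 0"
      using Suc.hyps(2) Suc.prems split
      by (intro Suc.hyps(1)) (simp_all add: fls_X_times_conv_shift)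
    moreover have "m + n = Suc (m' + n)" "m' + n = m + n'" using split by auto
    ultimately show ?thesis
      by (simp only: funpow_Suc_right comp_apply times_diff_family_pairing_split[OF Suc.prems(1)]
          times_diff_pow_diff times_diff_pow_shift) (simp add: fun_eq_iff)
  qed
qed

lemma local_family_commutator:
  assumes "is_field a" "is_field b" "is_field c" "local_order K a b"
  shows "local_family K (\<lambda>k q r. a k (b (q - k) (c r w)) - c r (a k (b (q - k) w)))
    (\<lambda>k q r. b (q - k) (a k (c r w)) - c r (b (q - k) (a k w)))"
  unfolding local_family_def
proof (intro allI)
  fix q r
  have pair: "local_pair K (left_series a b q v) (right_series a b q v)" for v
    using assms by (simp add: local_order_iff_local_pair)
  from local_pair_diff[OF pair[of "c r w"]
      local_pair_map[OF pair[of w] is_field_endo[OF assms(3), of r]]]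
  show "local_pair K (\<lambda>k. a k (b (q - k) (c r w)) - c r (a k (b (q - k) w)))
      (\<lambda>k. b (q - k) (a k (c r w)) - c r (b (q - k) (a k w)))"
    by (simp add: left_series_def right_series_def fun_diff_def)
qed

lemma family_pairing_commutator:
  assumes "is_field a" "is_field b" "is_field c" "local_order K a b"
  shows "(\<lambda>q r. field_product g a b q (c r w) - c r (field_product g a b q w)) =
    family_pairing g (\<lambda>k q r. a k (b (q - k) (c r w)) - c r (a k (b (q - k) w)))
      (\<lambda>k q r. b (q - k) (a k (c r w)) - c r (b (q - k) (a k w)))"
proof (intro ext)
  fix q r
  have pair: "local_pair K (left_series a b q v) (right_series a b q v)" for v
    using assms by (simp add: local_order_iff_local_pair)
  note map = pair[of w] is_field_endo[OF assms(3), of r]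
  show "field_product g a b q (c r w) - c r (field_product g a b q w) =
    family_pairing g (\<lambda>k q r. a k (b (q - k) (c r w)) - c r (a k (b (q - k) w)))
      (\<lambda>k q r. b (q - k) (a k (c r w)) - c r (b (q - k) (a k w))) q r"
    using pairing_diff[OF pair[of "c r w"] local_pair_map[OF map], of g] pairing_map[OF map, of g]
    by (simp add: family_pairing_def field_product_def left_series_def right_series_def
        fun_diff_def)
qed

lemma times_diff_commutator_eq_0:
  assumes "local_order K a b"
  shows "(times_diff ^^ K) (\<lambda>k q. a k (b q w) - b q (a k w)) = 0"
  using assms times_diff_pow_diff[of K "\<lambda>k q. a k (b q w)" "\<lambda>k q. b q (a k w)"]
  by (simp add: local_order_iff_times_diff fun_diff_def)

lemma times_diff13_times_diff_eq_0:
  fixes A B :: "int \<Rightarrow> int \<Rightarrow> int \<Rightarrow> 'w"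
  assumes "\<And>k. (times_diff ^^ K) (A k) = 0" "\<And>l. (times_diff ^^ K) (B l) = 0"
  shows "(times_diff13 ^^ K) (\<lambda>k. (times_diff ^^ K) (\<lambda>q r. A k (q - k) r + B (q - k) k r)) = 0"
proof -
  have A: "(times_diff ^^ K) (\<lambda>q r. A k (q - k) r) = 0" for k
    using times_diff_pow_shift[of K "A k" "- k"] assms(1) by (simp add: fun_eq_iff)
  have B: "(times_diff13 ^^ K) (\<lambda>k q r. B (q - k) k r) = 0"
    using assms(2) by (simp add: fun_eq_iff times_diff13_pow_eq)
  have "(times_diff ^^ K) (\<lambda>q r. A k (q - k) r + B (q - k) k r) =
      (times_diff ^^ K) (\<lambda>q r. B (q - k) k r)" for k
    using times_diff_pow_add[of K "\<lambda>q r. A k (q - k) r" "\<lambda>q r. B (q - k) k r"] A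
    by (simp add: plus_fun_def)
  then show ?thesis
    by (simp only: times_diff13_pow_commute B times_diff_pow_zero zero_fun_apply)
        (simp add: zero_fun_def)
qed

text \<open>The two summands come from \<open>[a b, c] = a [b, c] + [a, c] b\<close>.\<close>

lemma times_diff13_times_diff_commutator_eq_0:
  assumes fields: "is_field a" "is_field b"
    and loc: "local_order K a c" "local_order K b c"
  shows "(times_diff13 ^^ K) (\<lambda>k. (times_diff ^^ K)
      (\<lambda>q r. a k (b (q - k) (c r w)) - c r (a k (b (q - k) w)))) = 0" (is ?P)
    and "(times_diff13 ^^ K) (\<lambda>k. (times_diff ^^ K)
      (\<lambda>q r. b (q - k) (a k (c r w)) - c r (b (q - k) (a k w)))) = 0" (is ?Q)
proof -
  note commutator = times_diff_commutator_eq_0[OF loc(1)] times_diff_commutator_eq_0[OF loc(2)]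
  have "(times_diff ^^ K) (\<lambda>l r. a k (b l (c r w) - c r (b l w))) = 0" for k
    using times_diff_pow_map[of "a k" K "\<lambda>l r. b l (c r w) - c r (b l w)"] commutator(2)[of w]
    by (simp add: field_diff field_zero fields zero_fun_def)
  with commutator(1) have "(times_diff13 ^^ K) (\<lambda>k. (times_diff ^^ K) (\<lambda>q r.
      a k (b (q - k) (c r w) - c r (b (q - k) w)) +
      (a k (c r (b (q - k) w)) - c r (a k (b (q - k) w))))) = 0"
    using times_diff13_times_diff_eq_0[of K "\<lambda>k l r. a k (b l (c r w) - c r (b l w))"
        "\<lambda>l k r. a k (c r (b l w)) - c r (a k (b l w))"] by blast
  then show ?P by (simp add: field_diff fields)
  have "(times_diff ^^ K) (\<lambda>k r. b l (a k (c r w) - c r (a k w))) = 0" for l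
    using times_diff_pow_map[of "b l" K "\<lambda>k r. a k (c r w) - c r (a k w)"] commutator(1)[of w]
    by (simp add: field_diff field_zero fields zero_fun_def)
  with commutator(2) have "(times_diff13 ^^ K) (\<lambda>k. (times_diff ^^ K) (\<lambda>q r.
      b (q - k) (c r (a k w)) - c r (b (q - k) (a k w)) +
      b (q - k) (a k (c r w) - c r (a k w)))) = 0"
    using times_diff13_times_diff_eq_0[of K "\<lambda>k l r. b l (c r (a k w)) - c r (b l (a k w))"
        "\<lambda>l k r. b l (a k (c r w) - c r (a k w))"] by blast
  then show ?Q by (simp add: field_diff fields)
qed

text \<open>Dong's lemma: each term in the expansion of \<open>((x1 - x3) - x2 (y - 1))^(K + n)\<close> contains a power of
  one of the two summands that kills the commutator.\<close>

lemma local_order_field_product: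
  assumes fields: "is_field a" "is_field b" "is_field c"
    and loc: "local_order K a b" "local_order K a c" "local_order K b c"
    and g: "\<And>j. j < int K - int n \<Longrightarrow> g $$ j = 0"
  shows "local_order (K + n + K) (field_product g a b) c"
  unfolding local_order_iff_times_diff
proof
  fix w
  let ?F = "\<lambda>k q. field_product g a b k (c q w)" and ?G = "\<lambda>k q. c q (field_product g a b k w)"
  let ?P = "\<lambda>k q r. a k (b (q - k) (c r w)) - c r (a k (b (q - k) w))"
  let ?Q = "\<lambda>k q r. b (q - k) (a k (c r w)) - c r (b (q - k) (a k w))"
  let ?D = "\<lambda>F k. (times_diff ^^ K) (F k)"
  note pairing_D = times_diff_pow_family_pairing[OF local_family_commutator[OF fields loc(1)],
      where n = K and g = g]
  have "?F - ?G = family_pairing g ?P ?Q"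
    using family_pairing_commutator[OF fields loc(1), where g = g and w = w]
    by (simp add: fun_diff_def)
  then have "(times_diff ^^ (K + n + K)) (?F - ?G) =
      (times_diff ^^ (K + n)) (family_pairing g (?D ?P) (?D ?Q))"
    using pairing_D by (simp add: funpow_add)
  also have "\<dots> = 0"
    using pairing_D times_diff13_times_diff_commutator_eq_0[OF fields(1,2) loc(2,3), of w]
    by (intro times_diff_pow_family_pairing_eq_0 g) auto
  finally show "(times_diff ^^ (K + n + K)) ?F = (times_diff ^^ (K + n + K)) ?G"
    unfolding times_diff_pow_diff right_minus_eq .
qed

lemma mutually_local_field_product:
  assumes "is_field a" "is_field b" "is_field c"
    and "mutually_local a b" "mutually_local a c" "mutually_local b c"
  shows "mutually_local (field_product g a b) c"
proof -
  obtain K1 K2 where K: "local_order K1 a b" "local_order K1 a c" "local_order K2 b c"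
    using common_local_order[OF assms(1,2,1,3,4,5)] assms(6) by (metis mutually_local_def)
  define K where "K = max K1 K2"
  have "local_order K a b" "local_order K a c" "local_order K b c"
    using K assms(1-3) unfolding K_def by (meson local_order_mono max.cobounded1 max.cobounded2)+
  moreover have "g $$ j = 0" if "j < int K - int (nat (int K - fls_subdegree g))" for j
    using that by (intro fls_eq0_below_subdegree) linarith
  ultimately show ?thesis using local_order_field_product assms(1-3)
    by (blast intro: mutually_localI)
qed

end

lemma sum_apply: "(\<Sum>i\<in>I. f i) x = (\<Sum>i\<in>I. f i x)"
  by (induction I rule: infinite_finite_induct) auto

section \<open>The commutator formula\<close>

lemma vanishes2_add:
  fixes X Y :: "int \<Rightarrow> int \<Rightarrow> 'v::monoid_add"
  assumes "vanishes2 s t X" "vanishes2 s t Y"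
  shows "vanishes2 s t (\<lambda>k l. X k l + Y k l)"
proof -
  have common: "\<exists>c. \<forall>k\<in>beyond s c. \<forall>l\<in>beyond t d. X k l + Y k l = 0"
    if XY: "vanishes2 s t X" "vanishes2 s t Y" for s t d and X Y :: "int \<Rightarrow> int \<Rightarrow> 'v"
  proof -
    obtain a b where "\<forall>k\<in>beyond s a. \<forall>l\<in>beyond t d. X k l = 0"
        "\<forall>k\<in>beyond s b. \<forall>l\<in>beyond t d. Y k l = 0"
      using XY unfolding vanishes2_def by meson
    moreover obtain c where "beyond s c \<subseteq> beyond s a \<inter> beyond s b" using beyond_mono by blast
    ultimately show ?thesis by (intro exI[of _ c]) (auto dest!: subsetD)
  qed
  have "\<exists>d. \<forall>k\<in>beyond s c. \<forall>l\<in>beyond t d. X k l + Y k l = 0" for c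
    using common[OF assms[THEN vanishes2_transpose], of c] by blast
  with common[OF assms] show ?thesis unfolding vanishes2_def by blast
qed

lemma z_power2_diff:
  assumes "vanishes2 s t X" "vanishes2 s t Y"
  shows "z_power2 s t i j (\<lambda>k l. X k l - Y k l) = z_power2 s t i j X - z_power2 s t i j Y"
proof -
  have "(\<lambda>k. z_power t j (\<lambda>l. X k l - Y k l) 0) =
      (\<lambda>k. z_power t j (X k) 0) - (\<lambda>k. z_power t j (Y k) 0)"
    using assms[THEN vanishes2_right] z_power_diff[of t "X _" "Y _" j] by (simp add: fun_diff_def)
  then show ?thesis using assms by (simp add: z_power2_def z_power_diff vanishes_z_power_slice)
qed

lemma z_power2_sum:
  assumes "finite I" "\<And>i. i \<in> I \<Longrightarrow> vanishes2 s t (X i)"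
  shows "z_power2 s t m n (\<lambda>k l. \<Sum>i\<in>I. X i k l) = (\<Sum>i\<in>I. z_power2 s t m n (X i)) \<and>
    vanishes2 s t (\<lambda>k l. \<Sum>i\<in>I. X i k l)"
  using assms
proof (induction I rule: finite_induct)
  case empty
  have "z_power2 s t m n (\<lambda>k l. 0) = 0"
    by (simp add: z_power2_def z_power_zero flip: zero_fun_def)
  then show ?case by (simp add: vanishes2_def)
next
  case (insert i I)
  then show ?case
    using z_power2_add[of s t "X i" "\<lambda>k l. \<Sum>i\<in>I. X i k l" m n]
      vanishes2_add[of s t "X i" "\<lambda>k l. \<Sum>i\<in>I. X i k l"] by simp
qed

lemma fls_biadditive_eq_0:
  fixes D :: "'a::field fls \<Rightarrow> 'a fls \<Rightarrow> 'v::ab_group_add"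
  assumes add: "\<And>f g h. D (f + g) h = D f h + D g h" "\<And>f g h. D f (g + h) = D f g + D f h"
    and high: "\<And>h. \<exists>M. \<forall>g. (\<forall>j<M. g $$ j = 0) \<longrightarrow> D g h = 0"
      "\<And>g. \<exists>M. \<forall>h. (\<forall>j<M. h $$ j = 0) \<longrightarrow> D g h = 0"
    and monomial: "\<And>c m d n. D (fls_const c * fls_X_intpow m) (fls_const d * fls_X_intpow n) = 0"
  shows "D g h = 0"
proof -
  have "D (fls_const c * fls_X_intpow m) h = 0" for c m h
  proof -
    obtain M where "\<And>h. (\<And>j. j < M \<Longrightarrow> h $$ j = 0) \<Longrightarrow> D (fls_const c * fls_X_intpow m) h = 0"
      using high(2) by blast
    then show ?thesis
      by (induction h rule: fls_eventual_induct[where M = M]) (auto simp: add(2) monomial)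
  qed
  moreover obtain M where "\<And>g. (\<And>j. j < M \<Longrightarrow> g $$ j = 0) \<Longrightarrow> D g h = 0"
    using high(1) by blast
  ultimately show ?thesis
    by (induction g rule: fls_eventual_induct[where M = M]) (auto simp: add(1))
qed

context char_0_space
begin

lemma commutator_eq_sum_products:
  assumes "is_field a" "is_field b" "local_order K a b"
  shows "a k (b l w) - b l (a k w) =
    (\<Sum>i<K. sc ((- of_int k) ^ i / fact i) (field_product (log_y powi int i) a b (k + l) w))"
proof -
  have "local_pair K (left_series a b (k + l) w) (right_series a b (k + l) w)"
    using assms by (simp add: local_order_iff_local_pair)
  from diff_eq_sum_pairing[OF this, of k] show ?thesis
    by (simp add: field_product_def left_series_def right_series_def)
qed

lemma vanishes2_upper_upper:
  assumes "is_field c" "\<And>k l. f k l 0 = 0"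
  shows "vanishes2 Upper Upper (\<lambda>k l. f k l (c (p - k - l) w))"
proof -
  obtain N where N: "\<And>k. k < N \<Longrightarrow> c k w = 0" using is_field_boundE[OF assms(1)] by blast
  have "vanishes_beyond Upper (p - N) (\<lambda>j. c (p - j) w)" by (simp add: vanishes_beyond_def N)
  then show ?thesis
    by (rule vanishes2_diagonal[OF vanishesI]) (simp add: assms(2) diff_diff_eq)
qed

lemma vanishes2_lower_left:
  assumes "is_field a" "\<And>k l. f k l 0 = 0" "\<And>k v. vanishes t (\<lambda>l. f k l v)"
  shows "vanishes2 Lower t (\<lambda>k l. f k l (a k w))"
proof -
  obtain N where N: "\<And>k. k < N \<Longrightarrow> a k w = 0" using is_field_boundE[OF assms(1)] by blast
  show ?thesis by (rule vanishes2_strip[of N]) (use N assms(2,3) in \<open>auto simp: fun_eq_iff\<close>)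
qed

lemma
  assumes "is_field a" "is_field b" "is_field c"
  shows vanishes2_abc: "vanishes2 Upper Upper (\<lambda>k l. a k (b l (c (p - k - l) w)))"
    and vanishes2_acb: "vanishes2 Upper Lower (\<lambda>k l. a k (c (p - k - l) (b l w)))"
    and vanishes2_cba: "vanishes2 Lower Lower (\<lambda>k l. c (p - k - l) (b l (a k w)))"
proof -
  show "vanishes2 Upper Upper (\<lambda>k l. a k (b l (c (p - k - l) w)))"
    by (rule vanishes2_upper_upper) (simp_all add: assms field_zero)
  have "vanishes Upper (\<lambda>k. a k (c (p - k - l) v))" for l v
    using vanishes_left_series[OF assms(1,3), of "p - l" v]
    by (simp add: left_series_def[abs_def] algebra_simps)
  then show "vanishes2 Upper Lower (\<lambda>k l. a k (c (p - k - l) (b l w)))"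
    by (intro vanishes2_transpose[OF vanishes2_lower_left]) (simp_all add: assms field_zero)
  show "vanishes2 Lower Lower (\<lambda>k l. c (p - k - l) (b l (a k w)))"
    using vanishes_right_series[OF assms(2,3)]
    by (intro vanishes2_lower_left) (simp_all add: assms field_zero right_series_def[abs_def])
qed

lemma field_product_X_intpow_iterate:
  assumes "is_field a" "is_field b" "is_field c"
  shows "field_product (fls_X_intpow m) a (field_product (fls_X_intpow n) b c) p w =
    z_power2 Upper Upper m n (\<lambda>k l. a k (b l (c (p - k - l) w))) -
    z_power2 Upper Lower m n (\<lambda>k l. a k (c (p - k - l) (b l w))) -
    (z_power2 Lower Upper m n (\<lambda>k l. b l (c (p - k - l) (a k w))) -
     z_power2 Lower Lower m n (\<lambda>k l. c (p - k - l) (b l (a k w))))"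
proof -
  have inner: "field_product (fls_X_intpow n) b c (p - k) v =
      z_power Upper n (\<lambda>l. b l (c (p - k - l) v)) 0 -
      z_power Lower n (\<lambda>l. c (p - k - l) (b l v)) 0" for k v
    by (simp only: field_product_def pairing_X_intpow residue_def left_series_def[abs_def]
        right_series_def[abs_def])
  have map: "z_power s n (\<lambda>l. a k (L l)) 0 = a k (z_power s n L 0)" if "vanishes s L" for s k L
    using z_power_map[of "a k" s L n] that field_diff[OF assms(1)] by simp
  have upper: "vanishes Upper (\<lambda>l. b l (c (p - k - l) w))"
      and lower: "vanishes Lower (\<lambda>l. c (p - k - l) (b l w))" for k
    using vanishes_left_series[OF assms(2,3), of "p - k" w]
        vanishes_right_series[OF assms(2,3), of "p - k" w]
    by (simp_all add: left_series_def[abs_def] right_series_def[abs_def])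
  have "(\<lambda>k. a k (field_product (fls_X_intpow n) b c (p - k) w)) =
      (\<lambda>k. z_power Upper n (\<lambda>l. a k (b l (c (p - k - l) w))) 0) -
      (\<lambda>k. z_power Lower n (\<lambda>l. a k (c (p - k - l) (b l w))) 0)"
    by (simp only: inner field_diff[OF assms(1)] map[OF upper] map[OF lower] fun_diff_def)
  moreover have "(\<lambda>k. field_product (fls_X_intpow n) b c (p - k) (a k w)) =
      (\<lambda>k. z_power Upper n (\<lambda>l. b l (c (p - k - l) (a k w))) 0) -
      (\<lambda>k. z_power Lower n (\<lambda>l. c (p - k - l) (b l (a k w))) 0)"
    by (simp only: inner fun_diff_def)
  moreover have "vanishes2 Lower Upper (\<lambda>k l. b l (c (p - k - l) (a k w)))"
    using vanishes2_transpose[OF vanishes2_acb[OF assms(2,1,3)], of p w]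
    by (simp add: algebra_simps)
  ultimately show ?thesis
    by (simp only: field_product_def[of _ a] pairing_X_intpow residue_def
        left_series_def[of a, abs_def]
        right_series_def[of a, abs_def] z_power2_def z_power_diff vanishes_z_power_slice
        vanishes2_abc[OF assms] vanishes2_acb[OF assms] vanishes2_cba[OF assms] minus_apply)
qed

lemma X_intpow_commutator_expand:
  assumes "is_field a" "is_field b" "is_field c"
  shows "field_product (fls_X_intpow m) a (field_product (fls_X_intpow n) b c) p w -
      field_product (fls_X_intpow n) b (field_product (fls_X_intpow m) a c) p w =
    z_power2 Upper Upper m n (\<lambda>k l. a k (b l (c (p - k - l) w)) - b l (a k (c (p - k - l) w))) -
    z_power2 Lower Lower m n (\<lambda>k l. c (p - k - l) (a k (b l w) - b l (a k w)))"
proof -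
  have swap: "p - l - k = p - k - l" for k l :: int by simp
  note abc = vanishes2_abc[OF assms, of p w] vanishes2_cba[OF assms, of p w]
  note bac = vanishes2_abc[OF assms(2,1,3), of p w] vanishes2_acb[OF assms(2,1,3), of p w]
    vanishes2_cba[OF assms(2,1,3), of p w]
  have bca: "vanishes2 Lower Upper (\<lambda>k l. a l (c (p - k - l) (b k w)))"
    using vanishes2_transpose[OF vanishes2_acb[OF assms, of p w]] by (simp only: swap)
  have "field_product (fls_X_intpow n) b (field_product (fls_X_intpow m) a c) p w =
    z_power2 Upper Upper m n (\<lambda>k l. b l (a k (c (p - k - l) w))) -
    z_power2 Lower Upper m n (\<lambda>k l. b l (c (p - k - l) (a k w))) -
    (z_power2 Upper Lower m n (\<lambda>k l. a k (c (p - k - l) (b l w))) -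
     z_power2 Lower Lower m n (\<lambda>k l. c (p - k - l) (a k (b l w))))"
    unfolding field_product_X_intpow_iterate[OF assms(2,1,3)]
    by (simp only: z_power2_swap[OF bac(1)] z_power2_swap[OF bac(2)] z_power2_swap[OF bac(3)]
        z_power2_swap[OF bca] swap)
  moreover note bac[THEN vanishes2_transpose]
  ultimately show ?thesis
    unfolding field_product_X_intpow_iterate[OF assms] using abc
    by (simp add: z_power2_diff field_diff[OF assms(3)] swap)
qed

lemma z_power2_diagonal:
  assumes "vanishes s H"
  shows "z_power2 s s m n (\<lambda>k l. sc ((- of_int k) ^ i / fact i) (H (k + l))) =
    sc (1 / fact i) (z_power s m ((neg_index ^^ i) (z_power s n H)) 0)"
proof -
  have scale: "z_power s j (\<lambda>l. sc x (L l)) = (\<lambda>l. sc x (z_power s j L l))" if "vanishes s L"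
      for x j L
    by (rule z_power_map[OF scale_right_diff_distrib that])
  have "z_power s n (\<lambda>l. sc x (H (k + l))) 0 = sc x (z_power s n H k)" for x k
    using scale[OF vanishes_shift[OF assms, of k]] z_power_shift[OF assms, of n k]
    by (simp add: add.commute)
  then have "z_power2 s s m n (\<lambda>k l. sc ((- of_int k) ^ i / fact i) (H (k + l))) =
      z_power s m (\<lambda>k. sc (1 / fact i) ((neg_index ^^ i) (z_power s n H) k)) 0"
    by (simp add: z_power2_def neg_index_pow)
  moreover have "vanishes s ((neg_index ^^ i) (z_power s n H))"
    by (induction i) (simp_all add: vanishes_z_power assms vanishes_neg_index)
  ultimately show ?thesis by (simp add: scale)
qed

lemma z_power2_diagonal_pairing:
  assumes "local_pair K L R"
  shows "z_power2 Upper Upper m n (\<lambda>k l. sc ((- of_int k) ^ i / fact i) (L (k + l))) -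
      z_power2 Lower Lower m n (\<lambda>k l. sc ((- of_int k) ^ i / fact i) (R (k + l))) =
    sc (1 / fact i) (pairing ((euler ^^ i) (fls_X_intpow m) * fls_X_intpow n) L R)"
proof -
  obtain K' where K': "int K \<le> int K' + n" using that[of "nat (int K - n)"] by auto
  have "pairing ((euler ^^ i) (fls_X_intpow m) * fls_X_intpow n) L R =
      pairing ((euler ^^ i) (fls_X_intpow m)) (z_power Upper n L) (z_power Lower n R)"
    using pairing_X_intpow_mult[OF assms, of n "(euler ^^ i) (fls_X_intpow m)"]
    by (simp only: mult.commute)
  also have "\<dots> = residue m ((neg_index ^^ i) (z_power Upper n L))
      ((neg_index ^^ i) (z_power Lower n R))"
    by (simp only: pairing_euler_pow[OF local_pair_z_power[OF assms K']] pairing_X_intpow)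
  finally show ?thesis
    by (simp add: z_power2_diagonal local_pair_vanishes[OF assms] residue_def
        scale_right_diff_distrib)
qed

lemma X_intpow_commutator:
  assumes fields: "is_field a" "is_field b" "is_field c" and loc: "local_order K a b"
    and product_loc: "\<And>i. i < K \<Longrightarrow> mutually_local (field_product (log_y powi int i) a b) c"
  shows "field_product (fls_X_intpow m) a (field_product (fls_X_intpow n) b c) p w -
      field_product (fls_X_intpow n) b (field_product (fls_X_intpow m) a c) p w =
    (\<Sum>i<K. fscale (1 / fact i) (field_product ((euler ^^ i) (fls_X_intpow m) * fls_X_intpow n)
      (field_product (log_y powi int i) a b) c) p w)"
proof -
  define e where "e i = field_product (log_y powi int i) a b" for i
  have e: "is_field (e i)" for i unfolding e_def by (rule is_field_product[OF fields(1,2) loc])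
  let ?L = "\<lambda>i. left_series (e i) c p w" and ?R = "\<lambda>i. right_series (e i) c p w"
  let ?x = "\<lambda>i k. (- of_int k) ^ i / fact i :: 'a"
  have diagonal: "vanishes2 s s (\<lambda>k l. sc (?x i k) (H (k + l)))" if "vanishes s H" for s i H
    using that by (rule vanishes2_diagonal) simp
  note vanish = vanishes_left_series[OF e fields(3)] vanishes_right_series[OF e fields(3)]
  have ab: "a k (b l v) - b l (a k v) = (\<Sum>i<K. sc (?x i k) (e i (k + l) v))" for k l v
    using commutator_eq_sum_products[OF fields(1,2) loc] by (simp add: e_def)
  have "field_product (fls_X_intpow m) a (field_product (fls_X_intpow n) b c) p w -
      field_product (fls_X_intpow n) b (field_product (fls_X_intpow m) a c) p w =
      z_power2 Upper Upper m n (\<lambda>k l. \<Sum>i<K. sc (?x i k) (?L i (k + l))) -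
      z_power2 Lower Lower m n (\<lambda>k l. \<Sum>i<K. sc (?x i k) (?R i (k + l)))"
    unfolding X_intpow_commutator_expand[OF fields] ab
    by (simp add: left_series_def right_series_def field_sum[OF fields(3)]
        field_scale[OF fields(3)] diff_diff_eq)
  also have "\<dots> = (\<Sum>i<K. z_power2 Upper Upper m n (\<lambda>k l. sc (?x i k) (?L i (k + l))) -
      z_power2 Lower Lower m n (\<lambda>k l. sc (?x i k) (?R i (k + l))))"
    by (simp add: z_power2_sum diagonal vanish sum_subtractf)
  also have "\<dots> = (\<Sum>i<K. fscale (1 / fact i)
      (field_product ((euler ^^ i) (fls_X_intpow m) * fls_X_intpow n) (e i) c) p w)"
  proof (rule sum.cong[OF refl])
    fix i assume "i \<in> {..<K}"
    then obtain K' where "local_pair K' (?L i) (?R i)"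
      using mutually_local_local_pair[OF e fields(3)] product_loc[of i] unfolding e_def by blast
    from z_power2_diagonal_pairing[OF this]
    show "z_power2 Upper Upper m n (\<lambda>k l. sc (?x i k) (?L i (k + l))) -
        z_power2 Lower Lower m n (\<lambda>k l. sc (?x i k) (?R i (k + l))) =
      fscale (1 / fact i)
        (field_product ((euler ^^ i) (fls_X_intpow m) * fls_X_intpow n) (e i) c) p w"
      by (simp only: fscale_def field_product_def)
  qed
  finally show ?thesis by (simp only: e_def)
qed

lemma fscale_add: "fscale x (a + b) = fscale x a + fscale x b"
  by (intro ext) (simp add: fscale_def scale_right_distrib)

lemma fscale_diff: "fscale x (a - b) = fscale x a - fscale x b"
  by (intro ext) (simp add: fscale_def scale_right_diff_distrib)

lemma fscale_zero: "fscale x 0 = 0"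
  by (intro ext) (simp add: fscale_def)

lemma fscale_fscale: "fscale x (fscale y a) = fscale (x * y) a"
  by (intro ext) (simp add: fscale_def)

lemma fscale_sum: "fscale x (\<Sum>i\<in>I. a i) = (\<Sum>i\<in>I. fscale x (a i))"
  by (intro ext) (simp add: fscale_def sum_apply scale_sum_right)

lemma is_field_product_mutually_local:
  "is_field a \<Longrightarrow> is_field b \<Longrightarrow> mutually_local a b \<Longrightarrow> is_field (field_product g a b)"
  using is_field_product by (auto simp: mutually_local_def)

lemma mutually_local_field_product_right:
  assumes "is_field a" "is_field b" "is_field c"
    and "mutually_local a b" "mutually_local a c" "mutually_local b c"
  shows "mutually_local a (field_product g b c)"
  using assms mutually_local_sym[of a]
  by (intro mutually_local_sym[OF mutually_local_field_product]) simp_all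

lemma common_local_order_family:
  assumes "finite I" "is_field c" "\<And>i. i \<in> I \<Longrightarrow> is_field (e i) \<and> mutually_local (e i) c"
  shows "\<exists>K. \<forall>i\<in>I. local_order K (e i) c"
proof -
  have "\<forall>i\<in>I. \<exists>K. local_order K (e i) c" using assms(3) by (auto simp: mutually_local_def)
  from bchoice[OF this] obtain K where K: "\<forall>i\<in>I. local_order (K i) (e i) c" by blast
  have "local_order (Max (K ` I)) (e i) c" if i: "i \<in> I" for i
    by (rule local_order_mono[OF _ assms(2) K[rule_format, OF i]]) (simp_all add: i assms)
  then show ?thesis by blast
qed

definition commutator_expansion ::
  "nat \<Rightarrow> 'w formal_field \<Rightarrow> 'w formal_field \<Rightarrow> 'w formal_field \<Rightarrow>
    'a fls \<Rightarrow> 'a fls \<Rightarrow> 'w formal_field" where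
  "commutator_expansion K a b c g h = (\<Sum>i<K. fscale (1 / fact i)
      (field_product ((euler ^^ i) g * h) (field_product (log_y powi int i) a b) c))"

definition commutator_defect ::
  "nat \<Rightarrow> 'w formal_field \<Rightarrow> 'w formal_field \<Rightarrow> 'w formal_field \<Rightarrow>
    'a fls \<Rightarrow> 'a fls \<Rightarrow> 'w formal_field" where
  "commutator_defect K a b c g h =
    field_product g a (field_product h b c) - field_product h b (field_product g a c) -
    commutator_expansion K a b c g h"

context
  fixes a b c :: "'w formal_field" and K :: nat
  assumes fields: "is_field a" "is_field b" "is_field c"
    and loc: "local_order K a b" "mutually_local a c" "mutually_local b c"
begin

lemma commutator_side_conditions:
  "mutually_local a b" "is_field (field_product g a b)" "is_field (field_product g a c)"
  "is_field (field_product g b c)" "mutually_local (field_product g a b) c"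
  "mutually_local a (field_product g b c)" "mutually_local b (field_product g a c)"
proof -
  show ab: "mutually_local a b" by (rule mutually_localI[OF loc(1)])
  show "is_field (field_product g a b)" "is_field (field_product g a c)"
      "is_field (field_product g b c)"
    by (intro is_field_product_mutually_local fields loc ab)+
  show "mutually_local (field_product g a b) c"
    by (intro mutually_local_field_product fields loc ab)
  show "mutually_local a (field_product g b c)" "mutually_local b (field_product g a c)"
    by (intro mutually_local_field_product_right fields loc ab mutually_local_sym[OF ab])+
qed

lemma commutator_defect_add_left:
  "commutator_defect K a b c (f + g) h =
      commutator_defect K a b c f h + commutator_defect K a b c g h"
  using fields loc commutator_side_conditions
  by (simp add: commutator_defect_def commutator_expansion_def field_product_add
      field_product_add_right euler_pow_add distrib_right fscale_add sum.distrib)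

lemma commutator_defect_add_right:
  "commutator_defect K a b c f (g + h) =
      commutator_defect K a b c f g + commutator_defect K a b c f h"
  using fields loc commutator_side_conditions
  by (simp add: commutator_defect_def commutator_expansion_def field_product_add
      field_product_add_right distrib_left fscale_add sum.distrib)

lemma commutator_expansion_high:
  "\<exists>N. \<forall>P Q g h. (\<forall>j<P. g $$ j = 0) \<longrightarrow> (\<forall>j<Q. h $$ j = 0) \<longrightarrow> N \<le> P + Q \<longrightarrow>
    commutator_expansion K a b c g h = 0"
proof -
  obtain N where N: "\<And>i. i < K \<Longrightarrow> local_order N (field_product (log_y powi int i) a b) c"
    using common_local_order_family[of "{..<K}" c "\<lambda>i. field_product (log_y powi int i) a b"]
        fields(3)
      commutator_side_conditions(2,5) by blast
  have "field_product ((euler ^^ i) g * h) (field_product (log_y powi int i) a b) c = 0"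
    if "\<forall>j<P. g $$ j = 0" "\<forall>j<Q. h $$ j = 0" "int N + int K \<le> P + Q" "i < K" for P Q g h i
  proof (rule field_product_eq_0[OF commutator_side_conditions(2) fields(3) N[OF that(4)]])
    fix j assume "j < int N"
    then show "((euler ^^ i) g * h) $$ j = 0"
      using that by (intro fls_times_nth_below[of "P - int i" _ Q] euler_pow_nth_below[of P]) auto
  qed
  then have "commutator_expansion K a b c g h = 0"
    if "\<forall>j<P. g $$ j = 0" "\<forall>j<Q. h $$ j = 0" "int N + int K \<le> P + Q" for P Q g h
    unfolding commutator_expansion_def using that
    by (intro sum.neutral ballI) (simp add: fscale_zero)
  then show ?thesis by blast
qed

lemma commutator_defect_high_left: "\<exists>M. \<forall>g. (\<forall>j<M. g $$ j = 0) \<longrightarrow> commutator_defect K a b c g h = 0"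
proof -
  obtain A where A: "local_order A a (field_product h b c)" "local_order A a c"
    using common_local_order[of a "field_product h b c" a c] fields loc commutator_side_conditions
    by blast
  obtain N where N: "\<forall>P Q g h. (\<forall>j<P. g $$ j = 0) \<longrightarrow> (\<forall>j<Q. h $$ j = 0) \<longrightarrow> N \<le> P + Q \<longrightarrow>
      commutator_expansion K a b c g h = 0"
    using commutator_expansion_high by blast
  define M where "M = max (int A) (N - fls_subdegree h)"
  have "commutator_defect K a b c g h = 0" if g: "\<forall>j<M. g $$ j = 0" for g
  proof -
    have "field_product g a (field_product h b c) = 0" "field_product g a c = 0"
      using A fields commutator_side_conditions g by (auto simp: M_def intro!: field_product_eq_0)
    moreover have "N \<le> M + fls_subdegree h" by (simp add: M_def)
    ultimately show ?thesis
      using N[rule_format, of M g "fls_subdegree h" h] g fields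
      by (simp add: commutator_defect_def field_product_zero_right)
  qed
  then show ?thesis by blast
qed

lemma commutator_defect_high_right: "\<exists>M. \<forall>h. (\<forall>j<M. h $$ j = 0) \<longrightarrow> commutator_defect K a b c g h = 0"
proof -
  obtain B where B: "local_order B b (field_product g a c)" "local_order B b c"
    using common_local_order[of b "field_product g a c" b c] fields loc commutator_side_conditions
    by blast
  obtain N where N: "\<forall>P Q g h. (\<forall>j<P. g $$ j = 0) \<longrightarrow> (\<forall>j<Q. h $$ j = 0) \<longrightarrow> N \<le> P + Q \<longrightarrow>
      commutator_expansion K a b c g h = 0"
    using commutator_expansion_high by blast
  define M where "M = max (int B) (N - fls_subdegree g)"
  have "commutator_defect K a b c g h = 0" if h: "\<forall>j<M. h $$ j = 0" for h
  proof -
    have "field_product h b (field_product g a c) = 0" "field_product h b c = 0"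
      using B fields commutator_side_conditions h by (auto simp: M_def intro!: field_product_eq_0)
    moreover have "N \<le> fls_subdegree g + M" by (simp add: M_def)
    ultimately show ?thesis
      using N[rule_format, of "fls_subdegree g" g M h] h fields
      by (simp add: commutator_defect_def field_product_zero_right)
  qed
  then show ?thesis by blast
qed

lemma commutator_defect_monomial:
  "commutator_defect K a b c (fls_const x * fls_X_intpow m) (fls_const y * fls_X_intpow n) = 0"
proof -
  have bilinear: "(euler ^^ i) (fls_const x * f) * (fls_const y * g) =
      fls_const (x * y) * ((euler ^^ i) f * g)" for i f g
    by (simp only: euler_pow_const_mult) (simp only: fls_const_mult_const[symmetric] mult_ac)
  have "commutator_defect K a b c (fls_const x * f) (fls_const y * g) =
      fscale (x * y) (commutator_defect K a b c f g)" for f g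
    unfolding commutator_defect_def commutator_expansion_def bilinear
      using fields loc commutator_side_conditions
    by (simp add: field_product_const_mult field_product_fscale_right fscale_diff
        fscale_sum fscale_fscale mult.commute[of y x])
  moreover have "commutator_defect K a b c (fls_X_intpow m) (fls_X_intpow n) = 0"
    unfolding commutator_defect_def commutator_expansion_def
    by (intro ext, simp only: minus_apply sum_apply zero_fun_apply)
      (subst X_intpow_commutator[OF fields loc(1)], use commutator_side_conditions in auto)
  ultimately show ?thesis by (simp only: fscale_zero)
qed

theorem field_product_commutator:
  "field_product g a (field_product h b c) - field_product h b (field_product g a c) =
    commutator_expansion K a b c g h"
proof -
  have "commutator_defect K a b c g h = 0"
    by (rule fls_biadditive_eq_0[of "commutator_defect K a b c"])
       (rule commutator_defect_add_left commutator_defect_add_right commutator_defect_high_left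
         commutator_defect_high_right commutator_defect_monomial)+
  then show ?thesis by (simp add: commutator_defect_def)
qed

end

text \<open>With \<open>x1 = x e^t\<close>, the \<open>n\<close>-th product of \<open>a\<close> and \<open>b\<close> is the coefficient of \<open>t^(-n-1)\<close> in the
  operator product \<open>Y(a, t) b\<close> of the coordinate \<open>\<phi>(x, t) = x e^t\<close>.\<close>

abbreviation nth_product :: "'w formal_field \<Rightarrow> int \<Rightarrow> 'w formal_field \<Rightarrow> 'w formal_field" where
  "nth_product a n b \<equiv> field_product (log_y powi n) a b"

theorem nth_product_commutator:
  assumes "is_field a" "is_field b" "is_field c" "local_order K a b" "mutually_local a c"
      "mutually_local b c"
  shows "nth_product a m (nth_product b n c) - nth_product b n (nth_product a m c) =
    (\<Sum>i<K. fscale (of_int m gchoose i) (nth_product (nth_product a (int i) b) (m + n - int i) c))"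
proof -
  have "(euler ^^ i) (log_y powi m) * log_y powi n =
      fls_const (fact i * (of_int m gchoose i)) * (log_y powi (m + n - int i) :: 'a fls)" for i
  proof -
    have "m + n - int i = (m - int i) + n" by simp
    then show ?thesis by (simp only: euler_pow_log_y_powi power_int_add log_y_nonzero simp_thms
        mult.assoc)
  qed
  then show ?thesis
    unfolding field_product_commutator[OF assms] commutator_expansion_def
    using assms
    by (simp add: field_product_const_mult is_field_product_mutually_local
        mutually_local_field_product mutually_localI fscale_fscale)
qed

section \<open>Derivatives of fields and the identity field\<close>

lemma pairing_sum:
  assumes "finite I" "\<And>i. i \<in> I \<Longrightarrow> local_pair K (L i) (R i)"
  shows "pairing g (\<lambda>k. \<Sum>i\<in>I. L i k) (\<lambda>k. \<Sum>i\<in>I. R i k) = (\<Sum>i\<in>I. pairing g (L i) (R i)) \<and>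
    local_pair K (\<lambda>k. \<Sum>i\<in>I. L i k) (\<lambda>k. \<Sum>i\<in>I. R i k)"
  using assms
proof (induction I rule: finite_induct)
  case empty
  show ?case using pairing_zero[of g] local_pair_zero[of K] by (simp add: zero_fun_def)
next
  case (insert i I)
  then show ?case
    using pairing_add[of K "L i" "R i" "\<lambda>k. \<Sum>i\<in>I. L i k" "\<lambda>k. \<Sum>i\<in>I. R i k" g]
      local_pair_add[of K "L i" "R i" "\<lambda>k. \<Sum>i\<in>I. L i k" "\<lambda>k. \<Sum>i\<in>I. R i k"]
    by (simp add: plus_fun_def)
qed

definition delta :: "int \<Rightarrow> 'w \<Rightarrow> int \<Rightarrow> 'w" where
  "delta q v k = (if k = q then v else 0)"

lemma local_pair_delta: "local_pair 0 (delta q v) (delta q v)"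
proof -
  have "vanishes_beyond s q (delta q v)" for s
    by (cases s) (auto simp: vanishes_beyond_def delta_def)
  then show ?thesis by (auto simp: local_pair_def intro: vanishesI)
qed

lemma residue_minus_1_delta: "residue (-1) (delta q v) (delta q v) = v"
proof -
  have inverse: "z_power s (-1) (times_z L) = L" if "vanishes_beyond s q L" for s L
    using z_power_times_z[OF vanishesI[OF that], of "-1"] by (simp add: z_power_0)
  let ?U = "\<lambda>k. if k < q then v else 0" and ?V = "\<lambda>k. if k < q then 0 else - v"
  have "times_z ?U = delta q v" "times_z ?V = delta q v"
    by (auto simp: times_z_def delta_def)
  then have "z_power Upper (-1) (delta q v) = ?U" "z_power Lower (-1) (delta q v) = ?V"
    using inverse[of Upper ?U] inverse[of Lower ?V] by (simp_all add: vanishes_beyond_def)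
  then show ?thesis by (simp add: residue_def)
qed

lemma pairing_log_y_inverse:
  assumes "local_pair 0 L R"
  shows "pairing (log_y powi (-1)) L R = residue (-1) L R"
proof -
  have "pairing (log_y powi (-1)) L R = pairing (fls_X_intpow (-1)) L R"
  proof (rule pairing_eqI_high[OF assms])
    fix j assume "j < int 0"
    then show "(log_y powi (-1) - fls_X_intpow (-1)) $$ j = (0 :: 'a)"
      using log_y_powi_minus_1_nth[where 'a = 'a] log_y_powi_nth_below[of j "-1"]
      by (cases "j = -1") auto
  qed
  then show ?thesis by (simp only: pairing_X_intpow)
qed

lemma pairing_log_y:
  assumes "local_pair 2 L R"
  shows "pairing (log_y powi 1) L R = residue 1 L R"
proof -
  have "pairing (log_y powi 1) L R = pairing (fls_X_intpow 1) L R"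
  proof (rule pairing_eqI_high[OF assms])
    fix j :: int assume "j < int 2"
    then show "(log_y powi 1 - fls_X_intpow 1) $$ j = (0 :: 'a)"
      using log_y_nth_1[where 'a = 'a] by (cases "j = 1") auto
  qed
  then show ?thesis by (simp only: pairing_X_intpow)
qed

lemma pairing_delta:
  "pairing (log_y powi (-1 - int n)) (delta q v) (delta q v) = sc (of_int q ^ n / fact n) v"
proof -
  let ?c = "fact n * (-1) ^ n :: 'a"
  have "(of_int (-1) gchoose n :: 'a) = (-1) ^ n"
    using gbinomial_minus[of "1::'a" n] by (simp flip: binomial_gbinomial)
  then have euler: "(euler ^^ n) (log_y powi (-1) :: 'a fls) =
      fls_const ?c * log_y powi (-1 - int n)"
    by (simp only: euler_pow_log_y_powi)
  have "(neg_index ^^ n) (delta q v) = delta q (sc ((- of_int q) ^ n) v)"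
    by (auto simp: neg_index_pow delta_def)
  then have "sc ?c (pairing (log_y powi (-1 - int n)) (delta q v) (delta q v)) =
      sc ((- of_int q) ^ n) v"
    using pairing_euler_pow[OF local_pair_delta, of n "log_y powi (-1)" q v]
    by (simp only: euler pairing_const_mult[OF local_pair_delta]
        pairing_log_y_inverse[OF local_pair_delta] residue_minus_1_delta)
  also have "\<dots> = sc ?c (sc (of_int q ^ n / fact n) v)"
    by (simp flip: power_mult_distrib)
  finally show ?thesis by (rule scale_left_imp_eq[rotated]) simp
qed

lemma pairing_log_y_nonneg: "local_pair 0 L R \<Longrightarrow> n \<ge> 0 \<Longrightarrow> pairing (log_y powi n) L R = 0"
  by (rule pairing_eq_0) (auto intro!: log_y_powi_nth_below)

lemma pairing_finite_support:
  assumes "finite I" "\<And>k. k \<notin> I \<Longrightarrow> L k = 0"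
  shows "pairing (log_y powi (-1 - int n)) L L = (\<Sum>k\<in>I. sc (of_int k ^ n / fact n) (L k))"
    and "m \<ge> 0 \<Longrightarrow> pairing (log_y powi m) L L = 0"
proof -
  have L: "L = (\<lambda>k. \<Sum>q\<in>I. delta q (L q) k)"
    using assms by (auto simp: delta_def fun_eq_iff)
  note sum = pairing_sum[OF assms(1) local_pair_delta, of _ id L, simplified id_def]
  show "pairing (log_y powi (-1 - int n)) L L = (\<Sum>k\<in>I. sc (of_int k ^ n / fact n) (L k))"
    using sum by (subst (1 2) L) (simp only: pairing_delta)
  show "m \<ge> 0 \<Longrightarrow> pairing (log_y powi m) L L = 0"
    using sum by (subst (1 2) L) (simp add: pairing_log_y_nonneg local_pair_delta)
qed

definition divided_euler :: "nat \<Rightarrow> 'w formal_field \<Rightarrow> 'w formal_field" where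
  "divided_euler n a k w = sc (of_int k ^ n / fact n) (a k w)"

lemma nth_product_id_right:
  assumes "is_field a"
  shows "nth_product a n id_field = (if n < 0 then divided_euler (nat (- n - 1)) a else 0)"
proof (intro ext)
  fix p w
  have "left_series a id_field p w = delta p (a p w)"
      "right_series a id_field p w = delta p (a p w)"
    by (auto simp: left_series_def right_series_def id_field_def delta_def field_zero[OF assms])
  then have product: "nth_product a n id_field p w =
      pairing (log_y powi n) (delta p (a p w)) (delta p (a p w))"
    by (simp add: field_product_def)
  show "nth_product a n id_field p w = (if n < 0 then divided_euler (nat (- n - 1)) a else 0) p w"
  proof (cases "n < 0")
    case True
    then have "n = - 1 - int (nat (- n - 1))" by simp
    then show ?thesis
      using True product pairing_delta[of "nat (- n - 1)" p "a p w"]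
      by (simp add: divided_euler_def)
  qed (simp add: product pairing_log_y_nonneg local_pair_delta)
qed

lemma nth_product_id_left:
  assumes "is_field b"
  shows "nth_product id_field n b = (if n = -1 then b else 0)"
proof (intro ext)
  fix p w
  have "left_series id_field b p w = delta 0 (b p w)"
      "right_series id_field b p w = delta 0 (b p w)"
    by (auto simp: left_series_def right_series_def id_field_def delta_def field_zero[OF assms])
  then have product: "nth_product id_field n b p w =
      pairing (log_y powi n) (delta 0 (b p w)) (delta 0 (b p w))"
    by (simp add: field_product_def)
  show "nth_product id_field n b p w = (if n = -1 then b else 0) p w"
  proof (cases "n < 0")
    case True
    then have "n = - 1 - int (nat (- n - 1))" by simp
    then show ?thesis
      using True product pairing_delta[of "nat (- n - 1)" 0 "b p w"] by (simp add: power_0_left)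
  qed (simp add: product pairing_log_y_nonneg local_pair_delta)
qed

lemma is_field_divided_euler: "is_field a \<Longrightarrow> is_field (divided_euler n a)"
  unfolding is_field_def[of "divided_euler n a"] divided_euler_def
  by (auto simp: field_add field_scale scale_right_distrib mult.commute intro!: endoI
      intro: vanishes_mono[OF is_field_vanishes])

lemma divided_euler_left_series:
  assumes "is_field b"
  shows "left_series (divided_euler n a) b p w =
      (\<lambda>k. sc ((-1) ^ n / fact n) ((neg_index ^^ n) (left_series a b p w) k))"
    and "right_series (divided_euler n a) b p w =
      (\<lambda>k. sc ((-1) ^ n / fact n) ((neg_index ^^ n) (right_series a b p w) k))"
  using assms
  by (auto simp: left_series_def right_series_def divided_euler_def neg_index_pow field_scale
      fun_eq_iff simp flip: power_mult_distrib)

lemma local_order_divided_euler: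
  assumes "is_field a" "is_field b" "local_order K a b"
  shows "local_order (n + K) (divided_euler n a) b"
proof -
  have "local_pair K (left_series a b p w) (right_series a b p w)" for p w
    using assms by (simp add: local_order_iff_local_pair)
  from local_pair_map[OF local_pair_neg_index_pow[OF this, of n] endo_scale[of "(-1) ^ n / fact n"]]
  show ?thesis
    by (simp add: local_order_iff_local_pair is_field_divided_euler assms(1,2)
        divided_euler_left_series)
qed

lemma mutually_local_divided_euler:
  "is_field a \<Longrightarrow> is_field b \<Longrightarrow> mutually_local a b \<Longrightarrow> mutually_local (divided_euler n a) b"
  using local_order_divided_euler unfolding mutually_local_def by blast

lemma field_product_divided_euler_left:
  assumes "is_field a" "is_field b" "mutually_local a b"
  shows "field_product g (divided_euler n a) b =
      fscale ((-1) ^ n / fact n) (field_product ((euler ^^ n) g) a b)"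
proof -
  obtain K where pair: "\<And>p w. local_pair K (left_series a b p w) (right_series a b p w)"
    using mutually_local_local_pair[OF assms] by auto
  show ?thesis
  proof (intro ext)
    fix p w
    have "field_product g (divided_euler n a) b p w =
        pairing g (\<lambda>k. sc ((-1) ^ n / fact n) ((neg_index ^^ n) (left_series a b p w) k))
          (\<lambda>k. sc ((-1) ^ n / fact n) ((neg_index ^^ n) (right_series a b p w) k))"
      by (simp only: field_product_def divided_euler_left_series[OF assms(2)])
    also have "\<dots> = sc ((-1) ^ n / fact n)
        (pairing ((euler ^^ n) g) (left_series a b p w) (right_series a b p w))"
      by (simp only: pairing_scale[OF local_pair_neg_index_pow[OF pair]] pairing_euler_pow[OF pair])
    finally show "field_product g (divided_euler n a) b p w =
        fscale ((-1) ^ n / fact n) (field_product ((euler ^^ n) g) a b) p w"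
      by (simp only: fscale_def field_product_def)
  qed
qed

lemma of_int_power_div_fact_add:
  "(of_int (k + l) :: 'a) ^ n / fact n =
      (\<Sum>i\<le>n. of_int k ^ i / fact i * (of_int l ^ (n - i) / fact (n - i)))"
proof -
  have "(of_int (k + l) :: 'a) ^ n / fact n =
      (\<Sum>i\<le>n. of_nat (n choose i) * of_int k ^ i * of_int l ^ (n - i) / fact n)"
    by (simp add: binomial_ring sum_divide_distrib)
  also have "\<dots> = (\<Sum>i\<le>n. of_int k ^ i / fact i * (of_int l ^ (n - i) / fact (n - i)))"
    by (rule sum.cong) (auto simp: binomial_fact)
  finally show ?thesis .
qed

lemma scale_divided_power_split:
  "sc (of_int p ^ n / fact n) v =
    (\<Sum>i\<le>n. sc ((-1) ^ i / fact i)
        (sc ((- of_int k) ^ i) (sc (of_int (p - k) ^ (n - i) / fact (n - i)) v)))"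
proof -
  have sign: "(-1) ^ i / fact i * (- of_int k) ^ i = (of_int k ^ i / fact i :: 'a)" for i
    by (simp add: power_mult_distrib[symmetric])
  show ?thesis
    using of_int_power_div_fact_add[of k "p - k" n]
    by (simp only: scale_scale sign mult.assoc[symmetric]) (simp add: scale_sum_left)
qed

text \<open>On coefficients this is the binomial theorem for \<open>p = k + (p - k)\<close>.\<close>

lemma divided_euler_field_product:
  assumes "is_field a" "is_field b" "mutually_local a b"
  shows "divided_euler n (field_product g a b) =
    (\<Sum>i\<le>n. fscale ((-1) ^ i / fact i) (field_product ((euler ^^ i) g) a (divided_euler (n - i) b)))"
proof (intro ext)
  fix p w
  obtain K where K: "local_order K a b" using assms(3) by (auto simp: mutually_local_def)
  let ?b = "\<lambda>i. divided_euler (n - i) b"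
  let ?L = "\<lambda>i. left_series a (?b i) p w" and ?R = "\<lambda>i. right_series a (?b i) p w"
  have pair: "local_pair (n - i + K) (?L i) (?R i)" for i
    using local_order_sym[OF local_order_divided_euler[OF assms(2,1) local_order_sym[OF K]],
        of "n - i"] assms
    by (simp add: local_order_iff_local_pair is_field_divided_euler)
  let ?c = "\<lambda>i. (-1) ^ i / fact i :: 'a"
  have pair_i: "local_pair (n + K) (\<lambda>k. sc (?c i) ((neg_index ^^ i) (?L i) k))
      (\<lambda>k. sc (?c i) ((neg_index ^^ i) (?R i) k))" if "i \<in> {..n}" for i
    using local_pair_mono[OF local_pair_map[OF local_pair_neg_index_pow[OF pair, of i] endo_scale]]
        that by simp
  have left: "sc (of_int p ^ n / fact n) (left_series a b p w k) =
      (\<Sum>i\<le>n. sc (?c i) ((neg_index ^^ i) (?L i) k))" for k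
    by (subst scale_divided_power_split[of _ _ _ k])
        (simp add: neg_index_pow left_series_def divided_euler_def field_scale[OF assms(1)])
  have right: "sc (of_int p ^ n / fact n) (right_series a b p w k) =
      (\<Sum>i\<le>n. sc (?c i) ((neg_index ^^ i) (?R i) k))" for k
    by (subst scale_divided_power_split[of _ _ _ k])
        (simp add: neg_index_pow right_series_def divided_euler_def)
  have "divided_euler n (field_product g a b) p w =
      pairing g (\<lambda>k. sc (of_int p ^ n / fact n) (left_series a b p w k))
        (\<lambda>k. sc (of_int p ^ n / fact n) (right_series a b p w k))"
    using pairing_scale[of K "left_series a b p w" "right_series a b p w"] K assms(1,2)
    by (simp add: divided_euler_def field_product_def local_order_iff_local_pair)
  also have "\<dots> = (\<Sum>i\<le>n. pairing g (\<lambda>k. sc (?c i) ((neg_index ^^ i) (?L i) k))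
        (\<lambda>k. sc (?c i) ((neg_index ^^ i) (?R i) k)))"
    unfolding left right by (rule pairing_sum[OF finite_atMost pair_i, THEN conjunct1])
  also have "\<dots> = (\<Sum>i\<le>n. sc (?c i) (pairing ((euler ^^ i) g) (?L i) (?R i)))"
    by (simp only: pairing_scale[OF local_pair_neg_index_pow[OF pair]] pairing_euler_pow[OF pair])
  finally show "divided_euler n (field_product g a b) p w =
      (\<Sum>i\<le>n. fscale (?c i) (field_product ((euler ^^ i) g) a (?b i))) p w"
    by (simp add: sum_apply fscale_def field_product_def)
qed

lemma divided_euler_nth_product:
  assumes "is_field a" "is_field b" "mutually_local a b"
  shows "divided_euler n (nth_product a m b) =
    (\<Sum>i\<le>n. fscale ((-1) ^ i * (of_int m gchoose i))
        (nth_product a (m - int i) (divided_euler (n - i) b)))"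
proof -
  have "is_field (divided_euler j b) \<and> mutually_local a (divided_euler j b)" for j
    using assms mutually_local_divided_euler[of b a]
    by (blast intro: is_field_divided_euler mutually_local_sym)
  then show ?thesis
    unfolding divided_euler_field_product[OF assms]
    by (simp add: euler_pow_log_y_powi field_product_const_mult assms fscale_fscale)
qed

lemma nth_product_affine_commutator:
  assumes fields: "is_field a" "is_field b"
    and commutator: "\<And>k l w. a k (b l w) - b l (a k w) =
        u (k + l) w + sc (- of_int k) (v (k + l) w)"
  shows "local_order 2 a b" "nth_product a 0 b = u" "nth_product a 1 b = v"
proof -
  have diff: "left_series a b p w - right_series a b p w = (\<lambda>k. u p w + sc (- of_int k) (v p w))"
      for p w
    using commutator[of _ "p - _" w] by (simp add: fun_eq_iff left_series_def right_series_def)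
  have times_z: "times_z (left_series a b p w) - times_z (right_series a b p w) = (\<lambda>k. v p w)"
      for p w
    unfolding times_z_diff[symmetric] diff by (simp add: fun_eq_iff times_z_def algebra_simps)
  have "times_z (times_z (left_series a b p w)) - times_z (times_z (right_series a b p w)) = 0"
      for p w
  proof -
    have "times_z (\<lambda>k. v p w) = 0" by (simp add: times_z_def fun_eq_iff)
    then show ?thesis using times_z[of p w] by (simp only: times_z_diff[symmetric])
  qed
  then show order: "local_order 2 a b" by (simp add: local_order_def numeral_2_eq_2)
  have pair: "local_pair 2 (left_series a b p w) (right_series a b p w)" for p w
    using order fields by (simp add: local_order_iff_local_pair)
  show "nth_product a 0 b = u"
    using diff pairing_X_intpow[of 0]
    by (intro ext) (simp add: field_product_def residue_def z_power_0 fun_eq_iff)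
  have "pairing (log_y powi 1) (left_series a b p w) (right_series a b p w) = v p w" for p w
    using fun_cong[OF times_z[of p w], of 0]
    by (simp only: pairing_log_y[OF pair] residue_def) (simp add: z_power_def)
  then show "nth_product a 1 b = v" by (intro ext) (simp only: field_product_def)
qed

section \<open>Fields generated by mutually local fields\<close>

inductive_set generated :: "'w formal_field set \<Rightarrow> 'w formal_field set" for S where
  id: "id_field \<in> generated S"
| add: "b \<in> generated S \<Longrightarrow> c \<in> generated S \<Longrightarrow> b + c \<in> generated S"
| fscale: "c \<in> generated S \<Longrightarrow> fscale x c \<in> generated S"
| product: "a \<in> S \<Longrightarrow> c \<in> generated S \<Longrightarrow> field_product g a c \<in> generated S"

definition local_set :: "'w formal_field set \<Rightarrow> bool" where
  "local_set S \<longleftrightarrow> (\<forall>a\<in>S. is_field a) \<and> (\<forall>a\<in>S. \<forall>b\<in>S. mutually_local a b)"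

lemma generated_local_generators:
  assumes "local_set S" "c \<in> generated S"
  shows "is_field c \<and> (\<forall>a\<in>S. mutually_local c a)"
  using assms(2)
proof induction
  case id
  then show ?case using assms(1) by (simp add: local_set_def is_field_id mutually_local_id_left)
next
  case (add b c)
  then show ?case using assms(1) unfolding local_set_def
    by (blast intro: is_field_add mutually_local_add_left)
next
  case (fscale c x)
  then show ?case using assms(1)
    by (simp add: local_set_def is_field_fscale mutually_local_fscale_left)
next
  case (product a c g)
  then have "mutually_local a c" by (blast intro: mutually_local_sym)
  with product show ?case
    using assms(1) by (simp add: local_set_def is_field_product_mutually_local
        mutually_local_field_product)
qed

lemma generated_mutually_local:
  assumes "local_set S" "b \<in> generated S" "c \<in> generated S"
  shows "mutually_local b c"
  using assms(2)
proof induction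
  note c = generated_local_generators[OF assms(1,3)]
  case id
  then show ?case using c by (simp add: mutually_local_id_left)
next
  note c = generated_local_generators[OF assms(1,3)]
  case (add a b)
  then show ?case using c generated_local_generators[OF assms(1)]
    by (blast intro: mutually_local_add_left)
next
  note c = generated_local_generators[OF assms(1,3)]
  case (fscale b x)
  then show ?case using c generated_local_generators[OF assms(1)]
    by (simp add: mutually_local_fscale_left)
next
  note c = generated_local_generators[OF assms(1,3)]
  case (product a b g)
  then have "is_field a" "is_field b" "mutually_local a b" "mutually_local a c"
    using assms(1) c generated_local_generators[OF assms(1)]
    by (auto simp: local_set_def intro: mutually_local_sym)
  then show ?case using product c by (simp add: mutually_local_field_product)
qed

lemma generated_zero: "0 \<in> generated S"
proof -
  have "0 = fscale 0 id_field" by (intro ext) (simp add: fscale_def)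
  then show ?thesis using generated.fscale[OF generated.id] by metis
qed

lemma generated_sum: "(\<And>i. i \<in> I \<Longrightarrow> c i \<in> generated S) \<Longrightarrow> (\<Sum>i\<in>I. c i) \<in> generated S"
  by (induction I rule: infinite_finite_induct) (simp_all only: sum.infinite sum.empty sum.insert
      generated_zero generated.add insert_iff simp_thms not_False_eq_True)

lemma fscale_one: "fscale 1 a = a"
  by (intro ext) (simp add: fscale_def)

lemma nth_product_divided_euler_1_left:
  assumes "is_field a" "is_field b" "mutually_local a b"
  shows "nth_product (divided_euler 1 a) n b = fscale (- of_int n) (nth_product a (n - 1) b)"
  using field_product_divided_euler_left[OF assms, of "log_y powi n" 1]
    field_product_const_mult[OF assms, of "of_int n" "log_y powi (n - 1)"]
  by (simp add: euler_log_y_powi fscale_fscale flip: fls_of_int)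

text \<open>The assumption on \<open>A\<close>, \<open>B\<close>, \<open>C\<close> is the common form of the brackets of the fields \<open>T_m(x)\<close> and
  \<open>E_m(x)\<close>, the conclusion that of the brackets of \<open>hat L*\<close>.\<close>

context
  fixes A B C c :: "'w formal_field" and m r :: int and x y :: 'a
  assumes fields: "is_field A" "is_field B" "is_field C"
    and commutator: "\<And>k l w. A k (B l w) - B l (A k w) = sc (of_int (l * m - k * r)) (C (k + l) w) +
      (if m + r = 0 \<and> k + l = 0 then sc (of_int m * x - of_int k * y) w else 0)"
begin

abbreviation (input) "product_0 \<equiv> fscale (of_int m) (divided_euler 1 C) +
    fscale (if m + r = 0 then of_int m * x else 0) id_field"
abbreviation (input) "product_1 \<equiv> fscale (of_int (m + r)) C +
    fscale (if m + r = 0 then y else 0) id_field"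

lemma heisenberg_virasoro_products:
  "local_order 2 A B" "nth_product A 0 B = product_0" "nth_product A 1 B = product_1"
proof -
  have "A k (B l w) - B l (A k w) = product_0 (k + l) w + sc (- of_int k) (product_1 (k + l) w)"
      for k l w
    unfolding commutator
    by (auto simp: fscale_def divided_euler_def id_field_def algebra_simps)
  note affine = nth_product_affine_commutator[OF fields(1,2), of product_0 product_1, OF this]
  show "local_order 2 A B" "nth_product A 0 B = product_0" "nth_product A 1 B = product_1"
    by (fact affine)+
qed

lemma heisenberg_virasoro_nth_product:
  assumes "is_field c" "mutually_local C c"
  shows "nth_product product_0 k c = fscale (of_int m) (nth_product (divided_euler 1 C) k c) +
      fscale (if m + r = 0 then of_int m * x else 0) (nth_product id_field k c)"
    and "nth_product product_1 k c = fscale (of_int (m + r)) (nth_product C k c) +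
      fscale (if m + r = 0 then y else 0) (nth_product id_field k c)"
  using assms fields
  by (subst field_product_add_left; simp only: field_product_fscale_left is_field_fscale
      is_field_divided_euler is_field_id mutually_local_fscale_left mutually_local_divided_euler
      mutually_local_id_left)+

lemma heisenberg_virasoro_bracket:
  assumes "is_field c" "mutually_local A c" "mutually_local B c" "mutually_local C c"
  shows "nth_product A n (nth_product B s c) - nth_product B s (nth_product A n c) =
    fscale (of_int (n * r - m * s)) (nth_product C (n + s - 1) c) +
    fscale (if m + r = 0 \<and> n + s + 1 = 0 then of_int m * x else 0) c +
    fscale (if m + r = 0 \<and> n + s = 0 then of_int n * y else 0) c"
proof -
  have two: "(\<Sum>i<2. F i) = F 0 + F 1" for F :: "nat \<Rightarrow> 'w formal_field"
    by (simp add: numeral_2_eq_2)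
  have "nth_product A n (nth_product B s c) - nth_product B s (nth_product A n c) =
      nth_product product_0 (n + s) c + fscale (of_int n) (nth_product product_1 (n + s - 1) c)"
    unfolding nth_product_commutator[OF fields(1,2) assms(1) heisenberg_virasoro_products(1)
        assms(2,3)] two
    by (simp only: of_nat_0 of_nat_1 gbinomial_0 gbinomial_1 fscale_one diff_0_right
        heisenberg_virasoro_products(2,3))
  also have "\<dots> =
      fscale (of_int (n * r - m * s)) (nth_product C (n + s - 1) c) +
      fscale (if m + r = 0 \<and> n + s + 1 = 0 then of_int m * x else 0) c +
      fscale (if m + r = 0 \<and> n + s = 0 then of_int n * y else 0) c"
    unfolding heisenberg_virasoro_nth_product[OF assms(1,4)]
      nth_product_divided_euler_1_left[OF fields(3) assms(1,4)] nth_product_id_left[OF assms(1)]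
    by (intro ext) (auto simp: fscale_def algebra_simps)
  finally show ?thesis .
qed

end

end

section \<open>The vacuum module as a space of words\<close>

lemma Fin_mono: "Fin (mono p)"
  unfolding Fin_def mono_def by (rule finite_subset[of _ "{p}"]) auto

lemma Fin_add: "Fin u \<Longrightarrow> Fin v \<Longrightarrow> Fin (u + v)"
  unfolding Fin_def by (rule finite_subset[of _ "{w. u w \<noteq> 0} \<union> {w. v w \<noteq> 0}"]) auto

lemma Fin_diff: "Fin u \<Longrightarrow> Fin v \<Longrightarrow> Fin (u - v)"
  unfolding Fin_def by (rule finite_subset[of _ "{w. u w \<noteq> 0} \<union> {w. v w \<noteq> 0}"]) auto

lemma Fin_smul: "Fin u \<Longrightarrow> Fin (smul c u)"
  unfolding Fin_def smul_def by (erule rev_finite_subset) auto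

lemma Fin_zero: "Fin 0"
  by (simp add: Fin_def)

lemma Fin_vac: "Fin vac"
  by (simp add: vac_def Fin_mono)

lemma Fin_sum: "(\<And>i. i \<in> I \<Longrightarrow> Fin (f i)) \<Longrightarrow> Fin (\<Sum>i\<in>I. f i)"
  by (induction I rule: infinite_finite_induct) (simp_all only: sum.infinite sum.empty sum.insert
      Fin_zero Fin_add insert_iff simp_thms not_False_eq_True)

lemma Fin_sum_list: "(\<And>x. x \<in> set xs \<Longrightarrow> Fin (f x)) \<Longrightarrow> Fin (\<Sum>x\<leftarrow>xs. f x)"
  by (induction xs) (simp_all only: list.map sum_list.Nil sum_list.Cons Fin_zero Fin_add list.set
      insert_iff simp_thms)

lemma Fin_lmul:
  assumes "Fin u"
  shows "Fin (lmul x u)"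
proof -
  have "finite ((#) x ` {w. u w \<noteq> 0})" using assms by (simp add: Fin_def)
  then show ?thesis unfolding Fin_def
    by (rule rev_finite_subset) (auto simp: lmul_def split: list.split_asm if_split_asm)
qed

lemma lmul_mono: "lmul x (mono p) = mono (x # p)"
  by (auto simp: lmul_def mono_def fun_eq_iff split: list.splits)

lemma lmul_add: "lmul x (u + v) = lmul x u + lmul x v"
  and lmul_diff: "lmul x (u - v) = lmul x u - lmul x v"
  and lmul_smul: "lmul x (smul c u) = smul c (lmul x u)"
  and lmul_zero: "lmul x 0 = 0"
  by (auto simp: lmul_def smul_def fun_eq_iff split: list.splits)

lemma lmul_sum_list: "lmul x (\<Sum>y\<leftarrow>ys. f y) = (\<Sum>y\<leftarrow>ys. lmul x (f y))"
  by (induction ys) (simp_all only: list.map sum_list.Nil sum_list.Cons lmul_zero lmul_add)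

lemma smul_zero: "smul 0 u = 0"
  by (auto simp: smul_def)

lemma smul_uminus_1_add: "u + smul (-1) v = u - v"
  by (auto simp: smul_def fun_eq_iff)

lemma Fin_expand:
  assumes "Fin v"
  shows "v = (\<Sum>q | v q \<noteq> 0. smul (v q) (mono q))"
proof
  fix w
  have "(\<Sum>q | v q \<noteq> 0. smul (v q) (mono q)) w = (\<Sum>q | v q \<noteq> 0. if q = w then v q else 0)"
    unfolding sum_apply by (rule sum.cong) (auto simp: smul_def mono_def)
  also have "\<dots> = v w" using assms by (simp add: Fin_def)
  finally show "v w = (\<Sum>q | v q \<noteq> 0. smul (v q) (mono q)) w" ..
qed

lemma Fin_induct [consumes 1, case_names add smul_mono]:
  assumes "Fin v" and add: "\<And>u v. Fin u \<Longrightarrow> Fin v \<Longrightarrow> P u \<Longrightarrow> P v \<Longrightarrow> P (u + v)"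
    and smul_mono: "\<And>c q. P (smul c (mono q))"
  shows "P v"
proof -
  have zero: "P 0" using smul_mono[of 0 "[]"] by (simp only: smul_zero)
  have "P (\<Sum>q\<in>I. smul (v q) (mono q))" for I
  proof (induction I rule: infinite_finite_induct)
    case (insert q I)
    then have "P (smul (v q) (mono q) + (\<Sum>q\<in>I. smul (v q) (mono q)))"
      by (intro add smul_mono Fin_sum Fin_smul Fin_mono)
    then show ?case using insert.hyps by (simp only: sum.insert not_False_eq_True)
  qed (simp_all only: sum.infinite sum.empty zero not_False_eq_True)
  then show ?thesis using Fin_expand[OF assms(1)] by metis
qed

lemma foldr_lmul_mono: "foldr lmul p (mono q) = mono (p @ q)"
  by (induction p) (simp_all add: lmul_mono)

lemma foldr_lmul_diff: "foldr lmul p (u - v) = foldr lmul p u - foldr lmul p v"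
  by (induction p) (simp_all only: foldr.simps id_apply comp_apply lmul_diff)

lemma foldr_lmul_smul: "foldr lmul p (smul c u) = smul c (foldr lmul p u)"
  by (induction p) (simp_all add: lmul_smul)

lemma foldr_lmul_sum_list: "foldr lmul p (\<Sum>y\<leftarrow>ys. f y) = (\<Sum>y\<leftarrow>ys. foldr lmul p (f y))"
  by (induction p) (simp_all only: foldr.simps id_apply comp_apply lmul_sum_list)

locale Lstar_module = char_0_space sc for sc :: "complex \<Rightarrow> 'w::ab_group_add \<Rightarrow> 'w" +
  fixes l1 l2 l3 l4 :: complex and tact eact :: "int \<Rightarrow> int \<Rightarrow> 'w \<Rightarrow> 'w"
  assumes restricted_module: "restricted_Lstar_module sc l1 l2 l3 l4 tact eact"
begin

definition T_field :: "int \<Rightarrow> 'w formal_field" where "T_field m k w = zact tact m (- k) w"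

definition E_field :: "int \<Rightarrow> 'w formal_field" where "E_field m k w = zact eact m (- k) w"

lemma zact_0: "zact act 0 0 w = 0"
  by (simp add: zact_def)

lemma endo_zact: "endo (zact tact m n)" "endo (zact eact m n)"
  using restricted_module by (auto simp: restricted_Lstar_module_def intro!: endoI)

lemma restricted: "\<exists>N. \<forall>n\<ge>N. zact tact m n w = 0 \<and> zact eact m n w = 0"
  using restricted_module unfolding restricted_Lstar_module_def by blast

lemma bracket_TT:
  assumes "(m, n) \<noteq> (0, 0)" "(r, s) \<noteq> (0, 0)"
  shows "zact tact m n (zact tact r s w) = zact tact r s (zact tact m n w)"
  using restricted_module assms unfolding restricted_Lstar_module_def by (elim conjE) simp

lemma bracket_TE:
  assumes "(m, n) \<noteq> (0, 0)" "(r, s) \<noteq> (0, 0)"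
  shows "zact tact m n (zact eact r s w) - zact eact r s (zact tact m n w) =
    sc (of_int (n * r - m * s)) (zact tact (m + r) (n + s) w) +
    (if m + r = 0 \<and> n + s = 0 then sc (of_int m * l1 + of_int n * l2) w else 0)"
  using restricted_module assms unfolding restricted_Lstar_module_def by (elim conjE) simp

lemma bracket_EE:
  assumes "(m, n) \<noteq> (0, 0)" "(r, s) \<noteq> (0, 0)"
  shows "zact eact m n (zact eact r s w) - zact eact r s (zact eact m n w) =
    sc (of_int (n * r - m * s)) (zact eact (m + r) (n + s) w) +
    (if m + r = 0 \<and> n + s = 0 then sc (of_int m * l3 + of_int n * l4) w else 0)"
  using restricted_module assms unfolding restricted_Lstar_module_def by (elim conjE) simp

lemma is_field_T: "is_field (T_field m)" and is_field_E: "is_field (E_field m)"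
proof -
  have "vanishes Lower (\<lambda>k. T_field m k w)" "vanishes Lower (\<lambda>k. E_field m k w)" for w
  proof -
    obtain N where "\<forall>n\<ge>N. zact tact m n w = 0 \<and> zact eact m n w = 0" using restricted by blast
    then have "vanishes_beyond Lower (- N) (\<lambda>k. T_field m k w)"
        "vanishes_beyond Lower (- N) (\<lambda>k. E_field m k w)"
      by (simp_all add: vanishes_beyond_def T_field_def E_field_def)
    then show "vanishes Lower (\<lambda>k. T_field m k w)" "vanishes Lower (\<lambda>k. E_field m k w)"
      by (blast intro: vanishesI)+
  qed
  then show "is_field (T_field m)" "is_field (E_field m)"
    by (simp_all add: is_field_def T_field_def[abs_def] E_field_def[abs_def] endo_zact)
qed

lemma T_T_commute: "T_field m k (T_field r l w) = T_field r l (T_field m k w)"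
proof (cases "(m, - k) = (0, 0) \<or> (r, - l) = (0, 0)")
  case True
  then show ?thesis using module_hom.zero[OF endo_zact(1)] by (auto simp: T_field_def zact_0)
next
  case False
  then show ?thesis unfolding T_field_def by (intro bracket_TT) auto
qed

lemma T_E_commutator:
  "T_field m k (E_field r l w) - E_field r l (T_field m k w) =
    sc (of_int (l * m - k * r)) (T_field (m + r) (k + l) w) +
    (if m + r = 0 \<and> k + l = 0 then sc (of_int m * l1 - of_int k * l2) w else 0)"
proof (cases "(m, - k) = (0, 0) \<or> (r, - l) = (0, 0)")
  case True
  then show ?thesis
    using module_hom.zero[OF endo_zact(1)] module_hom.zero[OF endo_zact(2)]
    by (auto simp: T_field_def E_field_def zact_0)
next
  case False
  moreover have "- k + - l = - (k + l)" "- k * r - m * - l = l * m - k * r" by auto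
  ultimately show ?thesis
    using bracket_TE[of m "- k" r "- l" w] by (simp add: T_field_def E_field_def add_eq_0_iff2)
qed

lemma E_E_commutator:
  "E_field m k (E_field r l w) - E_field r l (E_field m k w) =
    sc (of_int (l * m - k * r)) (E_field (m + r) (k + l) w) +
    (if m + r = 0 \<and> k + l = 0 then sc (of_int m * l3 - of_int k * l4) w else 0)"
proof (cases "(m, - k) = (0, 0) \<or> (r, - l) = (0, 0)")
  case True
  then show ?thesis using module_hom.zero[OF endo_zact(2)] by (auto simp: E_field_def zact_0)
next
  case False
  moreover have "- k + - l = - (k + l)" "- k * r - m * - l = l * m - k * r" by auto
  ultimately show ?thesis
    using bracket_EE[of m "- k" r "- l" w] by (simp add: E_field_def add_eq_0_iff2)
qed

definition generators :: "'w formal_field set" where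
  "generators = range T_field \<union> range E_field"

lemma local_order_T_T: "local_order 0 (T_field m) (T_field r)"
  using T_T_commute by (simp add: local_order_0_iff)

lemma local_set_generators: "local_set generators"
proof -
  have TE: "mutually_local (T_field m) (E_field r)" for m r
    by (rule mutually_localI[OF
        heisenberg_virasoro_products(1)[OF is_field_T is_field_E is_field_T T_E_commutator]])
  have EE: "mutually_local (E_field m) (E_field r)" for m r
    by (rule mutually_localI[OF
        heisenberg_virasoro_products(1)[OF is_field_E is_field_E is_field_E E_E_commutator]])
  show ?thesis
    using TE EE mutually_local_sym[OF TE] mutually_localI[OF local_order_T_T]
    by (auto simp: local_set_def generators_def is_field_T is_field_E)
qed

abbreviation fields :: "'w formal_field set" where "fields \<equiv> generated generators"

lemma is_field_fields: "c \<in> fields \<Longrightarrow> is_field c"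
  using generated_local_generators[OF local_set_generators] by blast

lemma mutually_local_fields: "b \<in> fields \<Longrightarrow> c \<in> fields \<Longrightarrow> mutually_local b c"
  by (rule generated_mutually_local[OF local_set_generators])

lemma mutually_local_T_E:
  assumes "c \<in> fields"
  shows "mutually_local (T_field m) c" "mutually_local (E_field m) c"
  using generated_local_generators[OF local_set_generators assms]
  by (auto simp: generators_def intro: mutually_local_sym)

fun mode_op :: "hb \<Rightarrow> 'w formal_field \<Rightarrow> 'w formal_field" where
  "mode_op (HT m n) c = nth_product (T_field m) n c"
| "mode_op (HE m n) c = nth_product (E_field m) n c"
| "mode_op HK1 c = fscale l1 c"
| "mode_op HK2 c = fscale l2 c"
| "mode_op HK3 c = fscale l3 c"
| "mode_op HK4 c = fscale l4 c"

lemma mode_op_fields: "c \<in> fields \<Longrightarrow> mode_op x c \<in> fields"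
  by (cases x) (auto simp: generators_def intro: generated.intros)

lemma mode_op_add: "b \<in> fields \<Longrightarrow> c \<in> fields \<Longrightarrow> mode_op x (b + c) = mode_op x b + mode_op x c"
  by (cases x) (simp_all only: mode_op.simps fscale_add field_product_add_right is_field_T
      is_field_E is_field_fields mutually_local_T_E)

lemma mode_op_fscale: "c \<in> fields \<Longrightarrow> mode_op x (fscale z c) = fscale z (mode_op x c)"
  by (cases x) (simp_all only: mode_op.simps fscale_fscale mult.commute field_product_fscale_right
      is_field_T is_field_E is_field_fields mutually_local_T_E)

lemma mode_op_central:
  assumes "c \<in> fields" "z \<in> {HK1, HK2, HK3, HK4}"
  shows "mode_op t (mode_op z c) = mode_op z (mode_op t c)" "br t z = []" "br z t = []"
proof -
  have "\<exists>l. \<forall>c. mode_op z c = fscale l c" using assms(2) by auto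
  then obtain l where "\<forall>c. mode_op z c = fscale l c" ..
  then show "mode_op t (mode_op z c) = mode_op z (mode_op t c)"
    using mode_op_fscale[OF assms(1)] by simp
  show "br t z = []" "br z t = []" using assms(2) by (cases t; auto)+
qed

lemma mode_op_bracket:
  assumes c: "c \<in> fields"
  shows "mode_op x (mode_op y c) - mode_op y (mode_op x c) =
      (\<Sum>(z, t)\<leftarrow>br x y. fscale z (mode_op t c))"
proof -
  note local = is_field_fields[OF c] mutually_local_T_E[OF c]
  have TT: "mode_op (HT m n) (mode_op (HT r s) c) - mode_op (HT r s) (mode_op (HT m n) c) = 0"
      for m n r s
    using nth_product_commutator[OF is_field_T is_field_T local(1) local_order_T_T local(2,2)]
    by (simp only: mode_op.simps lessThan_0 sum.empty)
  have TE: "mode_op (HT m n) (mode_op (HE r s) c) - mode_op (HE r s) (mode_op (HT m n) c) =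
      (\<Sum>(z, t)\<leftarrow>br (HT m n) (HE r s). fscale z (mode_op t c))" for m n r s
    unfolding mode_op.simps
      heisenberg_virasoro_bracket[OF is_field_T is_field_E is_field_T T_E_commutator local(1,2,3,2)]
    by (intro ext) (auto simp: fscale_def)
  have ET: "mode_op (HE r s) (mode_op (HT m n) c) - mode_op (HT m n) (mode_op (HE r s) c) =
      (\<Sum>(z, t)\<leftarrow>br (HE r s) (HT m n). fscale z (mode_op t c))" for m n r s
    unfolding minus_diff_eq[of "mode_op (HT m n) _", symmetric] TE
    by (intro ext) (auto simp: fscale_def algebra_simps)
  have EE: "mode_op (HE m n) (mode_op (HE r s) c) - mode_op (HE r s) (mode_op (HE m n) c) =
      (\<Sum>(z, t)\<leftarrow>br (HE m n) (HE r s). fscale z (mode_op t c))" for m n r s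
    unfolding mode_op.simps
      heisenberg_virasoro_bracket[OF is_field_E is_field_E is_field_E E_E_commutator local(1,3,3,3)]
    by (intro ext) (auto simp: fscale_def)
  show ?thesis
  proof (cases "x \<in> {HK1, HK2, HK3, HK4} \<or> y \<in> {HK1, HK2, HK3, HK4}")
    case True
    then have "mode_op x (mode_op y c) = mode_op y (mode_op x c)" "br x y = []"
      using mode_op_central[OF c] by metis+
    then show ?thesis by (simp only: list.map sum_list.Nil diff_self)
  next
    case False
    then obtain m n r s where "x = HT m n \<or> x = HE m n" "y = HT r s \<or> y = HE r s"
      by (cases x; cases y) auto
    then show ?thesis using TT TE ET EE
      by (elim disjE) (simp_all only: br.simps list.map sum_list.Nil)
  qed
qed

definition word_field :: "hb list \<Rightarrow> 'w formal_field" where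
  "word_field q = foldr mode_op q id_field"

definition field_of :: "tv \<Rightarrow> 'w formal_field" where
  "field_of u = (\<Sum>q | u q \<noteq> 0. fscale (u q) (word_field q))"

lemma word_field_fields: "word_field q \<in> fields"
  unfolding word_field_def by (induction q) (auto intro: generated.id mode_op_fields)

lemma field_of_fields: "field_of u \<in> fields"
  unfolding field_of_def by (intro generated_sum generated.fscale word_field_fields)

lemma is_field_field_of: "is_field (field_of u)"
  by (rule is_field_fields[OF field_of_fields])

lemma mutually_local_field_of: "mutually_local (field_of u) (field_of v)"
  by (rule mutually_local_fields[OF field_of_fields field_of_fields])

lemma field_of_superset:
  assumes "finite I" "{q. u q \<noteq> 0} \<subseteq> I"
  shows "field_of u = (\<Sum>q\<in>I. fscale (u q) (word_field q))"
  unfolding field_of_def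
proof (rule sum.mono_neutral_left[OF assms], rule ballI)
  fix q assume "q \<in> I - {q. u q \<noteq> 0}"
  then show "fscale (u q) (word_field q) = 0" by (intro ext) (simp add: fscale_def)
qed

lemma field_of_add:
  assumes "Fin u" "Fin v"
  shows "field_of (u + v) = field_of u + field_of v"
proof -
  let ?I = "{q. u q \<noteq> 0} \<union> {q. v q \<noteq> 0}"
  have "finite ?I" using assms by (simp add: Fin_def)
  note superset = field_of_superset[OF this]
  have "field_of (u + v) = (\<Sum>q\<in>?I. fscale ((u + v) q) (word_field q))" by (rule superset) auto
  also have "\<dots> = (\<Sum>q\<in>?I. fscale (u q) (word_field q)) + (\<Sum>q\<in>?I. fscale (v q) (word_field q))"
    by (intro ext) (simp add: sum_apply fscale_def scale_left_distrib sum.distrib)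
  also have "\<dots> = field_of u + field_of v" using superset[of u] superset[of v]
    by (simp only: Un_upper1 Un_upper2)
  finally show ?thesis .
qed

lemma field_of_smul: "field_of (smul c u) = fscale c (field_of u)"
proof (cases "c = 0")
  case False
  then have "{q. smul c u q \<noteq> 0} = {q. u q \<noteq> 0}" by (simp add: smul_def)
  then show ?thesis by (simp add: field_of_def fscale_sum fscale_fscale) (simp add: smul_def)
qed (intro ext, simp add: field_of_def smul_def fscale_def sum_apply)

lemma field_of_diff:
  assumes "Fin u" "Fin v"
  shows "field_of (u - v) = field_of u - field_of v"
proof -
  have "field_of (u - v) = field_of (u + smul (-1) v)" by (simp only: smul_uminus_1_add)
  also have "\<dots> = field_of u + fscale (-1) (field_of v)"
    by (simp only: field_of_add[OF assms(1) Fin_smul[OF assms(2)]] field_of_smul)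
  finally show ?thesis by (simp add: fscale_def fun_eq_iff)
qed

lemma field_of_zero: "field_of 0 = 0"
  by (simp add: field_of_def)

lemma field_of_mono: "field_of (mono q) = word_field q"
proof -
  have "field_of (mono q) = (\<Sum>q'\<in>{q}. fscale (mono q q') (word_field q'))"
    by (rule field_of_superset) (auto simp: mono_def)
  then show ?thesis by (simp add: mono_def fscale_one)
qed

lemma field_of_vac: "field_of vac = id_field"
  by (simp add: vac_def field_of_mono word_field_def)

lemma field_of_sum: "(\<And>i. i \<in> I \<Longrightarrow> Fin (f i)) \<Longrightarrow> field_of (\<Sum>i\<in>I. f i) = (\<Sum>i\<in>I. field_of (f i))"
  by (induction I rule: infinite_finite_induct) (simp_all only: sum.infinite sum.empty sum.insert
      field_of_zero field_of_add Fin_sum insert_iff simp_thms not_False_eq_True)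

lemma field_of_sum_list:
  "(\<And>x. x \<in> set xs \<Longrightarrow> Fin (f x)) \<Longrightarrow> field_of (\<Sum>x\<leftarrow>xs. f x) = (\<Sum>x\<leftarrow>xs. field_of (f x))"
  by (induction xs) (simp_all only: list.map sum_list.Nil sum_list.Cons field_of_zero field_of_add
      Fin_sum_list list.set insert_iff simp_thms)

lemma field_of_lmul:
  assumes "Fin u"
  shows "field_of (lmul x u) = mode_op x (field_of u)"
  using assms
proof (induction u rule: Fin_induct)
  case (add u v)
  then show ?case
    by (simp only: lmul_add field_of_add Fin_lmul mode_op_add[OF field_of_fields field_of_fields])
next
  case (smul_mono c q)
  show ?case
    by (simp only: lmul_smul lmul_mono field_of_smul field_of_mono
        mode_op_fscale[OF word_field_fields])
      (simp add: word_field_def)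
qed

lemma field_of_foldr_lmul_eq_0:
  assumes "Fin u" "field_of u = 0"
  shows "Fin (foldr lmul p u) \<and> field_of (foldr lmul p u) = 0"
proof (induction p)
  case (Cons x p)
  have "mode_op x (fscale 0 0) = fscale 0 (mode_op x 0)" by (rule mode_op_fscale[OF generated_zero])
  moreover have "fscale 0 c = 0" for c :: "'w formal_field" by (intro ext) (simp add: fscale_def)
  ultimately have "mode_op x 0 = 0" by (simp only:)
  then show ?case using Cons by (simp only: foldr.simps comp_apply Fin_lmul field_of_lmul simp_thms)
qed (use assms in simp)

lemma field_of_bracket:
  fixes x y q
  defines "j \<equiv> mono ([x, y] @ q) - mono ([y, x] @ q) - (\<Sum>(c, z)\<leftarrow>br x y. smul c (mono ([z] @ q)))"
  shows "Fin j" "field_of j = 0"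
proof -
  have Fin: "Fin (\<Sum>(c, z)\<leftarrow>br x y. smul c (mono ([z] @ q)))"
    by (rule Fin_sum_list) (auto intro: Fin_smul Fin_mono)
  then show "Fin j" unfolding j_def by (intro Fin_diff Fin_mono)
  have "field_of (\<Sum>(c, z)\<leftarrow>br x y. smul c (mono ([z] @ q))) =
      (\<Sum>(c, z)\<leftarrow>br x y. fscale c (mode_op z (word_field q)))"
    by (subst field_of_sum_list)
      (auto intro!: Fin_smul Fin_mono arg_cong[of _ _ sum_list] simp: field_of_smul field_of_mono
          word_field_def)
  also have "\<dots> = mode_op x (mode_op y (word_field q)) - mode_op y (mode_op x (word_field q))"
    by (rule mode_op_bracket[OF word_field_fields, symmetric])
  also have "\<dots> = field_of (mono ([x, y] @ q)) - field_of (mono ([y, x] @ q))"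
    by (simp only: field_of_mono) (simp add: word_field_def)
  finally show "field_of j = 0"
    by (simp only: j_def field_of_diff[OF Fin_diff[OF Fin_mono Fin_mono] Fin]
        field_of_diff[OF Fin_mono Fin_mono] diff_self)
qed

lemma field_of_nonneg_mode: "nonneg_mode x \<Longrightarrow> field_of (mono [x]) = 0"
  by (cases x) (auto simp: field_of_mono word_field_def nth_product_id_right is_field_T is_field_E)

lemma field_of_central:
  assumes "\<And>c. mode_op x c = fscale l c"
  shows "Fin (mono (p @ [x]) - smul l (mono p)) \<and> field_of (mono (p @ [x]) - smul l (mono p)) = 0"
proof -
  have "field_of (mono [x] - smul l (mono [])) = 0"
    by (simp only: field_of_diff Fin_mono Fin_smul field_of_smul field_of_mono word_field_def
        foldr.simps comp_apply id_apply assms diff_self)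
  from field_of_foldr_lmul_eq_0[OF Fin_diff[OF Fin_mono Fin_smul[OF Fin_mono]] this, of p]
  show ?thesis
    by (simp only: foldr_lmul_diff foldr_lmul_smul foldr_lmul_mono append_Nil2)
qed

lemma field_of_Jset: "j \<in> Jset l1 l2 l3 l4 \<Longrightarrow> Fin j \<and> field_of j = 0"
proof (induction rule: Jset.induct)
  case J0
  then show ?case by (simp only: Fin_zero field_of_zero simp_thms)
next
  case (Jadd a b)
  then show ?case by (simp only: Fin_add field_of_add add_0_left simp_thms)
next
  case (Jsmul a c)
  then show ?case by (simp only: Fin_smul field_of_smul fscale_zero simp_thms)
next
  case (Jcomm p x y q)
  from field_of_foldr_lmul_eq_0[OF field_of_bracket[of x y q], of p] show ?case
    by (simp only: foldr_lmul_diff foldr_lmul_sum_list case_prod_unfold foldr_lmul_smul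
        foldr_lmul_mono)
next
  case (Jpos x p)
  from field_of_foldr_lmul_eq_0[OF Fin_mono field_of_nonneg_mode[OF this], of p] show ?case
    by (simp only: foldr_lmul_mono)
qed (intro field_of_central mode_op.simps)+

lemma field_of_cong: "veq l1 l2 l3 l4 u v \<Longrightarrow> Fin u \<Longrightarrow> Fin v \<Longrightarrow> field_of u = field_of v"
  using field_of_Jset[of "u - v"] by (simp add: veq_def field_of_diff)

end

section \<open>The vertex algebra structure\<close>

lemma smul_one: "smul 1 u = u"
  by (simp add: smul_def)

lemma sum_smul_gchoose_0:
  assumes "M > 0"
  shows "(\<Sum>i<M. smul (0 gchoose i) (f i)) = f 0"
    and "(\<Sum>i<M. smul ((-1) ^ i * (0 gchoose i)) (f i)) = f 0"
proof -
  have sum: "(\<Sum>i<M. smul (c i) (f i)) q = f 0 q" if "\<And>i. c i = (if i = 0 then 1 else 0)" for c q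
  proof -
    have "(\<Sum>i<M. smul (c i) (f i)) q = (\<Sum>i<M. if i = 0 then f 0 q else 0)"
      unfolding sum_apply by (rule sum.cong) (auto simp: smul_def that)
    then show ?thesis using assms by simp
  qed
  show "(\<Sum>i<M. smul (0 gchoose i) (f i)) = f 0"
    and "(\<Sum>i<M. smul ((-1) ^ i * (0 gchoose i)) (f i)) = f 0"
    by (intro ext sum; simp add: gbinomial_0_left)+
qed

definition V_generators :: "tv set" where
  "V_generators = range (\<lambda>m. mono [HT m (-1)]) \<union> range (\<lambda>m. mono [HE m (-1)])"

lemma Fin_V_generators: "a \<in> V_generators \<Longrightarrow> Fin a"
  by (auto simp: V_generators_def Fin_mono)

locale V_structure =
  fixes l1 l2 l3 l4 :: complex and Yv :: "tv \<Rightarrow> int \<Rightarrow> tv \<Rightarrow> tv"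
  assumes V: "is_V_structure l1 l2 l3 l4 Yv"
begin

abbreviation V_eq :: "tv \<Rightarrow> tv \<Rightarrow> bool" (infix "\<sim>" 50) where "u \<sim> v \<equiv> veq l1 l2 l3 l4 u v"

lemma veq_refl: "u \<sim> u"
  unfolding veq_def diff_self by (rule Jset.J0)

lemma veq_sym: "u \<sim> v \<Longrightarrow> v \<sim> u"
  unfolding veq_def using Jset.Jsmul[of "u - v" l1 l2 l3 l4 "-1"]
  by (metis minus_diff_eq smul_uminus_1_add add_0 diff_0)

lemma veq_trans: "u \<sim> v \<Longrightarrow> v \<sim> w \<Longrightarrow> u \<sim> w"
  unfolding veq_def using Jset.Jadd[of "u - v" l1 l2 l3 l4 "v - w"] by simp

lemma Fin_Yv [rule_format]:
  "\<forall>u v n. Fin u \<longrightarrow> Fin v \<longrightarrow> Fin (Yv u n v)"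
  using V unfolding is_V_structure_def Let_def by (elim conjE)

lemma Yv_cong [rule_format]:
  "\<forall>u u' v v' n. Fin u \<longrightarrow> Fin u' \<longrightarrow> Fin v \<longrightarrow> Fin v' \<longrightarrow> u \<sim> u' \<longrightarrow> v \<sim> v' \<longrightarrow>
    Yv u n v \<sim> Yv u' n v'"
  using V unfolding is_V_structure_def Let_def by (elim conjE)

lemma Yv_add_left [rule_format]:
  "\<forall>u u' v n. Fin u \<longrightarrow> Fin u' \<longrightarrow> Fin v \<longrightarrow> Yv (u + u') n v \<sim> Yv u n v + Yv u' n v"
  using V unfolding is_V_structure_def Let_def by (elim conjE)

lemma Yv_add_right [rule_format]:
  "\<forall>u v v' n. Fin u \<longrightarrow> Fin v \<longrightarrow> Fin v' \<longrightarrow> Yv u n (v + v') \<sim> Yv u n v + Yv u n v'"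
  using V unfolding is_V_structure_def Let_def by (elim conjE)

lemma Yv_smul_left [rule_format]:
  "\<forall>c u v n. Fin u \<longrightarrow> Fin v \<longrightarrow> Yv (smul c u) n v \<sim> smul c (Yv u n v)"
  using V unfolding is_V_structure_def Let_def by (elim conjE)

lemma Yv_smul_right [rule_format]:
  "\<forall>c u v n. Fin u \<longrightarrow> Fin v \<longrightarrow> Yv u n (smul c v) \<sim> smul c (Yv u n v)"
  using V unfolding is_V_structure_def Let_def by (elim conjE)

lemma Yv_truncation [rule_format]:
  "\<forall>u v. Fin u \<longrightarrow> Fin v \<longrightarrow> (\<exists>N. \<forall>n\<ge>N. Yv u n v \<sim> 0)"
  using V unfolding is_V_structure_def Let_def by (elim conjE)

lemma Yv_vac [rule_format]:
  "\<forall>v n. Fin v \<longrightarrow> Yv vac n v \<sim> (if n = -1 then v else 0)"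
  using V unfolding is_V_structure_def Let_def by (elim conjE)

lemma Yv_creation_nonneg [rule_format]:
  "\<forall>u n. Fin u \<longrightarrow> n \<ge> 0 \<longrightarrow> Yv u n vac \<sim> 0"
  using V unfolding is_V_structure_def Let_def by (elim conjE)

lemma Yv_jacobi [rule_format]:
  "\<forall>u v w p q r. Fin u \<longrightarrow> Fin v \<longrightarrow> Fin w \<longrightarrow> (\<exists>M. \<forall>M'\<ge>M.
    (\<Sum>i<M'. smul (of_int p gchoose i) (Yv (Yv u (r + int i) v) (p + q - int i) w)) \<sim>
    (\<Sum>i<M'. smul ((-1) ^ i * (of_int r gchoose i)) (Yv u (p + r - int i) (Yv v (q + int i) w)
      - smul ((-1) powi r) (Yv v (q + r - int i) (Yv u (p + int i) w)))))"
  using V unfolding is_V_structure_def Let_def by (elim conjE)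

lemma Yv_HT [rule_format]:
  "\<forall>m n v. Fin v \<longrightarrow> Yv (mono [HT m (-1)]) n v \<sim> lmul (HT m n) v"
  using V unfolding is_V_structure_def Let_def by (elim conjE)

lemma Yv_HE [rule_format]:
  "\<forall>m n v. Fin v \<longrightarrow> Yv (mono [HE m (-1)]) n v \<sim> lmul (HE m n) v"
  using V unfolding is_V_structure_def Let_def by (elim conjE)

lemma Yv_zero_right:
  assumes "Fin u" "Fin v" "v \<sim> 0"
  shows "Yv u n v \<sim> 0"
proof -
  have "Yv u n v \<sim> Yv u n (smul 0 v)"
    unfolding smul_zero by (intro Yv_cong assms Fin_zero veq_refl)
  then show ?thesis using Yv_smul_right[OF assms(1,2), of n 0] unfolding smul_zero
    by (rule veq_trans)
qed

lemma Yv_iterate: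
  assumes "Fin u" "Fin v" "Fin w"
  shows "\<exists>M. \<forall>M'\<ge>M. Yv (Yv u r v) q w \<sim>
    (\<Sum>i<M'. smul ((-1) ^ i * (of_int r gchoose i)) (Yv u (r - int i) (Yv v (q + int i) w)
      - smul ((-1) powi r) (Yv v (q + r - int i) (Yv u (int i) w))))"
    (is "\<exists>M. \<forall>M'\<ge>M. ?eq M'")
proof -
  obtain M where M: "\<And>M'. M' \<ge> M \<Longrightarrow>
      (\<Sum>i<M'. smul (of_int 0 gchoose i) (Yv (Yv u (r + int i) v) (0 + q - int i) w)) \<sim>
      (\<Sum>i<M'. smul ((-1) ^ i * (of_int r gchoose i)) (Yv u (0 + r - int i) (Yv v (q + int i) w)
        - smul ((-1) powi r) (Yv v (q + r - int i) (Yv u (0 + int i) w))))"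
    using Yv_jacobi[OF assms, of 0 r q] by blast
  show ?thesis
  proof (intro exI allI impI)
    fix M' assume "M' \<ge> Suc M"
    then have "M' > 0" "M' \<ge> M" by auto
    then show "?eq M'" using M[of M'] by (simp add: sum_smul_gchoose_0)
  qed
qed

lemma Yv_commutator:
  assumes "Fin u" "Fin v" "Fin w"
  shows "\<exists>M. \<forall>M'\<ge>M. (\<Sum>i<M'. smul (of_int p gchoose i) (Yv (Yv u (int i) v) (p + q - int i) w)) \<sim>
    Yv u p (Yv v q w) - Yv v q (Yv u p w)" (is "\<exists>M. \<forall>M'\<ge>M. ?eq M'")
proof -
  obtain M where M: "\<And>M'. M' \<ge> M \<Longrightarrow>
      (\<Sum>i<M'. smul (of_int p gchoose i) (Yv (Yv u (0 + int i) v) (p + q - int i) w)) \<sim>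
      (\<Sum>i<M'. smul ((-1) ^ i * (of_int 0 gchoose i)) (Yv u (p + 0 - int i) (Yv v (q + int i) w)
        - smul ((-1) powi 0) (Yv v (q + 0 - int i) (Yv u (p + int i) w))))"
    using Yv_jacobi[OF assms, of p 0 q] by blast
  show ?thesis
  proof (intro exI allI impI)
    fix M' assume "M' \<ge> Suc M"
    then have "M' > 0" "M' \<ge> M" by auto
    then show "?eq M'" using M[of M']
      by (simp only: sum_smul_gchoose_0 of_int_0 of_nat_0 add_0_left add_0_right diff_0_right
          power_int_0_right smul_one)
  qed
qed

lemma central_letter_veq:
  assumes "\<And>y. br x y = []" "\<And>p. mono (p @ [x]) \<sim> smul l (mono p)"
  shows "mono (p @ x # q) \<sim> smul l (mono (p @ q))"
proof (induction q arbitrary: p)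
  case Nil
  then show ?case using assms(2) by simp
next
  case (Cons y q)
  have "mono (p @ x # y # q) \<sim> mono ((p @ [y]) @ x # q)"
    using Jset.Jcomm[of p x y q l1 l2 l3 l4] by (simp add: veq_def assms(1))
  from veq_trans[OF this Cons] show ?case by simp
qed

lemma mono_Cons_veq_cases:
  obtains (generator) a n where "a \<in> V_generators" "Yv a n (mono q) \<sim> mono (x # q)"
  | (central) l where "smul l (mono q) \<sim> mono (x # q)"
proof (cases x)
  case (HT m n)
  have "mono [HT m (-1)] \<in> V_generators" by (simp add: V_generators_def)
  from generator[OF this] Yv_HT[OF Fin_mono, of m n q] show thesis by (simp add: HT lmul_mono)
next
  case (HE m n)
  have "mono [HE m (-1)] \<in> V_generators" by (simp add: V_generators_def)
  from generator[OF this] Yv_HE[OF Fin_mono, of m n q] show thesis by (simp add: HE lmul_mono)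
qed (use central[OF veq_sym[OF central_letter_veq[of x _ "[]" q, simplified]]]
    Jset.JK1 Jset.JK2 Jset.JK3 Jset.JK4 in \<open>simp_all add: veq_def, metis+\<close>)

lemma V_induct [consumes 1, case_names vac add smul veq product]:
  assumes "Fin v" and vac: "P vac"
    and add: "\<And>u v. Fin u \<Longrightarrow> Fin v \<Longrightarrow> P u \<Longrightarrow> P v \<Longrightarrow> P (u + v)"
    and smul: "\<And>c u. Fin u \<Longrightarrow> P u \<Longrightarrow> P (smul c u)"
    and veq: "\<And>u v. Fin u \<Longrightarrow> Fin v \<Longrightarrow> u \<sim> v \<Longrightarrow> P u \<Longrightarrow> P v"
    and product: "\<And>a n v. a \<in> V_generators \<Longrightarrow> Fin v \<Longrightarrow> P v \<Longrightarrow> P (Yv a n v)"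
  shows "P v"
proof -
  have mono: "P (mono q)" for q
  proof (induction q)
    case Nil
    then show ?case using vac by (simp add: vac_def)
  next
    case (Cons x q)
    consider (generator) a n where "a \<in> V_generators" "Yv a n (mono q) \<sim> mono (x # q)"
      | (central) l where "smul l (mono q) \<sim> mono (x # q)"
      by (rule mono_Cons_veq_cases)
    then show ?case
    proof cases
      case (generator a n)
      from veq[OF Fin_Yv Fin_mono generator(2) product[OF generator(1) Fin_mono Cons]] show ?thesis
        by (simp add: Fin_V_generators generator(1) Fin_mono)
    next
      case (central l)
      from veq[OF Fin_smul[OF Fin_mono] Fin_mono central smul[OF Fin_mono Cons]] show ?thesis .
    qed
  qed
  show ?thesis using assms(1)
  proof (induction v rule: Fin_induct)
    case (add u v)
    then show ?case by (rule assms(3))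
  next
    case (smul_mono c q)
    show ?case by (rule smul[OF Fin_mono mono])
  qed
qed

end

locale Lstar_V_module =
  Lstar_module sc l1 l2 l3 l4 tact eact + V_structure l1 l2 l3 l4 Yv
  for sc :: "complex \<Rightarrow> 'w::ab_group_add \<Rightarrow> 'w" and l1 l2 l3 l4 tact eact Yv
begin

lemma field_of_generators:
  "field_of (mono [HT m (-1)]) = T_field m" "field_of (mono [HE m (-1)]) = E_field m"
proof -
  have "nth_product c (-1) id_field = c" if "is_field c" for c
    using nth_product_id_right[OF that, of "-1"] by (simp add: divided_euler_def[abs_def])
  then show "field_of (mono [HT m (-1)]) = T_field m" "field_of (mono [HE m (-1)]) = E_field m"
    by (simp_all only: field_of_mono word_field_def foldr.simps comp_apply id_apply mode_op.simps
        is_field_T is_field_E)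
qed

lemma field_of_Yv_generator:
  assumes "a \<in> V_generators" "Fin v"
  shows "field_of (Yv a n v) = nth_product (field_of a) n (field_of v)"
proof -
  from assms(1) consider (HT) m where "a = mono [HT m (-1)]" | (HE) m where "a = mono [HE m (-1)]"
    by (auto simp: V_generators_def)
  then show ?thesis
  proof cases
    case HT
    with field_of_cong[OF Yv_HT] assms(2) show ?thesis
      by (simp add: Fin_Yv Fin_mono Fin_lmul field_of_lmul field_of_generators)
  next
    case HE
    with field_of_cong[OF Yv_HE] assms(2) show ?thesis
      by (simp add: Fin_Yv Fin_mono Fin_lmul field_of_lmul field_of_generators)
  qed
qed

lemma field_of_Yv_vac_iterate:
  assumes a: "a \<in> V_generators" and "Fin v"
    and v: "\<And>n. field_of (Yv v n vac) = nth_product (field_of v) n id_field"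
  shows "field_of (Yv (Yv a m v) (-1 - int n) vac) =
      divided_euler n (nth_product (field_of a) m (field_of v))"
proof -
  let ?A = "field_of a" and ?V = "field_of v"
      and ?c = "\<lambda>i. (-1) ^ i * (of_int m gchoose i) :: complex"
  let ?q = "-1 - int n"
  note Fin = Fin_V_generators[OF a] \<open>Fin v\<close> Fin_vac
  obtain M where M: "\<And>M'. M' \<ge> M \<Longrightarrow> Yv (Yv a m v) ?q vac \<sim>
      (\<Sum>i<M'. smul (?c i) (Yv a (m - int i) (Yv v (?q + int i) vac)
        - smul ((-1) powi m) (Yv v (?q + m - int i) (Yv a (int i) vac))))"
    using Yv_iterate[OF Fin, of m ?q] by blast
  have zero: "field_of (Yv v k (Yv a (int i) vac)) = 0" for i k
    using field_of_cong[OF Yv_zero_right[OF Fin(2) _ Yv_creation_nonneg[OF Fin(1)]]] Fin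
    by (simp add: Fin_Yv Fin_zero field_of_zero)
  define N where "N = M + Suc n"
  have "field_of (Yv (Yv a m v) ?q vac) =
      (\<Sum>i<N. fscale (?c i) (nth_product ?A (m - int i) (nth_product ?V (?q + int i) id_field)))"
    using field_of_cong[OF M[of N]] le_add1[of M "Suc n", folded N_def] Fin
    by (simp add: Fin_Yv Fin_sum Fin_smul Fin_diff field_of_sum field_of_smul field_of_diff zero
        field_of_Yv_generator[OF a] v fscale_zero)
  also have "\<dots> = (\<Sum>i\<le>n. fscale (?c i) (nth_product ?A (m - int i) (divided_euler (n - i) ?V)))"
    by (rule sum.mono_neutral_cong_right) (auto simp: N_def nth_product_id_right is_field_field_of
        field_product_zero_right fscale_zero nat_diff_distrib)
  also have "\<dots> = divided_euler n (nth_product ?A m ?V)"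
    by (rule divided_euler_nth_product[OF is_field_field_of is_field_field_of
        mutually_local_field_of, symmetric])
  finally show ?thesis .
qed

lemma field_of_Yv_vac_product:
  assumes a: "a \<in> V_generators" and v: "Fin v"
    and IH: "\<And>n. field_of (Yv v n vac) = nth_product (field_of v) n id_field"
  shows "field_of (Yv (Yv a m v) n vac) = nth_product (field_of (Yv a m v)) n id_field"
proof (cases "n < 0")
  case True
  then have "n = -1 - int (nat (- n - 1))" by simp
  then have "field_of (Yv (Yv a m v) n vac) = divided_euler (nat (- n - 1)) (field_of (Yv a m v))"
    using field_of_Yv_vac_iterate[OF assms, of m "nat (- n - 1)"]
    by (simp only: field_of_Yv_generator[OF a v])
  then show ?thesis using True by (simp only: nth_product_id_right[OF is_field_field_of] if_True)
next
  case False
  note Fin = Fin_Yv[OF Fin_V_generators[OF a] v]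
  show ?thesis
    using field_of_cong[OF Yv_creation_nonneg[OF Fin, of n]] False
    by (simp add: Fin Fin_Yv Fin_vac Fin_zero field_of_zero nth_product_id_right is_field_field_of)
qed

lemma field_of_Yv_vac:
  assumes "Fin u"
  shows "field_of (Yv u n vac) = nth_product (field_of u) n id_field"
  using assms
proof (induction u arbitrary: n rule: V_induct)
  case vac
  have "field_of (Yv vac n vac) = field_of (if n = -1 then vac else 0)"
    using field_of_cong[OF Yv_vac[OF Fin_vac, of n]] by (simp add: Fin_Yv Fin_vac Fin_zero)
  then show ?case
    by (simp only: nth_product_id_left[OF is_field_id] field_of_vac field_of_zero
        if_distrib[of field_of])
next
  case (add u v)
  then show ?case
    using field_of_cong[OF Yv_add_left[OF add(1,2) Fin_vac, of n]]
    by (simp only: Fin_Yv Fin_vac Fin_add field_of_add field_product_add_left[OF is_field_field_of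
        is_field_field_of is_field_id] mutually_local_id_right is_field_field_of)
next
  case (smul c u)
  then show ?case
    using field_of_cong[OF Yv_smul_left[OF smul(1) Fin_vac, of c n]]
    by (simp only: Fin_Yv Fin_vac Fin_smul field_of_smul
        field_product_fscale_left[OF is_field_field_of
        is_field_id] mutually_local_id_right is_field_field_of)
next
  case (veq u v)
  then show ?case
    using field_of_cong[OF Yv_cong[OF veq(1,2) Fin_vac Fin_vac veq(3) veq_refl, of n]]
        field_of_cong[OF veq(3,1,2)]
    by (simp only: Fin_Yv Fin_vac)
next
  case (product a m v)
  then show ?case by (rule field_of_Yv_vac_product)
qed

lemma field_of_Yv_product:
  assumes a: "a \<in> V_generators" and v: "Fin v" and u: "Fin u"
    and IH: "\<And>u n. Fin u \<Longrightarrow> field_of (Yv u n v) = nth_product (field_of u) n (field_of v)"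
  shows "field_of (Yv u n (Yv a m v)) = nth_product (field_of u) n (field_of (Yv a m v))"
proof -
  let ?A = "field_of a" and ?U = "field_of u" and ?V = "field_of v"
  note Fin = Fin_V_generators[OF a] u v
  obtain M where M: "\<And>M'. M' \<ge> M \<Longrightarrow>
      (\<Sum>i<M'. smul (of_int m gchoose i) (Yv (Yv a (int i) u) (m + n - int i) v)) \<sim>
      Yv a m (Yv u n v) - Yv u n (Yv a m v)"
    using Yv_commutator[OF Fin, of m n] by blast
  obtain K where "local_order K ?A ?U" using mutually_local_field_of[of a u]
    by (auto simp: mutually_local_def)
  then have "local_order (M + K) ?A ?U"
    by (rule local_order_mono[OF is_field_field_of is_field_field_of]) simp
  note bracket = nth_product_commutator[OF is_field_field_of is_field_field_of is_field_field_of
      this mutually_local_field_of mutually_local_field_of]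
  have "(\<Sum>i<M + K. fscale (of_int m gchoose i)
        (nth_product (nth_product ?A (int i) ?U) (m + n - int i) ?V)) =
      nth_product ?A m (nth_product ?U n ?V) - field_of (Yv u n (Yv a m v))"
    using field_of_cong[OF M[of "M + K"]] Fin
    by (simp add: Fin_Yv Fin_sum Fin_smul Fin_diff field_of_sum field_of_smul field_of_diff
        field_of_Yv_generator[OF a] IH)
  with bracket[of m n v]
  have "nth_product ?A m (nth_product ?U n ?V) - field_of (Yv u n (Yv a m v)) =
      nth_product ?A m (nth_product ?U n ?V) - nth_product ?U n (nth_product ?A m ?V)" by simp
  then show ?thesis unfolding field_of_Yv_generator[OF a v] by (rule diff_left_imp_eq)
qed

theorem field_of_Yv:
  assumes "Fin v" "Fin u"
  shows "field_of (Yv u n v) = nth_product (field_of u) n (field_of v)"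
  using assms
proof (induction v arbitrary: u n rule: V_induct)
  case vac
  then show ?case by (simp only: field_of_Yv_vac field_of_vac)
next
  case (add v w)
  then show ?case
    using field_of_cong[OF Yv_add_right[OF add.prems add(1,2), of n]]
    by (simp only: Fin_Yv Fin_add field_of_add field_product_add_right[OF is_field_field_of
        is_field_field_of is_field_field_of mutually_local_field_of mutually_local_field_of])
next
  case (smul c v)
  then show ?case
    using field_of_cong[OF Yv_smul_right[OF smul.prems smul(1), of n c]]
    by (simp only: Fin_Yv Fin_smul field_of_smul field_product_fscale_right[OF is_field_field_of
        is_field_field_of mutually_local_field_of])
next
  case (veq v w)
  then show ?case
    using field_of_cong[OF Yv_cong[OF veq.prems veq.prems veq(1,2) veq_refl veq(3), of n]]
        field_of_cong[OF veq(3,1,2)]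
    by (simp only: Fin_Yv)
next
  case (product a m v)
  then show ?case by (intro field_of_Yv_product)
qed

end

section \<open>\<open>\<phi>\<close>-coordinated modules\<close>

lemma fps_exp_minus_1_power_nth: "(fps_exp 1 - 1) ^ K $ d = ek K d"
proof -
  have "(fps_exp 1 - 1 :: complex fps) ^ K =
      (\<Sum>i\<le>K. of_nat (K choose i) * fps_exp 1 ^ i * (-1) ^ (K - i))"
    using binomial_ring[of "fps_exp 1 :: complex fps" "-1" K] by simp
  also have "\<dots> = (\<Sum>i\<le>K. fps_const (of_nat (K choose i) * (-1) ^ (K - i)) * fps_exp (of_nat i))"
  proof (rule sum.cong[OF refl])
    fix i
    have "(-1 :: complex fps) ^ (K - i) = fps_const ((-1) ^ (K - i))"
      by (metis fps_const_1_eq_1 fps_const_neg fps_const_power)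
    then show "of_nat (K choose i) * fps_exp 1 ^ i * (-1) ^ (K - i) =
        fps_const (of_nat (K choose i) * (-1) ^ (K - i)) * fps_exp (of_nat i :: complex)"
      by (simp add: fps_exp_power_mult fps_of_nat[symmetric] mult_ac flip: fps_const_mult)
  qed
  finally show ?thesis by (simp add: fps_sum_nth ek_def sum_divide_distrib)
qed

context char_0_space
begin

lemma times_z_pow_binomial:
  "(times_z ^^ n) L k = (\<Sum>i\<le>n. sc (of_int ((-1) ^ (n - i) * int (n choose i))) (L (k - int i)))"
proof (induction n arbitrary: k)
  case (Suc n)
  define c where "c n i = (-1) ^ (n - i) * int (n choose i)" for n i
  have pascal: "c (Suc n) 0 = - c n 0" "c (Suc n) (Suc i) = c n i - c n (Suc i)" for i
  proof -
    have "(-1) ^ (n - i) * int (n choose Suc i) = - ((-1) ^ (n - Suc i) * int (n choose Suc i))"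
      by (cases "Suc i \<le> n") (simp_all add: Suc_diff_Suc[symmetric])
    then show "c (Suc n) 0 = - c n 0" "c (Suc n) (Suc i) = c n i - c n (Suc i)"
      by (simp_all add: c_def distrib_left)
  qed
  have "(\<Sum>i\<le>n. sc (of_int (c n i)) (L (k - int i))) =
      (\<Sum>i\<le>Suc n. sc (of_int (c n i)) (L (k - int i)))"
    by (simp add: c_def)
  also have "\<dots> = sc (of_int (c n 0)) (L k) +
      (\<Sum>i\<le>n. sc (of_int (c n (Suc i))) (L (k - int (Suc i))))"
    by (subst sum.atMost_Suc_shift) simp
  finally have "(times_z ^^ Suc n) L k = (\<Sum>i\<le>n. sc (of_int (c n i)) (L (k - int (Suc i)))) -
      (sc (of_int (c n 0)) (L k) + (\<Sum>i\<le>n. sc (of_int (c n (Suc i))) (L (k - int (Suc i)))))"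
    by (simp add: times_z_def Suc c_def algebra_simps)
  also have "\<dots> = (\<Sum>i\<le>Suc n. sc (of_int (c (Suc n) i)) (L (k - int i)))"
    by (subst sum.atMost_Suc_shift) (simp add: pascal scale_left_diff_distrib sum_subtractf)
  finally show ?case by (simp only: c_def)
qed simp

lemma local_pair_unique:
  assumes "local_pair K L R" "local_pair K' L R'"
  shows "R = R'"
proof -
  let ?j = "int (max K K')"
  have "z_power Lower ?j (R - R') = 0"
    using local_pair_z_power_eq[OF assms(1), of ?j] local_pair_z_power_eq[OF assms(2), of ?j] assms
    by (simp add: z_power_diff local_pair_vanishes)
  then show ?thesis
    using z_power_eq_zero_imp[of Lower "R - R'"] assms
    by (auto simp: vanishes_diff local_pair_vanishes)
qed

lemma ex_local_pair:
  assumes "vanishes Upper L" "vanishes Lower ((times_z ^^ K) L)"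
  shows "\<exists>R. local_pair K L R"
  using assms z_power_z_power[OF assms(2), of "int K" "- int K"]
  by (intro exI[of _ "z_power Lower (- int K) ((times_z ^^ K) L)"])
     (simp add: local_pair_iff_z_power vanishes_z_power z_power_0 z_power_nat)

text \<open>This is \<open>z^K = (exp t - 1)^K\<close>, multiplied by \<open>t^n\<close>.\<close>

lemma pairing_X_power_mult_log_y_powi:
  assumes pair: "local_pair N L R" and D: "int N \<le> int D + n"
  shows "pairing (fls_X ^ K * log_y powi n) L R =
    (\<Sum>d<D. sc ((fps_exp 1 - 1) ^ K $ d) (pairing (log_y powi (int d + n)) L R))"
proof -
  let ?S = "\<Sum>d<D. fls_const ((fps_exp 1 - 1) ^ K $ d) * log_y powi int d :: 'a fls"
  have "pairing (fls_X ^ K * log_y powi n) L R = pairing (?S * log_y powi n) L R"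
  proof (rule pairing_eqI_high[OF pair])
    fix j assume "j < int N"
    have "(fls_X ^ K - ?S) $$ i = 0" if "i < int D" for i
      using fps_compose_ln_expansion[OF that, of "(fps_exp 1 - 1) ^ K"]
      by (simp add: exp_minus_1_power_compose_ln fps_to_fls_power)
    then have "((fls_X ^ K - ?S) * log_y powi n) $$ j = 0"
      by (rule fls_times_nth_below[where a = "int D" and b = n]) (use \<open>j < int N\<close> D in auto)
    then show "(fls_X ^ K * log_y powi n - ?S * log_y powi n) $$ j = 0"
      by (simp only: left_diff_distrib)
  qed
  also have "\<dots> = (\<Sum>d<D. sc ((fps_exp 1 - 1) ^ K $ d) (pairing (log_y powi (int d + n)) L R))"
    by (simp only: sum_distrib_right pairing_sum_left[OF pair] mult.assoc
        pairing_const_mult[OF pair] power_int_add log_y_nonzero simp_thms)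
  finally show ?thesis .
qed

lemma sum_exp_pairing:
  assumes pair: "local_pair K L R"
    and I: "finite I" "\<And>k. k \<notin> I \<Longrightarrow> (times_z ^^ K) L k = 0"
    and M: "\<And>j. j \<ge> M \<Longrightarrow> pairing (log_y powi j) L R = 0"
  shows "(\<Sum>j\<in>{-c-1..<M}. sc ((fps_exp 1 - 1) ^ K $ nat (c + j + 1)) (pairing (log_y powi j) L R)) =
    (if c < 0 then 0 else \<Sum>k\<in>I. sc (of_int k ^ nat c / fact (nat c)) ((times_z ^^ K) L k))"
proof -
  define D where "D = nat (max (int K) M + c + 1)"
  let ?e = "\<lambda>d. (fps_exp 1 - 1 :: 'a fps) ^ K $ d"
  let ?f = "\<lambda>j. sc (?e (nat (c + j + 1))) (pairing (log_y powi j) L R)"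
  have "(\<Sum>j\<in>{-c-1..<M}. ?f j) = (\<Sum>j\<in>{-c-1..<int D - c - 1}. ?f j)"
    by (rule sum.mono_neutral_left) (auto simp: D_def M)
  also have "\<dots> = (\<Sum>d<D. sc (?e d) (pairing (log_y powi (int d + (-1 - c))) L R))"
    by (rule sum.reindex_bij_witness[of _ "\<lambda>d. int d - c - 1" "\<lambda>j. nat (c + j + 1)"]) auto
  also have "\<dots> = pairing (fls_X ^ K * log_y powi (-1 - c)) L R"
    by (rule pairing_X_power_mult_log_y_powi[OF pair, symmetric]) (auto simp: D_def max_def)
  also have "\<dots> = pairing (log_y powi (-1 - c)) ((times_z ^^ K) L) ((times_z ^^ K) L)"
    using pairing_X_power_mult[OF pair] pair by (simp add: local_pair_def)
  also have "\<dots> =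
      (if c < 0 then 0 else \<Sum>k\<in>I. sc (of_int k ^ nat c / fact (nat c)) ((times_z ^^ K) L k))"
    using pairing_finite_support(1)[where L = "(times_z ^^ K) L" and n = "nat c", OF I]
      pairing_finite_support(2)[where L = "(times_z ^^ K) L" and m = "-1 - c", OF I]
    by (auto simp: algebra_simps)
  finally show ?thesis .
qed

lemma exp_minus_1_power_triangular:
  assumes M: "\<And>j. j \<ge> M \<Longrightarrow> f j = 0"
    and sum: "\<And>c. (\<Sum>j\<in>{-c-1..<M}. sc ((fps_exp 1 - 1) ^ K $ nat (c + j + 1)) (f j)) = 0"
  shows "f j = 0"
proof (induction "nat (M - j)" arbitrary: j rule: less_induct)
  case less
  let ?e = "\<lambda>d. (fps_exp 1 - 1 :: 'a fps) ^ K $ d"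
  show ?case
  proof (cases "j < M")
    case True
    have "0 = (\<Sum>i\<in>{j - int K..<M}. sc (?e (nat (i - j + int K))) (f i))"
      using sum[of "int K - 1 - j"] by (simp add: algebra_simps)
    also have "\<dots> = (\<Sum>i\<in>{j}. sc (?e (nat (i - j + int K))) (f i))"
    proof (intro sum.mono_neutral_right ballI)
      fix i assume i: "i \<in> {j - int K..<M} - {j}"
      then consider (below) "i < j" | (above) "i > j" by fastforce
      then show "sc (?e (nat (i - j + int K))) (f i) = 0"
      proof cases
        case below
        then have "nat (i - j + int K) < K" using i by auto
        then show ?thesis using startsby_zero_power_prefix[of "fps_exp 1 - 1 :: 'a fps" K] by simp
      next
        case above
        then show ?thesis using less[of i] True by simp
      qed
    qed (use True in auto)
    also have "\<dots> = f j" by (simp add: startsby_zero_power_nth_same)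
    finally show ?thesis ..
  qed (use M in simp)
qed

end

context Lstar_V_module
begin

lemma Pc_eq_times_z_pow:
  "Pc sc Y K u v w a b = (times_z ^^ K) (left_series (Y u) (Y v) (a + b - int K) w) a"
  unfolding Pc_def times_z_pow_binomial left_series_def
  by (rule sum.cong) (auto simp: of_nat_diff algebra_simps)

lemma sum_ek_pairing_eq_phiR:
  assumes pair: "local_pair K (left_series (Y u) (Y v) (p - int K) w) R"
    and N: "\<forall>a b. a < N \<or> b < N \<longrightarrow> Pc sc Y K u v w a b = 0"
    and M: "\<And>j. j \<ge> M \<Longrightarrow> pairing (log_y powi j) (left_series (Y u) (Y v) (p - int K) w) R = 0"
  shows "(\<Sum>j\<in>{-c-1..<M}. sc (ek K (nat (c + j + 1)))
      (pairing (log_y powi j) (left_series (Y u) (Y v) (p - int K) w) R)) = phiR sc Y K u v w N c p"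
proof -
  let ?P = "(times_z ^^ K) (left_series (Y u) (Y v) (p - int K) w)"
  have P: "Pc sc Y K u v w a (p - a) = ?P a" for a by (simp add: Pc_eq_times_z_pow)
  have "?P k = 0" if "k \<notin> {N..p - N}" for k
    using N that unfolding P[symmetric] by auto
  then show ?thesis
    using sum_exp_pairing[OF pair, of "{N..p - N}" M c] M
    by (simp add: phiR_def P fps_exp_minus_1_power_nth)
qed

definition phi_associative :: "(tv \<Rightarrow> 'w formal_field) \<Rightarrow> nat \<Rightarrow> tv \<Rightarrow> tv \<Rightarrow> bool" where
  "phi_associative Y K u v \<longleftrightarrow> (\<forall>w.
    (\<exists>N. \<forall>a b. a < N \<or> b < N \<longrightarrow> Pc sc Y K u v w a b = 0) \<and>
    (\<forall>N M. (\<forall>a b. a < N \<or> b < N \<longrightarrow> Pc sc Y K u v w a b = 0) \<longrightarrow> (\<forall>j\<ge>M. Yv u j v \<sim> 0) \<longrightarrow>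
      (\<forall>c p. phiL sc Yv Y K u v w M c p = phiR sc Y K u v w N c p)))"

lemma phi_associative_field_of:
  assumes uv: "Fin u" "Fin v" "local_order K (field_of u) (field_of v)"
  shows "phi_associative field_of K u v"
  unfolding phi_associative_def
proof (intro allI conjI impI)
  fix w
  show "\<exists>N. \<forall>a b. a < N \<or> b < N \<longrightarrow> Pc sc field_of K u v w a b = 0"
    using left_series_support[OF is_field_field_of is_field_field_of uv(3), of w]
    unfolding Pc_eq_times_z_pow by (metis diff_add_cancel add_diff_cancel_left')
  fix N M c p
  assume N: "\<forall>a b. a < N \<or> b < N \<longrightarrow> Pc sc field_of K u v w a b = 0" and M: "\<forall>j\<ge>M. Yv u j v \<sim> 0"
  let ?L = "left_series (field_of u) (field_of v) (p - int K) w"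
    and ?R = "right_series (field_of u) (field_of v) (p - int K) w"
  have Yv: "field_of (Yv u j v) (p - int K) w = pairing (log_y powi j) ?L ?R" for j
    using uv by (simp add: field_of_Yv field_product_def)
  have zero: "field_of (Yv u j v) (p - int K) w = 0" if "j \<ge> M" for j
    using field_of_cong[of "Yv u j v" 0] M that uv by (simp add: Fin_Yv Fin_zero field_of_zero)
  have "local_pair K ?L ?R" using uv(3) by (simp add: local_order_iff_local_pair is_field_field_of)
  from sum_ek_pairing_eq_phiR[OF this N, of M c] zero
  show "phiL sc Yv field_of K u v w M c p = phiR sc field_of K u v w N c p"
    by (simp add: phiL_def Yv)
qed

lemma phi_coord_module_field_of: "phi_coord_module sc l1 l2 l3 l4 Yv field_of"
proof -
  have associative: "\<exists>K. phi_associative field_of K u v" if "Fin u" "Fin v" for u v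
    using that phi_associative_field_of mutually_local_field_of unfolding mutually_local_def by blast
  have truncation: "\<exists>N. \<forall>k<N. field_of u k w = 0" for u w
    by (rule is_field_boundE[OF is_field_field_of]) blast
  show ?thesis
    unfolding phi_coord_module_def Let_def phi_associative_def[symmetric]
    by (intro conjI allI impI) ((rule associative truncation field_of_cong; assumption) |
        simp add: field_of_add field_of_smul field_of_vac fscale_def id_field_def field_add
          field_scale is_field_field_of)+
qed

lemma gen_fields_field_of: "gen_fields tact eact field_of"
  by (simp add: gen_fields_def field_of_generators T_field_def E_field_def)

lemma phi_coord_module_linear:
  assumes "phi_coord_module sc l1 l2 l3 l4 Yv Y"
  shows "\<And>u v. Fin u \<Longrightarrow> Fin v \<Longrightarrow> u \<sim> v \<Longrightarrow> Y u = Y v"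
    and "\<And>u v. Fin u \<Longrightarrow> Fin v \<Longrightarrow> Y (u + v) = Y u + Y v"
    and "\<And>c u. Fin u \<Longrightarrow> Y (smul c u) = fscale c (Y u)"
    and "Y vac = id_field"
  using assms unfolding phi_coord_module_def Let_def
  by (elim conjE; simp add: fun_eq_iff fscale_def id_field_def)+

lemma phi_coord_module_is_field:
  assumes "phi_coord_module sc l1 l2 l3 l4 Yv Y" "Fin u"
  shows "is_field (Y u)"
proof -
  have "\<exists>N. \<forall>k<N. Y u k w = 0" for w
    using assms unfolding phi_coord_module_def Let_def by (elim conjE) simp
  then have "vanishes Lower (\<lambda>k. Y u k w)" for w
    by (simp add: vanishes_def vanishes_beyond_def Ball_def)
  moreover have "endo (Y u k)" for k
    using assms unfolding phi_coord_module_def Let_def by (elim conjE, intro endoI) simp_all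
  ultimately show ?thesis by (simp add: is_field_def)
qed

lemma phi_coord_module_associative [rule_format]:
  assumes "phi_coord_module sc l1 l2 l3 l4 Yv Y"
  shows "\<forall>u v. Fin u \<longrightarrow> Fin v \<longrightarrow> (\<exists>K. phi_associative Y K u v)"
  using assms unfolding phi_coord_module_def Let_def phi_associative_def by (elim conjE)

lemma phi_coord_module_Yv:
  assumes Y: "phi_coord_module sc l1 l2 l3 l4 Yv Y" and Fin: "Fin u" "Fin v"
  shows "\<exists>K R. local_pair K (left_series (Y u) (Y v) p w) R \<and>
    (\<forall>j. Y (Yv u j v) p w = pairing (log_y powi j) (left_series (Y u) (Y v) p w) R)"
proof -
  let ?L = "left_series (Y u) (Y v) p w"
  obtain K where K: "phi_associative Y K u v" using phi_coord_module_associative[OF Y Fin] ..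
  then obtain N where N: "\<forall>a b. a < N \<or> b < N \<longrightarrow> Pc sc Y K u v w a b = 0"
    unfolding phi_associative_def by blast
  obtain M where "\<forall>j\<ge>M. Yv u j v \<sim> 0" using Yv_truncation[OF Fin] by blast
  then have M: "\<forall>j\<ge>max M (int K). Yv u j v \<sim> 0" by simp
  note fields = phi_coord_module_is_field[OF Y]
  have "(times_z ^^ K) ?L a = Pc sc Y K u v w a (p + int K - a)" for a
    by (simp add: Pc_eq_times_z_pow)
  then have "vanishes_beyond Lower N ((times_z ^^ K) ?L)" using N by (simp add: vanishes_beyond_def)
  then obtain R where R: "local_pair K ?L R"
    using ex_local_pair[OF vanishes_left_series vanishesI] fields Fin by blast
  define f where "f j = Y (Yv u j v) p w - pairing (log_y powi j) ?L R" for j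
  have high: "pairing (log_y powi j) ?L R = 0" if "j \<ge> max M (int K)" for j
    by (rule pairing_eq_0[OF R log_y_powi_nth_below]) (use that in simp)
  have "f j = 0" for j
  proof (rule exp_minus_1_power_triangular[of "max M (int K)" f K])
    fix j assume j: "j \<ge> max M (int K)"
    have "Y (Yv u j v) = Y (smul 0 vac)"
      unfolding smul_zero using M j Fin
      by (intro phi_coord_module_linear(1)[OF Y] Fin_Yv Fin_zero) simp_all
    then show "f j = 0"
      using high[OF j] by (simp add: f_def phi_coord_module_linear(3)[OF Y Fin_vac] fscale_def)
  next
    fix c
    have "phiL sc Yv Y K u v w (max M (int K)) c (p + int K) = phiR sc Y K u v w N c (p + int K)"
      using K N M unfolding phi_associative_def by blast
    then show "(\<Sum>j\<in>{-c-1..<max M (int K)}. sc ((fps_exp 1 - 1) ^ K $ nat (c + j + 1)) (f j)) = 0"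
      using sum_ek_pairing_eq_phiR[of K Y u v "p + int K" w R N "max M (int K)" c] R N high
      by (simp add: phiL_def f_def fps_exp_minus_1_power_nth scale_right_diff_distrib sum_subtractf)
  qed
  with R show ?thesis by (auto simp: f_def)
qed

lemma phi_coord_module_Yv_determined:
  assumes "phi_coord_module sc l1 l2 l3 l4 Yv Y" "phi_coord_module sc l1 l2 l3 l4 Yv Y'"
    and "Fin u" "Fin v" "Y u = Y' u" "Y v = Y' v"
  shows "Y (Yv u j v) = Y' (Yv u j v)"
proof (intro ext)
  fix p w
  show "Y (Yv u j v) p w = Y' (Yv u j v) p w"
    using phi_coord_module_Yv[OF assms(1,3,4), of p w] phi_coord_module_Yv[OF assms(2,3,4), of p w]
        local_pair_unique
    unfolding assms(5,6) by metis
qed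

theorem phi_coord_module_unique:
  assumes Y: "phi_coord_module sc l1 l2 l3 l4 Yv Y" "phi_coord_module sc l1 l2 l3 l4 Yv Y'"
    and generators: "gen_fields tact eact Y" "gen_fields tact eact Y'" and "Fin u"
  shows "Y u = Y' u"
  using \<open>Fin u\<close>
proof (induction u rule: V_induct)
  case (product a n v)
  have "Y a = Y' a"
    using generators product(1) by (auto simp: gen_fields_def V_generators_def fun_eq_iff)
  then show ?case
    by (rule phi_coord_module_Yv_determined[OF Y Fin_V_generators[OF product(1)] product(2) _
        product(3)])
next
  case (veq u v)
  then show ?case using phi_coord_module_linear(1)[OF Y(1)] phi_coord_module_linear(1)[OF Y(2)]
    by metis
qed (simp_all only: phi_coord_module_linear[OF Y(1)] phi_coord_module_linear[OF Y(2)])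

end

theorem theorem4p5:
  fixes sc :: "complex \<Rightarrow> 'w::ab_group_add \<Rightarrow> 'w"
    and tact eact :: "int \<Rightarrow> int \<Rightarrow> 'w \<Rightarrow> 'w"
    and l1 l2 l3 l4 :: complex
    and Yv :: "tv \<Rightarrow> int \<Rightarrow> tv \<Rightarrow> tv"
  assumes "vector_space sc"
    and "restricted_Lstar_module sc l1 l2 l3 l4 tact eact"
    and "is_V_structure l1 l2 l3 l4 Yv"
  shows "(\<exists>YW. phi_coord_module sc l1 l2 l3 l4 Yv YW \<and> gen_fields tact eact YW) \<and>
         (\<forall>YW1 YW2. phi_coord_module sc l1 l2 l3 l4 Yv YW1 \<and> gen_fields tact eact YW1 \<and>
                    phi_coord_module sc l1 l2 l3 l4 Yv YW2 \<and> gen_fields tact eact YW2 \<longrightarrow>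
                    (\<forall>u. Fin u \<longrightarrow> YW1 u = YW2 u))"
proof -
  interpret vector_space sc by fact
  interpret Lstar_V_module sc l1 l2 l3 l4 tact eact Yv
    by unfold_locales fact+
  show ?thesis
    using phi_coord_module_field_of gen_fields_field_of phi_coord_module_unique by blast
qed

end
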